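(* Let $F$ be a $C^\infty$ vector field on a smooth manifold $M$. Suppose that every singular point $z\in\Sigma_F$ has an open neighbourhood $V\subset M$ such that $Sh(\mathbf{F},V)=\mathcal{E}_{\mathrm{id}}(\mathbf{F},V)^{\infty}$ and the shift map $\varphi_V$ of $F$ on $V$ satisfies the smooth path-lifting condition. Then $F$ is parameter rigid.
   Context: Let $M$ be a smooth manifold and $F$ a $C^\infty$ vector field on $M$ tangent to $\partial M$; $\Sigma_F$ denotes the set of singular points (zeros) of $F$. For $x\in M$ let $\gamma_x:(a_x,b_x)\to M$ be the maximal integral curve of $F$ with $\gamma_x(0)=x$. Put $\mathsf{dom}(\mathbf{F})=\bigcup_{x\in M}\{x\}\times(a_x,b_x)\subset M\times\mathbb{R}$; the local flow of $F$ is $\mathbf{F}:\mathsf{dom}(\mathbf{F})\to M$, $\mathbf{F}(x,t)=\gamma_x(t)$. For open $V\subset M$ let $\mathsf{func}(\mathbf{F},V)$ be the set of $\alpha\in C^\infty(V,\mathbb{R})$ whose graph $\{(x,\alpha(x)):x\in V\}$ lies in $\mathsf{dom}(\mathbf{F})$. The shift map of $F$ on $V$ is $\varphi_V:\mathsf{func}(\mathbf{F},V)\to C^\infty(V,M)$, $\varphi_V(\alpha)(x)=\mathbf{F}(x,\alpha(x))$, and $Sh(\mathbf{F},V)$ denotes its image. $\mathcal{E}(\mathbf{F},V)\subset C^\infty(V,M)$ is the set of smooth maps $h:V\to M$ such that $h(\omega\cap V)\subset\omega$ for every orbit $\omega$ of $F$ and $h$ is a local diffeomorphism at every $z\in\Sigma_F\cap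 V$. For $0\le r\le\infty$, $\mathcal{E}_{\mathrm{id}}(\mathbf{F},V)^{r}$ is the path component of the inclusion $i_V:V\subset M$ in $\mathcal{E}(\mathbf{F},V)$ with respect to the weak Whitney topology $C^r_W$. Smooth path-lifting condition: let $V\subset M$ be open with $\Sigma_F$ nowhere dense in $V$, and $I=[0,1]$. For every $\alpha_0\in\mathsf{func}(\mathbf{F},V)$ and every $C^\infty$ homotopy $H:V\times I\to M$ with $H_0=\varphi_V(\alpha_0)$ and $H_t\in Sh(\mathbf{F},V)$ for all $t\in I$, there is a unique $C^\infty$ function $\Lambda:(V\setminus\Sigma_F)\times I\to\mathbb{R}$ with $\Lambda(x,0)=\alpha_0(x)$ and $H(x,t)=\mathbf{F}(x,\Lambda(x,t))$ for all $(x,t)\in(V\setminus\Sigma_F)\times I$. The shift map $\varphi_V$ satisfies the smooth path-lifting condition if (for such $V$, with $\Sigma_F$ nowhere dense in $V$) for all such $\alpha_0$ and $H$ this function $\Lambda$ extends to a $C^\infty$ function on all of $V\times I$. $F$ is parameter rigid if for every $C^\infty$ vector field $G$ on $M$ such that every orbit of $G$ is contained in some orbit of $F$ there exists a $C^\infty$ function $\alpha:M\to\mathbb{R}$ with $G=\alpha F$. *)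

theory Defs
  imports "HOL-Analysis.Analysis" "HOL-Library.Extended_Nat"
begin

section \<open>Smooth maps between subsets of Euclidean spaces\<close>

primrec Ck_on :: "nat \<Rightarrow> 'a::euclidean_space set \<Rightarrow> ('a \<Rightarrow> 'b::euclidean_space) \<Rightarrow> bool" where
  "Ck_on 0 U f \<longleftrightarrow> continuous_on U f"
| "Ck_on (Suc k) U f \<longleftrightarrow> (\<forall>x\<in>U. f differentiable (at x)) \<and>
     (\<forall>v. Ck_on k U (\<lambda>x. frechet_derivative f (at x) v))"

text \<open>On an arbitrary subset of a Euclidean space, smooth means: locally the restriction
  of a smooth map defined on an open set.\<close>

definition smooth_on :: "'a::euclidean_space set \<Rightarrow> ('a \<Rightarrow> 'b::euclidean_space) \<Rightarrow> bool" where
  "smooth_on S f \<longleftrightarrow> (\<forall>p\<in>S. \<exists>U g. open U \<and> p \<in> U \<and> (\<forall>k. Ck_on k U g) \<and> (\<forall>q\<in>S \<inter> U. g q = f q))"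

text \<open>\<open>partials S vs f\<close> is the iterated directional derivative of \<open>f\<close> in the directions \<open>vs\<close>,
  taken within \<open>S\<close>.  It is used only for \<open>S\<close> relatively open in a closed half-space,
  where derivatives within \<open>S\<close> are unique, also at boundary points.\<close>

primrec partials ::
  "'a::euclidean_space set \<Rightarrow> 'a list \<Rightarrow> ('a \<Rightarrow> 'b::euclidean_space) \<Rightarrow> 'a \<Rightarrow> 'b" where
  "partials S [] f = f"
| "partials S (v # vs) f = (\<lambda>x. frechet_derivative (partials S vs f) (at x within S) v)"


section \<open>Smooth manifolds with boundary\<close>

text \<open>The manifold is the whole type \<open>'m\<close>.  A chart is a pair of its domain and a map that
  matters only on this domain.  Charts take values in the closed half-space determined by a
  basis vector \<open>b\<close>; the boundary may be empty.\<close>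

type_synonym ('m, 'e) chart = "'m set \<times> ('m \<Rightarrow> 'e)"

definition half_space :: "'e::euclidean_space \<Rightarrow> 'e set" where
  "half_space b = {v. 0 \<le> v \<bullet> b}"

definition is_chart :: "'e::euclidean_space \<Rightarrow> ('m::topological_space, 'e) chart \<Rightarrow> bool" where
  "is_chart b c \<longleftrightarrow> open (fst c) \<and> openin (top_of_set (half_space b)) (snd c ` fst c) \<and>
     homeomorphism (fst c) (snd c ` fst c) (snd c) (inv_into (fst c) (snd c))"

definition local_rep :: "('m, 'e) chart \<Rightarrow> ('n, 'f) chart \<Rightarrow> ('m \<Rightarrow> 'n) \<Rightarrow> 'e \<Rightarrow> 'f" where
  "local_rep c d h = snd d \<circ> h \<circ> inv_into (fst c) (snd c)"

text \<open>A smooth structure is given by any (not necessarily maximal) smooth atlas.\<close>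

definition smooth_manifold ::
  "'e::euclidean_space \<Rightarrow> ('m::{t2_space,second_countable_topology}, 'e) chart set \<Rightarrow> bool" where
  "smooth_manifold b A \<longleftrightarrow> b \<in> Basis \<and> (\<forall>c\<in>A. is_chart b c) \<and> (\<Union>c\<in>A. fst c) = UNIV \<and>
     (\<forall>c\<in>A. \<forall>d\<in>A. smooth_on (snd c ` (fst c \<inter> fst d)) (local_rep c d id))"

definition manifold_boundary :: "'e::euclidean_space \<Rightarrow> ('m, 'e) chart set \<Rightarrow> 'm set" where
  "manifold_boundary b A = {x. \<exists>c\<in>A. x \<in> fst c \<and> snd c x \<bullet> b = 0}"

definition euclidean_atlas :: "('e, 'e) chart set" where
  "euclidean_atlas = {(UNIV, id)}"

text \<open>The product atlas on \<open>M \<times> \<real>\<close>.\<close>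

definition cylinder_atlas :: "('m, 'e) chart set \<Rightarrow> ('m \<times> real, 'e \<times> real) chart set" where
  "cylinder_atlas A = (\<lambda>c. (fst c \<times> UNIV, map_prod (snd c) id)) ` A"

text \<open>\<open>W\<close> need not be open: it is also taken to be of the form \<open>V \<times> {0..1}\<close>.\<close>

definition smooth_map ::
  "('m::topological_space, 'e::euclidean_space) chart set \<Rightarrow>
   ('n::topological_space, 'f::euclidean_space) chart set \<Rightarrow> 'm set \<Rightarrow> ('m \<Rightarrow> 'n) \<Rightarrow> bool" where
  "smooth_map A B W h \<longleftrightarrow> continuous_on W h \<and>
     (\<forall>c\<in>A. \<forall>d\<in>B. smooth_on (snd c ` {x \<in> fst c \<inter> W. h x \<in> fst d}) (local_rep c d h))"

text \<open>Elements of function spaces are made unique by being \<open>undefined\<close> outside \<open>V\<close>.\<close>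

definition smooth_maps ::
  "('m::topological_space, 'e::euclidean_space) chart set \<Rightarrow>
   ('n::topological_space, 'f::euclidean_space) chart set \<Rightarrow> 'm set \<Rightarrow> ('m \<Rightarrow> 'n) set" where
  "smooth_maps A B V = {h \<in> extensional V. smooth_map A B V h}"

definition local_diffeo_at ::
  "('m::topological_space, 'e::euclidean_space) chart set \<Rightarrow> 'm set \<Rightarrow> ('m \<Rightarrow> 'm) \<Rightarrow> 'm \<Rightarrow> bool" where
  "local_diffeo_at A V h z \<longleftrightarrow> (\<exists>U. open U \<and> z \<in> U \<and> U \<subseteq> V \<and> open (h ` U) \<and> inj_on h U \<and>
     smooth_map A A U h \<and> smooth_map A A (h ` U) (inv_into U h))"


section \<open>Vector fields and flows\<close>

text \<open>A tangent vector at \<open>x\<close> is represented by its coordinate vectors in all charts around \<open>x\<close>,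
  which are related by the derivatives of the coordinate changes; the remaining
  entries are 0.\<close>

definition tangent_space ::
  "('m, 'e::euclidean_space) chart set \<Rightarrow> 'm \<Rightarrow> (('m, 'e) chart \<Rightarrow> 'e) set" where
  "tangent_space A x = {v.
     (\<forall>c\<in>A. \<forall>d\<in>A. x \<in> fst c \<longrightarrow> x \<in> fst d \<longrightarrow>
        v d = frechet_derivative (local_rep c d id)
                (at (snd c x) within snd c ` (fst c \<inter> fst d)) (v c)) \<and>
     (\<forall>c. \<not> (c \<in> A \<and> x \<in> fst c) \<longrightarrow> v c = 0)}"

type_synonym ('m, 'e) vector_field = "'m \<Rightarrow> ('m, 'e) chart \<Rightarrow> 'e"

definition smooth_vector_field ::
  "('m, 'e::euclidean_space) chart set \<Rightarrow> ('m, 'e) vector_field \<Rightarrow> bool" where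
  "smooth_vector_field A X \<longleftrightarrow> (\<forall>x. X x \<in> tangent_space A x) \<and>
     (\<forall>c\<in>A. smooth_on (snd c ` fst c) (\<lambda>y. X (inv_into (fst c) (snd c) y) c))"

definition tangent_to_boundary ::
  "'e::euclidean_space \<Rightarrow> ('m, 'e) chart set \<Rightarrow> ('m, 'e) vector_field \<Rightarrow> bool" where
  "tangent_to_boundary b A X \<longleftrightarrow>
     (\<forall>x\<in>manifold_boundary b A. \<forall>c\<in>A. x \<in> fst c \<longrightarrow> X x c \<bullet> b = 0)"

definition singular_set :: "('m, 'e::euclidean_space) vector_field \<Rightarrow> 'm set" where
  "singular_set X = {x. X x = (\<lambda>c. 0)}"

definition integral_curve ::
  "('m::topological_space, 'e::euclidean_space) chart set \<Rightarrow> ('m, 'e) vector_field \<Rightarrow>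
   real set \<Rightarrow> (real \<Rightarrow> 'm) \<Rightarrow> bool" where
  "integral_curve A X J \<gamma> \<longleftrightarrow> is_interval J \<and> continuous_on J \<gamma> \<and>
     (\<forall>t\<in>J. \<forall>c\<in>A. \<gamma> t \<in> fst c \<longrightarrow>
        ((snd c \<circ> \<gamma>) has_vector_derivative X (\<gamma> t) c) (at t within J))"

text \<open>The domain of the maximal integral curve through \<open>x\<close> is the union of the domains of all
  integral curves through \<open>x\<close>.  If \<open>X\<close> is tangent to the boundary, it is an open interval.
  Arbitrary intervals are admitted so that orbits also make sense for fields
  that are not tangent to the boundary.\<close>

definition max_interval ::
  "('m::topological_space, 'e::euclidean_space) chart set \<Rightarrow> ('m, 'e) vector_field \<Rightarrow> 'm \<Rightarrow> real set" where
  "max_interval A X x = \<Union>{J. \<exists>\<gamma>. integral_curve A X J \<gamma> \<and> 0 \<in> J \<and> \<gamma> 0 = x}"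

definition flow ::
  "('m::topological_space, 'e::euclidean_space) chart set \<Rightarrow> ('m, 'e) vector_field \<Rightarrow> 'm \<Rightarrow> real \<Rightarrow> 'm" where
  "flow A X x t =
     (THE y. \<exists>J \<gamma>. integral_curve A X J \<gamma> \<and> 0 \<in> J \<and> \<gamma> 0 = x \<and> t \<in> J \<and> \<gamma> t = y)"

definition flow_domain ::
  "('m::topological_space, 'e::euclidean_space) chart set \<Rightarrow> ('m, 'e) vector_field \<Rightarrow> ('m \<times> real) set" where
  "flow_domain A X = (SIGMA x:UNIV. max_interval A X x)"

definition orbit ::
  "('m::topological_space, 'e::euclidean_space) chart set \<Rightarrow> ('m, 'e) vector_field \<Rightarrow> 'm \<Rightarrow> 'm set" where
  "orbit A X x = flow A X x ` max_interval A X x"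


section \<open>The shift map\<close>

definition shift_functions ::
  "('m::topological_space, 'e::euclidean_space) chart set \<Rightarrow> ('m, 'e) vector_field \<Rightarrow> 'm set \<Rightarrow>
   ('m \<Rightarrow> real) set" where
  "shift_functions A F V =
     {\<alpha> \<in> smooth_maps A euclidean_atlas V. \<forall>x\<in>V. (x, \<alpha> x) \<in> flow_domain A F}"

definition shift_map ::
  "('m::topological_space, 'e::euclidean_space) chart set \<Rightarrow> ('m, 'e) vector_field \<Rightarrow> 'm set \<Rightarrow>
   ('m \<Rightarrow> real) \<Rightarrow> 'm \<Rightarrow> 'm" where
  "shift_map A F V \<alpha> = (\<lambda>x\<in>V. flow A F x (\<alpha> x))"

definition Sh ::
  "('m::topological_space, 'e::euclidean_space) chart set \<Rightarrow> ('m, 'e) vector_field \<Rightarrow> 'm set \<Rightarrow>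
   ('m \<Rightarrow> 'm) set" where
  "Sh A F V = shift_map A F V ` shift_functions A F V"


section \<open>Weak Whitney topologies and the identity path component\<close>

definition whitney_nbhd ::
  "('m::topological_space, 'e::euclidean_space) chart set \<Rightarrow> 'm set \<Rightarrow> ('m \<Rightarrow> 'm) \<Rightarrow>
   ('m, 'e) chart \<Rightarrow> ('m, 'e) chart \<Rightarrow> 'm set \<Rightarrow> nat \<Rightarrow> real \<Rightarrow> ('m \<Rightarrow> 'm) set" where
  "whitney_nbhd A V f c d K m \<epsilon> = {g \<in> smooth_maps A A V. g ` K \<subseteq> fst d \<and>
     (\<forall>x\<in>K. \<forall>vs. set vs \<subseteq> Basis \<and> length vs \<le> m \<longrightarrow>
        norm (partials (snd c ` (fst c \<inter> V)) vs (local_rep c d f) (snd c x)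
            - partials (snd c ` (fst c \<inter> V)) vs (local_rep c d g) (snd c x)) < \<epsilon>)}"

text \<open>For \<open>r = \<infinity>\<close> this is the join of the topologies for finite \<open>r\<close>.\<close>

definition whitney_topology ::
  "('m::topological_space, 'e::euclidean_space) chart set \<Rightarrow> enat \<Rightarrow> 'm set \<Rightarrow> ('m \<Rightarrow> 'm) topology" where
  "whitney_topology A r V = topology_generated_by
     {whitney_nbhd A V f c d K m \<epsilon> | f c d K m \<epsilon>.
        f \<in> smooth_maps A A V \<and> c \<in> A \<and> d \<in> A \<and> compact K \<and> K \<subseteq> fst c \<inter> V \<and>
        f ` K \<subseteq> fst d \<and> enat m \<le> r \<and> 0 < \<epsilon>}"

definition \<E> ::
  "('m::topological_space, 'e::euclidean_space) chart set \<Rightarrow> ('m, 'e) vector_field \<Rightarrow> 'm set \<Rightarrow>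
   ('m \<Rightarrow> 'm) set" where
  "\<E> A F V = {h \<in> smooth_maps A A V.
     (\<forall>x. h ` (orbit A F x \<inter> V) \<subseteq> orbit A F x) \<and>
     (\<forall>z\<in>singular_set F \<inter> V. local_diffeo_at A V h z)}"

definition \<E>_id ::
  "('m::topological_space, 'e::euclidean_space) chart set \<Rightarrow> ('m, 'e) vector_field \<Rightarrow> 'm set \<Rightarrow> enat \<Rightarrow>
   ('m \<Rightarrow> 'm) set" where
  "\<E>_id A F V r =
     path_component_of_set (subtopology (whitney_topology A r V) (\<E> A F V)) (restrict id V)"


section \<open>Smooth path-lifting and parameter rigidity\<close>

definition shift_lift ::
  "('m::topological_space, 'e::euclidean_space) chart set \<Rightarrow> ('m, 'e) vector_field \<Rightarrow> 'm set \<Rightarrow>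
   ('m \<Rightarrow> real) \<Rightarrow> ('m \<times> real \<Rightarrow> 'm) \<Rightarrow> ('m \<times> real \<Rightarrow> real) \<Rightarrow> bool" where
  "shift_lift A F V \<alpha>\<^sub>0 H \<Lambda> \<longleftrightarrow>
     smooth_map (cylinder_atlas A) euclidean_atlas ((V - singular_set F) \<times> {0..1}) \<Lambda> \<and>
     (\<forall>x\<in>V - singular_set F. \<Lambda> (x, 0) = \<alpha>\<^sub>0 x) \<and>
     (\<forall>x\<in>V - singular_set F. \<forall>t\<in>{0..1}.
        (x, \<Lambda> (x, t)) \<in> flow_domain A F \<and> H (x, t) = flow A F x (\<Lambda> (x, t)))"

text \<open>Off the singular set the lift exists and is unique, so quantifying over
  all lifts refers to this one function.\<close>

definition smooth_path_lifting ::
  "('m::topological_space, 'e::euclidean_space) chart set \<Rightarrow> ('m, 'e) vector_field \<Rightarrow> 'm set \<Rightarrow> bool" where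
  "smooth_path_lifting A F V \<longleftrightarrow>
     interior (closure (singular_set F \<inter> V)) \<inter> V = {} \<and>
     (\<forall>\<alpha>\<^sub>0\<in>shift_functions A F V. \<forall>H.
        smooth_map (cylinder_atlas A) A (V \<times> {0..1}) H \<and>
        (\<lambda>x\<in>V. H (x, 0)) = shift_map A F V \<alpha>\<^sub>0 \<and>
        (\<forall>t\<in>{0..1}. (\<lambda>x\<in>V. H (x, t)) \<in> Sh A F V) \<longrightarrow>
        (\<forall>\<Lambda>. shift_lift A F V \<alpha>\<^sub>0 H \<Lambda> \<longrightarrow>
           (\<exists>\<Lambda>'. smooth_map (cylinder_atlas A) euclidean_atlas (V \<times> {0..1}) \<Lambda>' \<and>
              (\<forall>p\<in>(V - singular_set F) \<times> {0..1}. \<Lambda>' p = \<Lambda> p))))"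

definition parameter_rigid ::
  "('m::topological_space, 'e::euclidean_space) chart set \<Rightarrow> ('m, 'e) vector_field \<Rightarrow> bool" where
  "parameter_rigid A F \<longleftrightarrow>
     (\<forall>G. smooth_vector_field A G \<and> (\<forall>x. \<exists>y. orbit A G x \<subseteq> orbit A F y) \<longrightarrow>
        (\<exists>\<alpha>::'m \<Rightarrow> real. smooth_map A euclidean_atlas UNIV \<alpha> \<and> (\<forall>x. G x = (\<lambda>c. \<alpha> x *\<^sub>R F x c))))"

end

theory Submission
  imports Defs
begin

text \<open>
  Let the orbits of \<open>G\<close> lie in orbits of \<open>F\<close>, and let \<open>\<Sigma>\<close> be the singular set of \<open>F\<close>.
  An \<open>F\<close>-orbit is a countable union of compact arcs, so by Baire's theorem some piece of each integral curve
  of \<open>G\<close> lies in a single arc.  Hence \<open>G\<close> is parallel to \<open>F\<close>, that is \<open>G = \<alpha> F\<close> with \<open>\<alpha>\<close> smooth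
  off \<open>\<Sigma>\<close>; moreover \<open>G\<close> is tangent to the boundary and vanishes on \<open>\<Sigma>\<close>.
  Near \<open>z \<in> \<Sigma>\<close> cut \<open>G\<close> off inside a chart contained in \<open>V\<close>.  The flow \<open>H\<^sub>t\<close> of the resulting field
  consists of diffeomorphisms of \<open>V\<close> preserving the orbits of \<open>F\<close>, and it is a path in the weak Whitney topology;
  hence \<open>H\<^sub>t\<close> lies in the identity path component, that is, in the image of the shift map.
  Off \<open>\<Sigma>\<close> the lift of \<open>H\<close> starting at 0 is \<open>\<Lambda>(x, t) = \<integral>\<^sub>0\<^sup>t \<alpha>(H\<^sub>s(x)) ds\<close>.
  The path-lifting condition extends it smoothly over \<open>\<Sigma>\<close>, and so
  \<open>\<alpha> = \<partial>\<Lambda>/\<partial>t\<close> at \<open>t = 0\<close> extends smoothly as well.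
\<close>

section \<open>Calculus of \<open>C\<^sup>k\<close> functions\<close>

text \<open>A curve contained in an orbit of \<open>F\<close> is not tangent to \<open>F\<close> for
  free: orbits are in general only immersed and may come back arbitrarily close to themselves, so a
  category argument must precede any comparison of derivatives. Smoothness on a half-space means
  having smooth extensions; differential equations are therefore solved for extended, compactly
  supported fields on the whole Euclidean space, and tangency to the boundary hyperplane brings the
  solutions back into the half-space. \<open>G\<close> is not assumed tangent to the boundary, so
  this too must be extracted from its orbits. The cut-off is there because \<open>G\<close> may be
  incomplete and its curves may leave \<open>V\<close>; multiplying by a function keeps the field
  parallel to \<open>F\<close>, and its flow acts on \<open>V\<close> for all times. As the lift
  lives on times in \<open>{0..1}\<close>, its derivative at 0 is one-sided. The local quotients
  agree off \<Sigma>, and since \<Sigma> is nowhere dense near each of its points, their values on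
  \<Sigma> are forced as limits; hence they glue.\<close>

lemma Ck_on_subset: "Ck_on k U f \<Longrightarrow> V \<subseteq> U \<Longrightarrow> Ck_on k V f"
  by (induction k arbitrary: f) (auto intro: continuous_on_subset)

lemma Ck_on_SucD: "Ck_on (Suc k) U f \<Longrightarrow> Ck_on k U f"
proof (induction k arbitrary: f)
  case 0
  then show ?case
    by (auto intro!: continuous_at_imp_continuous_on differentiable_imp_continuous_within)
next
  case (Suc k)
  then show ?case by (metis Ck_on.simps(2))
qed

lemma Ck_on_imp_continuous_on: "Ck_on k U f \<Longrightarrow> continuous_on U f"
proof (induction k)
  case (Suc k)
  then show ?case using Ck_on_SucD by blast
qed simp

lemma Ck_on_has_derivative:
  "Ck_on (Suc k) U f \<Longrightarrow> x \<in> U \<Longrightarrow> (f has_derivative frechet_derivative f (at x)) (at x)"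
  by (simp add: frechet_derivative_works)

lemma Ck_on_SucD2: "Ck_on (Suc k) U f \<Longrightarrow> Ck_on k U (\<lambda>x. frechet_derivative f (at x) v)"
  by simp

text \<open>\<open>frechet_derivative f (at x)\<close> sees \<open>f\<close> on a full neighbourhood
  of \<open>x\<close>, so agreement on \<open>U\<close> carries over to derivatives because
  \<open>U\<close> is open.\<close>

lemma Ck_on_cong:
  assumes "open U" "\<And>x. x \<in> U \<Longrightarrow> f x = g x" "Ck_on k U f"
  shows "Ck_on k U g"
  using assms
proof (induction k arbitrary: f g)
  case 0
  then show ?case by (auto intro: continuous_on_eq)
next
  case (Suc k)
  have *: "(g has_derivative frechet_derivative f (at x)) (at x)" if "x \<in> U" for x
    using Ck_on_has_derivative[OF Suc.prems(3) that] has_derivative_transform_within_open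
      \<open>open U\<close> that Suc.prems(2) by blast
  have "frechet_derivative g (at x) = frechet_derivative f (at x)" if "x \<in> U" for x
    using frechet_derivative_at[OF *[OF that]] by simp
  moreover have "Ck_on k U (\<lambda>x. frechet_derivative f (at x) v)" for v
    using Suc.prems(3) by simp
  ultimately have "Ck_on k U (\<lambda>x. frechet_derivative g (at x) v)" for v
    using Suc.IH[OF \<open>open U\<close>, of "\<lambda>x. frechet_derivative f (at x) v"] by simp
  then show ?case using * by (auto simp: differentiable_def)
qed

text \<open>Admits an explicit derivative \<open>D\<close>, to which the smoothness rules apply, in
  place of the choice term \<open>frechet_derivative\<close>.\<close>

lemma Ck_on_Suc_intro:
  assumes "open U" "\<And>x. x \<in> U \<Longrightarrow> (f has_derivative D x) (at x)" "\<And>v. Ck_on k U (\<lambda>x. D x v)"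
  shows "Ck_on (Suc k) U f"
proof -
  have "frechet_derivative f (at x) = D x" if "x \<in> U" for x
    using frechet_derivative_at[OF assms(2)[OF that]] by simp
  then have "Ck_on k U (\<lambda>x. frechet_derivative f (at x) v)" for v
    using Ck_on_cong[OF assms(1) _ assms(3)[of v]] by simp
  then show ?thesis using assms(2) by (auto simp: differentiable_def)
qed

lemma Ck_on_local:
  assumes "\<And>x. x \<in> U \<Longrightarrow> \<exists>V. open V \<and> x \<in> V \<and> Ck_on k V f"
  shows "Ck_on k U f"
  using assms
proof (induction k arbitrary: f)
  case 0
  then show ?case
    by (auto intro!: continuous_at_imp_continuous_on) (metis continuous_on_eq_continuous_at)
next
  case (Suc k)
  then show ?case by (simp, metis)
qed

lemma Ck_on_const: "Ck_on k U (\<lambda>x. c)"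
proof (induction k arbitrary: c)
  case (Suc k)
  then show ?case by simp
qed simp

lemma Ck_on_linear:
  assumes "bounded_linear f"
  shows "Ck_on k U f"
proof (cases k)
  case 0
  then show ?thesis using assms by (auto intro: linear_continuous_on)
next
  case (Suc j)
  have "(f has_derivative f) (at x)" for x
    using assms by (rule bounded_linear_imp_has_derivative)
  then have "Ck_on (Suc j) UNIV f"
    by (intro Ck_on_Suc_intro[where D="\<lambda>x. f"] Ck_on_const open_UNIV) auto
  then show ?thesis using Suc Ck_on_subset by blast
qed

lemma Ck_on_add:
  assumes "open U" "Ck_on k U f" "Ck_on k U g"
  shows "Ck_on k U (\<lambda>x. f x + g x)"
  using assms(2,3)
proof (induction k arbitrary: f g)
  case 0
  then show ?case by (auto intro: continuous_intros)
next
  case (Suc k)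
  show ?case
  proof (rule Ck_on_Suc_intro)
    show "((\<lambda>x. f x + g x) has_derivative
        (\<lambda>v. frechet_derivative f (at x) v + frechet_derivative g (at x) v)) (at x)" if "x \<in> U" for x
      by (rule has_derivative_add; rule Ck_on_has_derivative[OF _ that]; fact Suc.prems)
    show "Ck_on k U (\<lambda>x. frechet_derivative f (at x) v + frechet_derivative g (at x) v)" for v
      by (rule Suc.IH; rule Ck_on_SucD2; fact Suc.prems)
  qed (rule \<open>open U\<close>)
qed

lemma Ck_on_sum:
  assumes "open U" "\<And>i. i \<in> I \<Longrightarrow> Ck_on k U (f i)"
  shows "Ck_on k U (\<lambda>x. \<Sum>i\<in>I. f i x)"
  using assms(2)
  by (induction I rule: infinite_finite_induct) (auto intro: Ck_on_const Ck_on_add[OF assms(1)])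

text \<open>The product rule turns the derivative into a sum of two values of \<open>bop\<close>
  whose arguments are of class \<open>k\<close>, so the induction closes over all \<open>f\<close>
  and \<open>g\<close> at once.\<close>

lemma Ck_on_bilinear:
  assumes "bounded_bilinear bop" "open U" "Ck_on k U f" "Ck_on k U g"
  shows "Ck_on k U (\<lambda>x. bop (f x) (g x))"
  using assms(3,4)
proof (induction k arbitrary: f g)
  case 0
  then show ?case using bounded_bilinear.continuous_on[OF assms(1)] by auto
next
  case (Suc k)
  show ?case
  proof (rule Ck_on_Suc_intro)
    show "((\<lambda>x. bop (f x) (g x)) has_derivative (\<lambda>v. bop (f x) (frechet_derivative g (at x) v)
        + bop (frechet_derivative f (at x) v) (g x))) (at x)" if "x \<in> U" for x
      by (rule bounded_bilinear.FDERIV[OF assms(1)]; rule Ck_on_has_derivative[OF _ that]; fact Suc.prems)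
    show "Ck_on k U (\<lambda>x. bop (f x) (frechet_derivative g (at x) v)
        + bop (frechet_derivative f (at x) v) (g x))" for v
      using Suc.prems[THEN Ck_on_SucD] Suc.prems[THEN Ck_on_SucD2]
      by (intro Ck_on_add Suc.IH \<open>open U\<close>)
  qed (rule \<open>open U\<close>)
qed

lemmas Ck_on_scaleR = Ck_on_bilinear[OF bounded_bilinear_scaleR]
  and Ck_on_mult = Ck_on_bilinear[OF bounded_bilinear_mult]
  and Ck_on_inner = Ck_on_bilinear[OF bounded_bilinear_inner]

lemma linear_eq_sum_Basis:
  fixes f :: "'a::euclidean_space \<Rightarrow> 'b::real_vector"
  assumes "linear f"
  shows "f x = (\<Sum>i\<in>Basis. (x \<bullet> i) *\<^sub>R f i)"
proof -
  have "f x = f (\<Sum>i\<in>Basis. (x \<bullet> i) *\<^sub>R i)" by (simp add: euclidean_representation)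
  also have "\<dots> = (\<Sum>i\<in>Basis. (x \<bullet> i) *\<^sub>R f i)"
    using assms by (simp add: linear_sum linear_scale)
  finally show ?thesis .
qed

text \<open>In the chain rule the direction handed to the derivative of \<open>g\<close> moves with
  \<open>x\<close>, whereas \<open>Ck_on\<close> speaks of fixed directions. Expanding the direction
  in \<open>Basis\<close> leaves products of coordinate functions with derivatives of
  \<open>g\<close> in fixed directions.\<close>

lemma Ck_on_compose:
  fixes f :: "'a::euclidean_space \<Rightarrow> 'b::euclidean_space" and g :: "'b \<Rightarrow> 'c::euclidean_space"
  assumes "open U" "Ck_on k U f" "Ck_on k V g" "f ` U \<subseteq> V"
  shows "Ck_on k U (\<lambda>x. g (f x))"
  using assms(2,3)
proof (induction k arbitrary: g)
  case 0
  then show ?case using continuous_on_compose2[of V g U f] assms(4) by simp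
next
  case (Suc k)
  let ?D = "\<lambda>x v. frechet_derivative g (at (f x)) (frechet_derivative f (at x) v)"
  have f: "Ck_on k U f" using Suc.prems Ck_on_SucD by blast
  have "Ck_on k U (\<lambda>x. ?D x v)" for v
  proof (rule Ck_on_cong[OF \<open>open U\<close>])
    fix x assume "x \<in> U"
    then have "(g has_derivative frechet_derivative g (at (f x))) (at (f x))"
      using Ck_on_has_derivative Suc.prems(2) assms(4) by blast
    then have "linear (frechet_derivative g (at (f x)))"
      by (rule has_derivative_linear)
    then show "(\<Sum>i\<in>Basis. (frechet_derivative f (at x) v \<bullet> i) *\<^sub>R frechet_derivative g (at (f x)) i) = ?D x v"
      by (rule linear_eq_sum_Basis[symmetric])
  next
    show "Ck_on k U (\<lambda>x. \<Sum>i\<in>Basis. (frechet_derivative f (at x) v \<bullet> i) *\<^sub>R frechet_derivative g (at (f x)) i)"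
    proof (intro Ck_on_sum Ck_on_scaleR Ck_on_inner Ck_on_const \<open>open U\<close>)
      show "Ck_on k U (\<lambda>x. frechet_derivative g (at (f x)) i)" for i
        using Suc.IH[OF f, of "\<lambda>y. frechet_derivative g (at y) i"] Suc.prems(2) by simp
    qed (use Suc.prems(1) in simp)
  qed
  moreover have "((\<lambda>x. g (f x)) has_derivative ?D x) (at x)" if "x \<in> U" for x
  proof -
    have "f x \<in> V" using that assms(4) by blast
    then show ?thesis
      using has_derivative_compose[OF Ck_on_has_derivative[OF Suc.prems(1) that]
          Ck_on_has_derivative[OF Suc.prems(2)]] by simp
  qed
  ultimately show ?case by (rule Ck_on_Suc_intro[OF \<open>open U\<close>, rotated])
qed

lemma Ck_on_minus:
  assumes "open U" "Ck_on k U f"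
  shows "Ck_on k U (\<lambda>x. - f x)"
  using Ck_on_scaleR[OF assms(1) Ck_on_const[of k U "-1"] assms(2)] by simp

lemma Ck_on_diff:
  assumes "open U" "Ck_on k U f" "Ck_on k U g"
  shows "Ck_on k U (\<lambda>x. f x - g x)"
  using Ck_on_add[OF assms(1,2) Ck_on_minus[OF assms(1,3)]] by simp

lemma Ck_on_Pair:
  assumes "open U" "Ck_on k U f" "Ck_on k U g"
  shows "Ck_on k U (\<lambda>x. (f x, g x))"
proof -
  have "Ck_on k UNIV (\<lambda>y::'b. (y, 0::'c))" "Ck_on k UNIV (\<lambda>y::'c. (0::'b, y))"
    by (auto intro!: Ck_on_linear bounded_linear_intros)
  then have "Ck_on k U (\<lambda>x. (f x, 0::'c))" "Ck_on k U (\<lambda>x. (0::'b, g x))"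
    using Ck_on_compose[OF assms(1,2)] Ck_on_compose[OF assms(1,3)] by blast+
  then have "Ck_on k U (\<lambda>x. (f x, 0) + (0, g x))"
    by (rule Ck_on_add[OF assms(1)])
  then show ?thesis by simp
qed

lemma Ck_on_fst: "Ck_on k U fst" and Ck_on_snd: "Ck_on k U snd" and Ck_on_id: "Ck_on k W (\<lambda>x. x)"
  by (auto intro: Ck_on_linear bounded_linear_fst bounded_linear_snd bounded_linear_ident)

text \<open>The derivative involves only the inverse itself and the derivative of \<open>f\<close>,
  so class \<open>k\<close> of the inverse yields class \<open>Suc k\<close>.\<close>

lemma Ck_on_inverse:
  fixes f :: "'a::euclidean_space \<Rightarrow> real"
  assumes "open U" "Ck_on k U f" "\<And>x. x \<in> U \<Longrightarrow> f x \<noteq> 0"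
  shows "Ck_on k U (\<lambda>x. inverse (f x))"
  using assms(2)
proof (induction k)
  case 0
  then show ?case using assms(3) by (auto intro: continuous_on_inverse)
next
  case (Suc k)
  have *: "Ck_on k U (\<lambda>x. inverse (f x))" using Suc Ck_on_SucD by blast
  show ?case
  proof (rule Ck_on_Suc_intro[where D="\<lambda>x v. - (inverse (f x) * frechet_derivative f (at x) v * inverse (f x))"])
    show "Ck_on k U (\<lambda>x. - (inverse (f x) * frechet_derivative f (at x) v * inverse (f x)))" for v
      using * Suc.prems by (intro Ck_on_minus Ck_on_mult \<open>open U\<close>) auto
    show "((\<lambda>x. inverse (f x)) has_derivative
        (\<lambda>v. - (inverse (f x) * frechet_derivative f (at x) v * inverse (f x)))) (at x)"
      if "x \<in> U" for x
      using assms(3)[OF that] Ck_on_has_derivative[OF Suc.prems that] by (rule Deriv.has_derivative_inverse)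
  qed (rule \<open>open U\<close>)
qed

lemma Ck_on_divide:
  fixes f g :: "'a::euclidean_space \<Rightarrow> real"
  assumes "open U" "Ck_on k U f" "Ck_on k U g" "\<And>x. x \<in> U \<Longrightarrow> g x \<noteq> 0"
  shows "Ck_on k U (\<lambda>x. f x / g x)"
  using Ck_on_mult[OF assms(1,2) Ck_on_inverse[OF assms(1,3,4)]] by (simp add: divide_inverse)

lemma Ck_on_power:
  fixes f :: "'a::euclidean_space \<Rightarrow> real"
  assumes "open U" "Ck_on k U f"
  shows "Ck_on k U (\<lambda>x. f x ^ n)"
  by (induction n) (auto intro: Ck_on_const Ck_on_mult assms)

lemmas Ck_on_intros = Ck_on_const Ck_on_add Ck_on_diff Ck_on_minus Ck_on_sum Ck_on_scaleR Ck_on_mult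
  Ck_on_inner Ck_on_Pair Ck_on_fst Ck_on_snd Ck_on_id Ck_on_divide Ck_on_power

section \<open>Smooth bump functions\<close>

text \<open>The powers are carried along because the family is closed under differentiation.\<close>

definition flat_exp :: "nat \<Rightarrow> real \<Rightarrow> real" where
  "flat_exp n x = (if x \<le> 0 then 0 else exp (- inverse x) * inverse x ^ n)"

text \<open>Inverting the variable turns this into the decay at infinity of a power divided by the
  exponential.\<close>

lemma flat_exp_tendsto_0: "(flat_exp n \<longlongrightarrow> 0) (at_right 0)"
proof -
  have "((\<lambda>x::real. x ^ n / exp x) \<longlongrightarrow> 0) at_top" by (rule tendsto_power_div_exp_0)
  then have "((\<lambda>x::real. inverse x ^ n / exp (inverse x)) \<longlongrightarrow> 0) (at_right 0)"
    by (simp add: at_right_to_top filterlim_filtermap)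
  moreover have "\<forall>\<^sub>F x in at_right 0. inverse x ^ n / exp (inverse x) = flat_exp n x"
    by (auto simp: eventually_at_right_field flat_exp_def exp_minus divide_inverse intro!: exI[of _ 1])
  ultimately show ?thesis by (rule Lim_transform_eventually)
qed

lemma flat_exp_has_derivative:
  "(flat_exp n has_real_derivative flat_exp (n + 2) x - real n * flat_exp (n + 1) x) (at x)"
proof -
  consider "x < 0" | "x = 0" | "x > 0" by linarith
  then show ?thesis
  proof cases
    case 1
    have "((\<lambda>x. 0) has_real_derivative 0) (at x)" by simp
    then have "(flat_exp n has_real_derivative 0) (at x)"
      by (rule has_field_derivative_transform_within_open[where S="{..<0}"])
        (use 1 in \<open>auto simp: flat_exp_def\<close>)
    then show ?thesis using 1 by (simp add: flat_exp_def)
  next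
    case 2
    \<comment> \<open>On the right the difference quotient at 0 is \<open>flat_exp (Suc n)\<close>,
      again a member of the family; on the left it is 0.\<close>
    have "((\<lambda>h. (flat_exp n h - flat_exp n 0) / h) \<longlongrightarrow> 0) (at_right 0)"
    proof (rule Lim_transform_eventually[OF flat_exp_tendsto_0[of "Suc n"]])
      show "\<forall>\<^sub>F h in at_right 0. flat_exp (Suc n) h = (flat_exp n h - flat_exp n 0) / h"
        by (auto simp: eventually_at_right_field flat_exp_def divide_inverse intro!: exI[of _ 1])
    qed
    moreover have "((\<lambda>h. (flat_exp n h - flat_exp n 0) / h) \<longlongrightarrow> 0) (at_left 0)"
    proof (rule Lim_transform_eventually[OF tendsto_const])
      show "\<forall>\<^sub>F h in at_left 0. 0 = (flat_exp n h - flat_exp n 0) / h"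
        by (auto simp: eventually_at_left_field flat_exp_def intro!: exI[of _ "-1"])
    qed
    ultimately have "((\<lambda>h. (flat_exp n h - flat_exp n 0) / h) \<longlongrightarrow> 0) (at 0)"
      by (simp add: filterlim_split_at)
    then show ?thesis using 2 by (simp add: has_field_derivative_iff flat_exp_def)
  next
    case 3
    have "((\<lambda>x. exp (- inverse x) * inverse x ^ n) has_real_derivative
        flat_exp (n + 2) x - real n * flat_exp (n + 1) x) (at x)"
    proof -
      have "((\<lambda>x. inverse x ^ n) has_real_derivative - (real n * inverse x ^ (n + 1))) (at x)"
        using DERIV_power[OF DERIV_inverse[of x UNIV], of n] 3 by (cases n) (auto simp: algebra_simps)
      moreover have "((\<lambda>x. exp (- inverse x)) has_real_derivative exp (- inverse x) * inverse x ^ 2) (at x)"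
        using 3 by (auto intro!: derivative_eq_intros simp: power2_eq_square)
      ultimately have "((\<lambda>x. exp (- inverse x) * inverse x ^ n) has_real_derivative
          exp (- inverse x) * inverse x ^ 2 * inverse x ^ n + - (real n * inverse x ^ (n + 1)) * exp (- inverse x)) (at x)"
        by (intro DERIV_mult)
      then show ?thesis
        using 3 by (auto simp: flat_exp_def algebra_simps power2_eq_square elim!: DERIV_cong)
    qed
    then show ?thesis
      by (rule has_field_derivative_transform_within_open[where S="{0<..}"])
        (use 3 in \<open>auto simp: flat_exp_def\<close>)
  qed
qed

lemma Ck_on_flat_exp: "Ck_on k UNIV (flat_exp n)"
proof (induction k arbitrary: n)
  case 0
  show ?case
    using flat_exp_has_derivative[of n] by (auto intro!: continuous_at_imp_continuous_on DERIV_isCont)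
next
  case (Suc k)
  show ?case
  proof (rule Ck_on_Suc_intro)
    show "(flat_exp n has_derivative (\<lambda>h. (flat_exp (n + 2) x - real n * flat_exp (n + 1) x) * h)) (at x)" for x
      using flat_exp_has_derivative by (simp add: has_field_derivative_def)
    show "Ck_on k UNIV (\<lambda>x. (flat_exp (n + 2) x - real n * flat_exp (n + 1) x) * v)" for v
      by (intro Ck_on_intros Suc.IH) auto
  qed auto
qed

text \<open>Take \<open>a / (a + b)\<close>, where \<open>a\<close> is positive exactly inside the
  ball of radius \<open>r\<close> and \<open>b\<close> exactly outside the closed ball of radius
  \<open>r / 2\<close>; the denominator never vanishes. Squared distances keep both functions smooth
  at the centre.\<close>

lemma smooth_bump:
  fixes p :: "'a::euclidean_space"
  assumes "0 < r"
  obtains h :: "'a \<Rightarrow> real" where "\<And>k. Ck_on k UNIV h" "\<And>x. x \<in> cball p (r / 2) \<Longrightarrow> h x = 1"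
    "\<And>x. x \<notin> ball p r \<Longrightarrow> h x = 0"
proof -
  define a where "a x = flat_exp 0 (r\<^sup>2 - (x - p) \<bullet> (x - p))" for x
  define b where "b x = flat_exp 0 ((x - p) \<bullet> (x - p) - (r / 2)\<^sup>2)" for x
  have fe: "flat_exp 0 s \<ge> 0" "flat_exp 0 s > 0 \<longleftrightarrow> s > 0" "flat_exp 0 s = 0 \<longleftrightarrow> s \<le> 0" for s
    by (auto simp: flat_exp_def)
  have lt: "(r / 2)\<^sup>2 < r\<^sup>2" using assms by (simp add: power_divide)
  have pos: "a x + b x > 0" for x
  proof (cases "(x - p) \<bullet> (x - p) < r\<^sup>2")
    case True
    then show ?thesis unfolding a_def b_def using fe by (simp add: add_pos_nonneg)
  next
    case False
    then show ?thesis unfolding a_def b_def using fe lt by (intro add_nonneg_pos) auto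
  qed
  have nrm: "(x - p) \<bullet> (x - p) = (dist p x)\<^sup>2" for x
    by (simp add: dist_norm norm_minus_commute dot_square_norm)
  have Ck: "Ck_on k UNIV a" "Ck_on k UNIV b" for k
    unfolding a_def b_def
    by (auto intro!: Ck_on_compose[OF _ _ Ck_on_flat_exp] Ck_on_intros)
  show thesis
  proof (rule that[of "\<lambda>x. a x / (a x + b x)"])
    show "Ck_on k UNIV (\<lambda>x. a x / (a x + b x))" for k
      using pos by (intro Ck_on_divide Ck_on_add Ck) (auto simp: less_imp_neq[symmetric])
    show "a x / (a x + b x) = 1" if "x \<in> cball p (r / 2)" for x
    proof -
      have "(dist p x)\<^sup>2 \<le> (r / 2)\<^sup>2" using that by (intro power_mono) auto
      then have "b x = 0" by (simp add: b_def fe nrm)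
      then show ?thesis using pos[of x] by simp
    qed
    show "a x / (a x + b x) = 0" if "x \<notin> ball p r" for x
    proof -
      have "r\<^sup>2 \<le> (dist p x)\<^sup>2" using that assms by (intro power_mono) auto
      then show ?thesis by (simp add: a_def fe nrm)
    qed
  qed
qed

section \<open>Ordinary differential equations with parameters\<close>

text \<open>This is the fundamental theorem of calculus for the integral from 0 to \<open>t\<close>,
  rescaled to \<open>{0..1}\<close> so that one formula serves both signs of
  \<open>t\<close>.\<close>

lemma scaled_integral_has_vector_derivative:
  fixes \<phi> :: "real \<Rightarrow> 'a::euclidean_space"
  assumes cont: "continuous_on UNIV \<phi>"
  shows "((\<lambda>t. t *\<^sub>R integral {0..1} (\<lambda>s. \<phi> (t * s))) has_vector_derivative \<phi> t) (at t)"
proof -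
  \<comment> \<open>An interval with both 0 and \<open>t\<close> in its interior, so that
    derivatives at \<open>t\<close> are two-sided.\<close>
  define a where "a = \<bar>t\<bar> + 1"
  define \<Psi> where "\<Psi> u = integral {-a..u} \<phi>" for u
  have \<Psi>: "(\<Psi> has_vector_derivative \<phi> u) (at u)" if "u \<in> {-a<..<a}" for u
  proof -
    have "(\<Psi> has_vector_derivative \<phi> u) (at u within {-a..a})"
      unfolding \<Psi>_def
      by (rule integral_has_vector_derivative) (use that cont in \<open>auto intro: continuous_on_subset\<close>)
    then show ?thesis using that by (simp add: at_within_Icc_at)
  qed
  have eq: "\<Psi> u - \<Psi> 0 = u *\<^sub>R integral {0..1} (\<lambda>s. \<phi> (u * s))" if u: "u \<in> {-a<..<a}" for u
  proof -
    have "((\<lambda>s. u *\<^sub>R \<phi> (u * s)) has_integral (\<Psi> \<circ> (\<lambda>s. u * s)) 1 - (\<Psi> \<circ> (\<lambda>s. u * s)) 0) {0..1}"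
    proof (rule fundamental_theorem_of_calculus)
      fix s :: real assume s: "s \<in> {0..1}"
      have "\<bar>u * s\<bar> < a"
      proof -
        have "\<bar>u * s\<bar> \<le> \<bar>u\<bar> * 1" unfolding abs_mult using s by (intro mult_left_mono) auto
        then show ?thesis using u by auto
      qed
      then have "(\<Psi> has_vector_derivative \<phi> (u * s)) (at (u * s))" by (intro \<Psi>) auto
      moreover have "((\<lambda>s. u * s) has_vector_derivative u) (at s)"
        by (auto intro!: derivative_eq_intros)
      ultimately have "(\<Psi> \<circ> (\<lambda>s. u * s) has_vector_derivative u *\<^sub>R \<phi> (u * s)) (at s)"
        by (intro vector_diff_chain_at)
      then show "(\<Psi> \<circ> (\<lambda>s. u * s) has_vector_derivative u *\<^sub>R \<phi> (u * s)) (at s within {0..1})"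
        by (rule has_vector_derivative_at_within)
    qed simp
    then show ?thesis by (simp add: integral_unique flip: integral_cmul)
  qed
  have "((\<lambda>u. \<Psi> u - \<Psi> 0) has_vector_derivative \<phi> t) (at t)"
    using \<Psi>[of t]
    by (auto simp: a_def abs_if intro!: derivative_eq_intros split: if_splits)
  then show ?thesis
    by (rule has_vector_derivative_transform_within_open[where S="{-a<..<a}"])
      (use eq in \<open>auto simp: a_def\<close>)
qed

lemma continuous_on_UNIV_bounded:
  fixes g :: "'a::heine_borel \<Rightarrow> 'b::real_normed_vector"
  assumes "continuous_on UNIV g" "compact C"
  shows "\<exists>M\<ge>0. \<forall>x\<in>C. norm (g x) \<le> M"
proof -
  have "bounded (g ` C)"
    using assms by (meson compact_continuous_image compact_imp_bounded continuous_on_subset subset_UNIV)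
  then obtain M where "\<forall>x\<in>C. norm (g x) \<le> M" unfolding bounded_iff by auto
  then have "\<forall>x\<in>C. norm (g x) \<le> max M 0" by (auto intro: max.coboundedI1)
  then show ?thesis by (intro exI[of _ "max M 0"]) simp
qed

lemma continuous_on_UNIV_bounded_above:
  fixes g :: "'a::heine_borel \<Rightarrow> real"
  assumes "continuous_on UNIV g" "compact C"
  shows "\<exists>M\<ge>0. \<forall>x\<in>C. g x \<le> M"
  using continuous_on_UNIV_bounded[OF assms] by (auto simp: abs_le_iff)

text \<open>Picard iteration, with all times rescaled to \<open>{0..1}\<close> so that negative times need no
  special treatment.  With the weight \<open>exp (2 * K * \<bar>t\<bar>)\<close> each step halves the distance.\<close>

theorem ode_param_exists:
  fixes f :: "real \<times> 'p::euclidean_space \<times> 'e::euclidean_space \<Rightarrow> 'e" and y0 :: "'p \<Rightarrow> 'e"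
  assumes cf: "continuous_on UNIV f" and c0: "continuous_on UNIV y0"
    and lip: "\<And>R. \<exists>L. \<forall>t p x y. \<bar>t\<bar> \<le> R \<longrightarrow> norm p \<le> R \<longrightarrow>
      norm (f (t, p, x) - f (t, p, y)) \<le> L * norm (x - y)"
  obtains Y where "continuous_on UNIV Y" "\<And>p. Y (0, p) = y0 p"
    "\<And>t p. ((\<lambda>s. Y (s, p)) has_vector_derivative f (t, p, Y (t, p))) (at t)"
proof -
  \<comment> \<open>The Picard operator: its fixed points are the solutions with initial value
    \<open>y0\<close>.\<close>
  define N where "N Z x = y0 (snd x) +
    fst x *\<^sub>R integral {0..1} (\<lambda>s. f (fst x * s, snd x, Z (fst x * s, snd x)))" for Z and x :: "real \<times> 'p"
  have cN: "continuous_on UNIV (N Z)" if Z: "continuous_on UNIV Z" for Z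
  proof -
    have "continuous_on (UNIV \<times> cbox 0 1) (\<lambda>(x :: real \<times> 'p, s). f (fst x * s, snd x, Z (fst x * s, snd x)))"
      unfolding case_prod_beta
      by (intro continuous_on_compose2[OF cf] continuous_on_compose2[OF Z] continuous_intros) auto
    from integral_continuous_on_param[OF this]
    show ?thesis unfolding N_def
      by (intro continuous_intros continuous_on_compose2[OF c0]) auto
  qed
  define Y where "Y n = (N ^^ n) (\<lambda>x. y0 (snd x))" for n
  have YS: "Y (Suc n) = N (Y n)" for n by (simp add: Y_def)
  have cY: "continuous_on UNIV (Y n)" for n
  proof (induction n)
    case 0
    show ?case by (auto simp: Y_def intro!: continuous_on_compose2[OF c0] continuous_intros)
  next
    case (Suc n)
    then show ?case by (simp add: YS cN)
  qed
  have cfZ: "continuous_on {0..1} (\<lambda>s. f (t * s, p, Z (t * s, p)))"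
    if Z: "continuous_on UNIV Z" for Z :: "real \<times> 'p \<Rightarrow> 'e" and t p
    by (intro continuous_on_compose2[OF cf] continuous_on_compose2[OF Z] continuous_intros) auto
  \<comment> \<open>Compact boxes, stable under scaling the time by a factor in
    \<open>{0..1}\<close>; the Picard step on a box therefore uses values on the same box.\<close>
  define A where "A R = {-R..R} \<times> cball (0::'p) R" for R
  obtain K where K1: "\<And>R. K R \<ge> 1"
    and K: "\<And>R t p x y. \<bar>t\<bar> \<le> R \<Longrightarrow> norm p \<le> R \<Longrightarrow>
      norm (f (t, p, x) - f (t, p, y)) \<le> K R * norm (x - y)"
  proof -
    from lip obtain L where L: "\<forall>R t p x y. \<bar>t\<bar> \<le> R \<longrightarrow> norm p \<le> R \<longrightarrow>
      norm (f (t, p, x) - f (t, p, y)) \<le> L R * norm (x - y)" by metis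
    show thesis
    proof (rule that[of "\<lambda>R. max 1 (L R)"])
      fix R t p x y assume "\<bar>t\<bar> \<le> R" "norm (p::'p) \<le> R"
      then have "norm (f (t, p, x) - f (t, p, y)) \<le> L R * norm (x - y)" using L by blast
      also have "\<dots> \<le> max 1 (L R) * norm (x - y)" by (intro mult_right_mono) auto
      finally show "norm (f (t, p, x) - f (t, p, y)) \<le> max 1 (L R) * norm (x - y)" .
    qed simp
  qed
  have Ndiff: "norm (N Z (t, p) - N Z' (t, p)) \<le> \<bar>t\<bar> * integral {0..1} g"
    if "(t, p) \<in> A R" "continuous_on UNIV Z" "continuous_on UNIV Z'" "g integrable_on {0..1}"
      and g: "\<And>s. s \<in> {0..1} \<Longrightarrow> K R * norm (Z (t * s, p) - Z' (t * s, p)) \<le> g s"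
    for Z Z' t p R g
  proof -
    let ?i = "\<lambda>Z s. f (t * s, p, Z (t * s, p))"
    have int: "?i Z integrable_on {0..1}" "?i Z' integrable_on {0..1}"
      using that cfZ by (auto intro: integrable_continuous_real)
    have "norm (integral {0..1} (\<lambda>s. ?i Z s - ?i Z' s)) \<le> integral {0..1} g"
    proof (rule integral_norm_bound_integral)
      fix s :: real assume s: "s \<in> {0..1}"
      have "\<bar>t * s\<bar> \<le> \<bar>t\<bar> * 1" unfolding abs_mult using s by (intro mult_left_mono) auto
      then have "norm (?i Z s - ?i Z' s) \<le> K R * norm (Z (t * s, p) - Z' (t * s, p))"
        using that(1) by (intro K) (auto simp: A_def)
      then show "norm (?i Z s - ?i Z' s) \<le> g s" using g[OF s] by linarith
    qed (use int that in \<open>auto intro: integrable_diff\<close>)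
    moreover have "N Z (t, p) - N Z' (t, p) = t *\<^sub>R integral {0..1} (\<lambda>s. ?i Z s - ?i Z' s)"
      using int by (simp add: N_def integral_diff scaleR_diff_right)
    ultimately show ?thesis by (simp add: mult_left_mono)
  qed
  have bound: "\<exists>M. \<forall>n. \<forall>x\<in>A R. norm (Y (Suc n) x - Y n x) \<le> M * (1/2) ^ n" for R
  proof -
    have "compact (A R)" by (auto simp: A_def intro: compact_Times)
    then obtain M where M: "M \<ge> 0" "\<And>x. x \<in> A R \<Longrightarrow> norm (Y (Suc 0) x - Y 0 x) \<le> M"
      using continuous_on_UNIV_bounded[OF continuous_on_diff[OF cY[of "Suc 0"] cY[of 0]], of "A R"] by blast
    let ?E = "\<lambda>t. exp (2 * K R * \<bar>t\<bar>)"
    have *: "norm (Y (Suc n) (t, p) - Y n (t, p)) \<le> M * (1/2) ^ n * ?E t" if "(t, p) \<in> A R" for n t p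
      using that
    proof (induction n arbitrary: t)
      case 0
      have "M * 1 \<le> M * ?E t" using M(1) K1[of R] by (intro mult_left_mono) auto
      then show ?case using M(2)[OF 0] by simp
    next
      case (Suc n)
      define g where "g s = K R * (M * (1/2) ^ n * exp (2 * K R * \<bar>t\<bar> * s))" for s :: real
      \<comment> \<open>Differentiating the exponential produces
        \<open>2 * K R * \<bar>t\<bar>\<close>, so the antiderivative carries an additional
        \<open>1/2\<close>; this is the gain per step.\<close>
      have g: "((\<lambda>s. \<bar>t\<bar> * g s) has_integral
          (M * (1/2) ^ Suc n * exp (2 * K R * \<bar>t\<bar> * 1) - M * (1/2) ^ Suc n * exp (2 * K R * \<bar>t\<bar> * 0))) {0..1}"
        unfolding g_def
        by (rule fundamental_theorem_of_calculus)
          (auto intro!: derivative_eq_intros simp flip: has_real_derivative_iff_has_vector_derivative)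
      have ci: "g integrable_on {0..1}"
        unfolding g_def by (intro integrable_continuous_real continuous_intros)
      have "norm (N (Y (Suc n)) (t, p) - N (Y n) (t, p)) \<le> \<bar>t\<bar> * integral {0..1} g"
      proof (rule Ndiff[OF Suc.prems cY cY ci])
        fix s :: real assume s: "s \<in> {0..1}"
        have le: "\<bar>t * s\<bar> \<le> \<bar>t\<bar> * 1" unfolding abs_mult using s by (intro mult_left_mono) auto
        then have "(t * s, p) \<in> A R" using Suc.prems by (auto simp: A_def)
        from Suc.IH[OF this] have "norm (Y (Suc n) (t * s, p) - Y n (t * s, p))
            \<le> M * (1/2) ^ n * exp (2 * K R * \<bar>t\<bar> * s)"
          using s by (simp add: abs_mult mult.assoc)
        then show "K R * norm (Y (Suc n) (t * s, p) - Y n (t * s, p)) \<le> g s"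
          unfolding g_def using K1[of R] by (intro mult_left_mono) auto
      qed
      also have "\<bar>t\<bar> * integral {0..1} g = M * (1/2) ^ Suc n * (?E t - 1)"
        using integral_unique[OF g] by (simp add: algebra_simps)
      also have "\<dots> \<le> M * (1/2) ^ Suc n * ?E t" using M(1) by (intro mult_left_mono) auto
      finally show ?case by (simp add: YS)
    qed
    have "norm (Y (Suc n) x - Y n x) \<le> (M * exp (2 * K R * \<bar>R\<bar>)) * (1/2) ^ n" if "x \<in> A R" for n x
    proof -
      obtain t p where x: "x = (t, p)" by (cases x)
      have "?E t \<le> exp (2 * K R * \<bar>R\<bar>)"
        using that K1[of R] by (auto simp: A_def x intro!: mult_left_mono)
      then have "M * (1/2) ^ n * ?E t \<le> M * (1/2) ^ n * exp (2 * K R * \<bar>R\<bar>)"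
        using M(1) by (intro mult_left_mono) auto
      then show ?thesis using *[of t p n] that by (simp add: x mult_ac)
    qed
    then show ?thesis by blast
  qed
  \<comment> \<open>Written as a telescoping series, so that the Weierstrass test gives uniform
    convergence on each box.\<close>
  define Yl where "Yl x = Y 0 x + (\<Sum>n. Y (Suc n) x - Y n x)" for x
  have ul: "uniform_limit (A R) Y Yl sequentially" for R
  proof -
    obtain M where M: "\<And>n x. x \<in> A R \<Longrightarrow> norm (Y (Suc n) x - Y n x) \<le> M * (1/2) ^ n"
      using bound by blast
    have "summable (\<lambda>n. M * (1/2::real) ^ n)" by (intro summable_mult summable_geometric) auto
    then have "uniform_limit (A R) (\<lambda>n x. \<Sum>i<n. Y (Suc i) x - Y i x) (\<lambda>x. \<Sum>i. Y (Suc i) x - Y i x) sequentially"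
      using M by (intro Weierstrass_m_test)
    then have "uniform_limit (A R) (\<lambda>n x. Y n x - Y 0 x) (\<lambda>x. Yl x - Y 0 x) sequentially"
      using sum_lessThan_telescope[of "\<lambda>i. Y i x" for x] by (simp add: Yl_def)
    then have "uniform_limit (A R) (\<lambda>n x. (Y n x - Y 0 x) + Y 0 x) (\<lambda>x. (Yl x - Y 0 x) + Y 0 x) sequentially"
      by (intro uniform_limit_add uniform_limit_const)
    then show ?thesis by simp
  qed
  have cl: "continuous_on UNIV Yl"
  proof (rule continuous_at_imp_continuous_on, rule ballI)
    fix x :: "real \<times> 'p"
    obtain t p where x: "x = (t, p)" by (cases x)
    define R where "R = \<bar>t\<bar> + norm p + 1"
    have "continuous_on (A R) Yl"
      by (rule uniform_limit_theorem[OF _ ul])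
        (auto intro!: always_eventually continuous_on_subset[OF cY])
    then have "continuous_on ({-R<..<R} \<times> ball 0 R) Yl"
      by (rule continuous_on_subset) (auto simp: A_def)
    moreover have "open ({-R<..<R} \<times> ball (0::'p) R)" by (intro open_Times) auto
    moreover have "- R < t" "t < R" "norm p < R"
      unfolding R_def using norm_ge_zero[of p] by linarith+
    then have "x \<in> {-R<..<R} \<times> ball 0 R" by (auto simp: x)
    ultimately show "isCont Yl x" by (metis continuous_on_eq_continuous_at)
  qed
  have fixed: "Yl x = N Yl x" for x
  proof -
    obtain t p where x: "x = (t, p)" by (cases x)
    define R where "R = \<bar>t\<bar> + norm p"
    have "- R \<le> t" "t \<le> R" "norm p \<le> R"
      unfolding R_def using norm_ge_zero[of p] by linarith+
    then have xA: "x \<in> A R" by (auto simp: x A_def)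
    have "norm (Yl x - N Yl x) \<le> e" if "e > 0" for e
    proof -
      \<comment> \<open>Two errors must add up to at most \<open>e\<close>: the distance from
        \<open>Yl\<close> to an iterate, at most \<open>\<epsilon>\<close>, and the effect of this
        distance after applying \<open>N\<close>, at most
        \<open>\<bar>t\<bar> * K R * \<epsilon>\<close>.\<close>
      define \<epsilon> where "\<epsilon> = e / (1 + \<bar>t\<bar> * K R)"
      have pos: "1 + \<bar>t\<bar> * K R > 0" using K1[of R] by (intro add_pos_nonneg) auto
      then have "\<epsilon> > 0" using that by (simp add: \<epsilon>_def)
      from uniform_limitD[OF ul this, of R] obtain n
        where n: "\<And>m x. m \<ge> n \<Longrightarrow> x \<in> A R \<Longrightarrow> dist (Y m x) (Yl x) < \<epsilon>"
        unfolding eventually_sequentially by blast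
      have "norm (N (Y n) (t, p) - N Yl (t, p)) \<le> \<bar>t\<bar> * integral {0..1} (\<lambda>s::real. K R * \<epsilon>)"
      proof (rule Ndiff[OF _ cY cl])
        fix s :: real assume s: "s \<in> {0..1}"
        have "\<bar>t * s\<bar> \<le> \<bar>t\<bar> * 1" unfolding abs_mult using s by (intro mult_left_mono) auto
        then have "(t * s, p) \<in> A R" using xA by (auto simp: A_def x)
        then have "norm (Y n (t * s, p) - Yl (t * s, p)) \<le> \<epsilon>"
          using n[of n] by (force simp: dist_norm)
        then show "K R * norm (Y n (t * s, p) - Yl (t * s, p)) \<le> K R * \<epsilon>"
          using K1[of R] by (intro mult_left_mono) auto
      qed (use xA x in auto)
      moreover have "norm (Yl x - Y (Suc n) x) \<le> \<epsilon>"
        using n[of "Suc n" x] xA by (simp add: dist_norm norm_minus_commute)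
      moreover have "norm (Yl x - N Yl x) \<le> norm (Yl x - Y (Suc n) x) + norm (Y (Suc n) x - N Yl x)"
        using norm_triangle_ineq[of "Yl x - Y (Suc n) x" "Y (Suc n) x - N Yl x"] by simp
      ultimately have "norm (Yl x - N Yl x) \<le> \<epsilon> * (1 + \<bar>t\<bar> * K R)"
        by (simp add: YS x algebra_simps)
      then show ?thesis using pos by (simp add: \<epsilon>_def)
    qed
    then have "norm (Yl x - N Yl x) \<le> 0" by (rule field_le_epsilon[of _ 0, simplified])
    then show ?thesis by simp
  qed
  show thesis
  proof (rule that[OF cl])
    show "Yl (0, p) = y0 p" for p using fixed[of "(0, p)"] by (simp add: N_def)
    show "((\<lambda>s. Yl (s, p)) has_vector_derivative f (t, p, Yl (t, p))) (at t)" for t p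
    proof -
      let ?\<phi> = "\<lambda>s. f (s, p, Yl (s, p))"
      have "continuous_on UNIV ?\<phi>"
        by (intro continuous_on_compose2[OF cf] continuous_on_compose2[OF cl] continuous_intros) auto
      from has_vector_derivative_add[OF has_vector_derivative_const
          scaled_integral_has_vector_derivative[OF this, of t], of "y0 p"]
      have "((\<lambda>t. y0 p + t *\<^sub>R integral {0..1} (\<lambda>s. ?\<phi> (t * s))) has_vector_derivative ?\<phi> t) (at t)"
        by simp
      moreover have "(\<lambda>s. Yl (s, p)) = (\<lambda>t. y0 p + t *\<^sub>R integral {0..1} (\<lambda>s. ?\<phi> (t * s)))"
        by (rule ext, subst fixed) (simp add: N_def)
      ultimately show ?thesis by simp
    qed
  qed
qed

text \<open>The squared norm is differentiable also where \<open>u\<close> vanishes, which the norm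
  is not. In the rate \<open>2 * L + 1\<close> the part \<open>2 * L\<close> comes from
  \<open>L * norm (u t)\<close>, and the 1 from splitting \<open>2 * norm (u t) * \<epsilon>\<close>
  into two squares. With this rate the function \<open>\<phi>\<close> of the proof does not
  increase.\<close>

lemma gronwall_forward:
  fixes u :: "real \<Rightarrow> 'a::real_inner"
  assumes "a \<le> b" "L \<ge> 0" "\<epsilon> \<ge> 0"
    and der: "\<And>t. t \<in> {a..b} \<Longrightarrow> (u has_vector_derivative u' t) (at t within {a..b})"
    and le: "\<And>t. t \<in> {a..b} \<Longrightarrow> norm (u' t) \<le> L * norm (u t) + \<epsilon>"
  shows "(norm (u b))\<^sup>2 \<le> exp ((2 * L + 1) * (b - a)) * ((norm (u a))\<^sup>2 + \<epsilon>\<^sup>2 * (b - a))"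
proof -
  define k where "k = 2 * L + 1"
  define q where "q t = u t \<bullet> u t" for t
  define \<phi> where "\<phi> t = exp (- k * (t - a)) * (u t \<bullet> u t) - \<epsilon>\<^sup>2 * (t - a)" for t
  have cu: "continuous_on {a..b} u"
    using der continuous_on_vector_derivative by blast
  have "\<phi> b \<le> \<phi> a"
  proof (rule DERIV_nonpos_imp_decreasing_open[OF \<open>a \<le> b\<close>])
    show "continuous_on {a..b} \<phi>"
      unfolding \<phi>_def by (intro continuous_intros cu)
    fix t assume t: "a < t" "t < b"
    then have "(u has_vector_derivative u' t) (at t)"
      using der[of t] by (simp add: at_within_Icc_at)
    then have "(u has_derivative (\<lambda>h. h *\<^sub>R u' t)) (at t)" by (simp add: has_vector_derivative_def)
    then have "((\<lambda>t. u t \<bullet> u t) has_derivative (\<lambda>h. u t \<bullet> (h *\<^sub>R u' t) + (h *\<^sub>R u' t) \<bullet> u t)) (at t)"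
      by (intro has_derivative_inner)
    moreover have "(\<lambda>h. u t \<bullet> (h *\<^sub>R u' t) + (h *\<^sub>R u' t) \<bullet> u t) = (*) (2 * (u t \<bullet> u' t))"
      by (simp add: fun_eq_iff inner_commute)
    ultimately have q: "(q has_real_derivative 2 * (u t \<bullet> u' t)) (at t)"
      by (simp add: has_field_derivative_def q_def[abs_def])
    have "((\<lambda>t. exp (- k * (t - a)) * q t - \<epsilon>\<^sup>2 * (t - a)) has_real_derivative
        exp (- k * (t - a)) * (2 * (u t \<bullet> u' t) - k * (u t \<bullet> u t)) - \<epsilon>\<^sup>2) (at t)"
      by (rule derivative_eq_intros q refl | simp)+ (simp add: q_def right_diff_distrib mult_ac)
    then have "(\<phi> has_real_derivative
        exp (- k * (t - a)) * (2 * (u t \<bullet> u' t) - k * (u t \<bullet> u t)) - \<epsilon>\<^sup>2) (at t)"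
      by (simp add: \<phi>_def[abs_def] q_def)
    moreover have "exp (- k * (t - a)) * (2 * (u t \<bullet> u' t) - k * (u t \<bullet> u t)) \<le> 1 * \<epsilon>\<^sup>2"
    proof -
      have "u t \<bullet> u' t \<le> norm (u t) * norm (u' t)" by (rule norm_cauchy_schwarz)
      also have "\<dots> \<le> norm (u t) * (L * norm (u t) + \<epsilon>)"
        using le[of t] t by (intro mult_left_mono) auto
      finally have "2 * (u t \<bullet> u' t) \<le> 2 * L * (norm (u t))\<^sup>2 + 2 * norm (u t) * \<epsilon>"
        by (simp add: algebra_simps power2_eq_square)
      moreover have "2 * norm (u t) * \<epsilon> \<le> (norm (u t))\<^sup>2 + \<epsilon>\<^sup>2"
        by (rule sum_squares_bound)
      ultimately have "2 * (u t \<bullet> u' t) - k * (u t \<bullet> u t) \<le> \<epsilon>\<^sup>2"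
        by (simp add: k_def dot_square_norm algebra_simps)
      moreover have "exp (- k * (t - a)) \<le> 1"
        using t \<open>L \<ge> 0\<close> by (simp add: k_def mult_nonpos_nonneg)
      then have "exp (- k * (t - a)) * \<epsilon>\<^sup>2 \<le> 1 * \<epsilon>\<^sup>2" by (intro mult_right_mono) auto
      moreover have "exp (- k * (t - a)) * (2 * (u t \<bullet> u' t) - k * (u t \<bullet> u t)) \<le> exp (- k * (t - a)) * \<epsilon>\<^sup>2"
        using \<open>2 * (u t \<bullet> u' t) - k * (u t \<bullet> u t) \<le> \<epsilon>\<^sup>2\<close> by (intro mult_left_mono) auto
      ultimately show ?thesis by linarith
    qed
    ultimately show "\<exists>y. (\<phi> has_real_derivative y) (at t) \<and> y \<le> 0" by auto
  qed
  then have "exp (- k * (b - a)) * (norm (u b))\<^sup>2 \<le> (norm (u a))\<^sup>2 + \<epsilon>\<^sup>2 * (b - a)"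
    by (simp add: \<phi>_def dot_square_norm)
  then have "exp (k * (b - a)) * (exp (- k * (b - a)) * (norm (u b))\<^sup>2)
      \<le> exp (k * (b - a)) * ((norm (u a))\<^sup>2 + \<epsilon>\<^sup>2 * (b - a))"
    by (intro mult_left_mono) auto
  moreover have "exp (k * (b - a)) * exp (- k * (b - a)) = 1"
    by (subst exp_add[symmetric]) simp
  ultimately show ?thesis by (simp only: mult.assoc[symmetric] k_def mult_1)
qed

text \<open>Backward times reduce to forward ones by time reversal. The two-sided form is what shows
  later that a quantity vanishing at one time vanishes at all times.\<close>

lemma gronwall:
  fixes u :: "real \<Rightarrow> 'a::real_inner"
  assumes "is_interval J" "s \<in> J" "t \<in> J" "L \<ge> 0" "\<epsilon> \<ge> 0"
    and der: "\<And>\<tau>. \<tau> \<in> J \<Longrightarrow> (u has_vector_derivative u' \<tau>) (at \<tau> within J)"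
    and le: "\<And>\<tau>. \<tau> \<in> J \<Longrightarrow> norm (u' \<tau>) \<le> L * norm (u \<tau>) + \<epsilon>"
  shows "(norm (u t))\<^sup>2 \<le> exp ((2 * L + 1) * \<bar>t - s\<bar>) * ((norm (u s))\<^sup>2 + \<epsilon>\<^sup>2 * \<bar>t - s\<bar>)"
proof (cases "s \<le> t")
  case True
  then have sub: "{s..t} \<subseteq> J" using assms(1-3) unfolding is_interval_1 atLeastAtMost_iff subset_iff by blast
  have "(u has_vector_derivative u' \<tau>) (at \<tau> within {s..t})" if "\<tau> \<in> {s..t}" for \<tau>
    using has_vector_derivative_within_subset[OF der sub] sub that by blast
  from gronwall_forward[OF True \<open>L \<ge> 0\<close> \<open>\<epsilon> \<ge> 0\<close> this le]
  show ?thesis using sub True by (simp add: subset_iff)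
next
  case False
  then have sub: "{t..s} \<subseteq> J"
    using assms(1-3) unfolding is_interval_1 atLeastAtMost_iff subset_iff by blast
  define v where "v = u \<circ> uminus"
  have "(v has_vector_derivative (- 1) *\<^sub>R u' (- \<tau>)) (at \<tau> within {-s..-t})" if "\<tau> \<in> {-s..-t}" for \<tau>
    unfolding v_def
  proof (rule vector_diff_chain_within)
    show "(uminus has_vector_derivative - 1) (at \<tau> within {-s..-t})"
      by (auto intro!: derivative_eq_intros)
    show "(u has_vector_derivative u' (- \<tau>)) (at (- \<tau>) within uminus ` {-s..-t})"
      by (rule has_vector_derivative_within_subset[OF der]) (use that sub in auto)
  qed
  moreover have "norm ((- 1) *\<^sub>R u' (- \<tau>)) \<le> L * norm (v \<tau>) + \<epsilon>" if "\<tau> \<in> {-s..-t}" for \<tau>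
    unfolding v_def using le[OF subsetD[OF sub], of "- \<tau>"] that by auto
  ultimately have "(norm (v (- t)))\<^sup>2 \<le> exp ((2 * L + 1) * (- t - - s)) * ((norm (v (- s)))\<^sup>2 + \<epsilon>\<^sup>2 * (- t - - s))"
    using False \<open>L \<ge> 0\<close> \<open>\<epsilon> \<ge> 0\<close> by (intro gronwall_forward) auto
  then show ?thesis using False by (simp add: v_def)
qed

text \<open>The mean value inequality, with the derivatives at \<open>z\<close> and at nearby points
  compared by uniform continuity on a compact neighbourhood of \<open>K\<close>. Uniformity in
  \<open>z\<close> matters because \<open>z\<close> will run along a whole piece of
  trajectory.\<close>

lemma Ck_on_1_uniform_linearization:
  fixes f :: "'a::euclidean_space \<Rightarrow> 'b::euclidean_space"
  assumes f: "Ck_on (Suc 0) UNIV f" and K: "compact K" and "\<eta> > 0"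
  shows "\<exists>\<delta>>0. \<forall>z\<in>K. \<forall>h. norm h < \<delta> \<longrightarrow>
    norm (f (z + h) - f z - frechet_derivative f (at z) h) \<le> \<eta> * norm h"
proof -
  let ?D = "\<lambda>z. frechet_derivative f (at z)"
  have der: "(f has_derivative ?D z) (at z)" for z using Ck_on_has_derivative[OF f] by simp
  have cD: "continuous_on UNIV (\<lambda>z. ?D z v)" for v using f by simp
  \<comment> \<open>The closed 1-neighbourhood of \<open>K\<close>; it contains the ball of radius
    \<open>\<delta>\<close> around each \<open>z\<close> of \<open>K\<close>, as
    \<open>\<delta>\<close> is at most 1.\<close>
  define K' where "K' = {x + y |x y. x \<in> K \<and> y \<in> cball 0 (1::real)}"
  have K': "compact K'" unfolding K'_def by (intro compact_sums K) auto
  \<comment> \<open>Summing over \<open>Basis\<close> bounds the operator norm of the difference of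
    the two derivatives.\<close>
  define G where "G w = (\<Sum>i\<in>Basis. norm (?D (fst w) i - ?D (snd w) i))" for w
  have "continuous_on (K' \<times> K') G"
    unfolding G_def by (intro continuous_intros continuous_on_compose2[OF cD]) auto
  then have "uniformly_continuous_on (K' \<times> K') G"
    by (intro compact_uniformly_continuous compact_Times K')
  then obtain d where "d > 0"
    and d: "\<And>w w'. w \<in> K' \<times> K' \<Longrightarrow> w' \<in> K' \<times> K' \<Longrightarrow> dist w' w < d \<Longrightarrow> dist (G w') (G w) < \<eta>"
    unfolding uniformly_continuous_on_def using \<open>\<eta> > 0\<close> by metis
  define \<delta> where "\<delta> = min d 1"
  have "norm (f (z + h) - f z - ?D z h) \<le> \<eta> * norm h" if z: "z \<in> K" and h: "norm h < \<delta>" for z h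
  proof -
    have on: "onorm (\<lambda>v. ?D x v - ?D z v) \<le> \<eta>" if x: "x \<in> ball z \<delta>" for x
    proof (rule onorm_le)
      fix v
      have "x = z + (x - z)" "x - z \<in> cball 0 1" "z = z + 0" "0 \<in> cball 0 (1::real)"
        using x by (auto simp: \<delta>_def dist_norm norm_minus_commute)
      then have mem: "x \<in> K'" "z \<in> K'"
        using z unfolding K'_def by blast+
      have "dist (G (x, z)) (G (z, z)) < \<eta>"
        by (rule d) (use x mem in \<open>auto simp: dist_Pair_Pair \<delta>_def dist_commute\<close>)
      then have G: "(\<Sum>i\<in>Basis. norm (?D x i - ?D z i)) < \<eta>" by (simp add: G_def dist_norm)
      have "linear (\<lambda>v. ?D x v - ?D z v)"
        using der has_derivative_linear by (intro linear_compose_sub) blast+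
      from linear_eq_sum_Basis[OF this, of v]
      have "norm (?D x v - ?D z v) = norm (\<Sum>i\<in>Basis. (v \<bullet> i) *\<^sub>R (?D x i - ?D z i))" by simp
      also have "\<dots> \<le> (\<Sum>i\<in>Basis. norm v * norm (?D x i - ?D z i))"
        by (intro sum_norm_le) (simp add: Basis_le_norm mult_right_mono)
      also have "\<dots> = norm v * (\<Sum>i\<in>Basis. norm (?D x i - ?D z i))" by (simp add: sum_distrib_left)
      also have "\<dots> \<le> norm v * \<eta>" using G by (intro mult_left_mono) auto
      finally show "norm (?D x v - ?D z v) \<le> \<eta> * norm v" by (simp add: mult.commute)
    qed
    have "norm (f (z + h) - f z - ?D z (z + h - z)) \<le> norm (z + h - z) * \<eta>"
    proof (rule differentiable_bound_linearization[where S="ball z \<delta>"])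
      fix t :: real assume "t \<in> {0..1}"
      then have "\<bar>t\<bar> * norm h \<le> 1 * norm h" by (intro mult_right_mono) auto
      then show "z + t *\<^sub>R (z + h - z) \<in> ball z \<delta>" using h by (simp add: dist_norm)
    next
      show "(f has_derivative ?D x) (at x within ball z \<delta>)" for x
        using der has_derivative_at_withinI by blast
      show "onorm (?D x - ?D z) \<le> \<eta>" if "x \<in> ball z \<delta>" for x
        using on[OF that] by (simp add: fun_diff_def)
      show "z \<in> ball z \<delta>" using \<open>d > 0\<close> by (simp add: \<delta>_def)
    qed
    then show ?thesis by (simp add: mult.commute)
  qed
  then show ?thesis using \<open>d > 0\<close> by (intro exI[of _ \<delta>]) (auto simp: \<delta>_def)
qed

lemma has_derivative_Pair_right:
  fixes f :: "'a::euclidean_space \<times> 'b::euclidean_space \<Rightarrow> 'c::euclidean_space"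
  assumes "(f has_derivative f') (at (x, y))"
  shows "((\<lambda>y. f (x, y)) has_derivative (\<lambda>v. f' (0, v))) (at y within S)"
proof -
  have "((\<lambda>y. (x, y)) has_derivative (\<lambda>v. (0, v))) (at y within S)"
    by (auto intro!: derivative_eq_intros)
  then show ?thesis using has_derivative_compose[of "\<lambda>y. (x, y)" _ y S f f'] assms by simp
qed

text \<open>The columns \<open>w i\<close> solve the variational equation. The remainder
  \<open>y (s, p + q) - y (s, p) - W q s\<close> satisfies a linear differential inequality with
  inhomogeneity \<open>\<eta> * (1 + C) * norm q\<close>, and Gronwall's inequality makes it small
  compared with \<open>norm q\<close>.\<close>

theorem ode_param_has_derivative:
  fixes f :: "real \<times> 'p::euclidean_space \<times> 'e::euclidean_space \<Rightarrow> 'e" and w :: "'p \<Rightarrow> real \<Rightarrow> 'e"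
  assumes f: "Ck_on (Suc 0) UNIV f" and cy: "continuous_on UNIV y"
    and y: "\<And>t q. ((\<lambda>s. y (s, q)) has_vector_derivative f (t, q, y (t, q))) (at t)"
    and y0: "((\<lambda>q. y (0, q)) has_derivative D0) (at p)"
    and w0: "\<And>i. i \<in> Basis \<Longrightarrow> w i 0 = D0 i"
    and w: "\<And>i t. i \<in> Basis \<Longrightarrow> (w i has_vector_derivative
      frechet_derivative f (at (t, p, y (t, p))) (0, i, w i t)) (at t)"
  shows "((\<lambda>q. y (t, q)) has_derivative (\<lambda>q. \<Sum>i\<in>Basis. (q \<bullet> i) *\<^sub>R w i t)) (at p)"
proof -
  let ?Df = "\<lambda>s. frechet_derivative f (at (s, p, y (s, p)))"
  have lin: "linear (?Df s)" for s
    using Ck_on_has_derivative[OF f] has_derivative_linear by blast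
  have cDf: "continuous_on UNIV (\<lambda>s. ?Df s v)" for v
  proof -
    have "continuous_on UNIV (\<lambda>z. frechet_derivative f (at z) v)" using Ck_on_SucD2[OF f] by simp
    then show ?thesis
      by (rule continuous_on_compose2) (auto intro!: continuous_intros continuous_on_compose2[OF cy])
  qed
  define W where "W q s = (\<Sum>i\<in>Basis. (q \<bullet> i) *\<^sub>R w i s)" for q s
  have W: "(W q has_vector_derivative ?Df s (0, q, W q s)) (at s)" for q s
  proof -
    have "(W q has_vector_derivative (\<Sum>i\<in>Basis. (q \<bullet> i) *\<^sub>R ?Df s (0, i, w i s))) (at s)"
      unfolding W_def[abs_def] by (auto intro!: derivative_eq_intros w)
    also have "(\<Sum>i\<in>Basis. (q \<bullet> i) *\<^sub>R ?Df s (0, i, w i s)) = ?Df s (\<Sum>i\<in>Basis. (q \<bullet> i) *\<^sub>R (0, i, w i s))"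
      by (simp add: linear_sum[OF lin] linear_scale[OF lin] del: scaleR_Pair)
    also have "(\<Sum>i\<in>Basis. (q \<bullet> i) *\<^sub>R (0::real, i, w i s)) = (0, q, W q s)"
      by (simp add: sum_prod W_def euclidean_representation)
    finally show ?thesis .
  qed
  define T where "T = \<bar>t\<bar> + 1"
  let ?S = "{-T..T}"
  have "T > 0" by (simp add: T_def)
  have Tt: "t \<in> ?S" "0 \<in> ?S" by (auto simp: T_def)
  obtain L where "L \<ge> 0" and L: "\<And>s k. s \<in> ?S \<Longrightarrow> norm (?Df s (0, 0, k)) \<le> L * norm k"
  proof -
    have "continuous_on UNIV (\<lambda>s. \<Sum>j\<in>Basis. norm (?Df s (0, 0, j)))"
      by (intro continuous_intros cDf)
    from continuous_on_UNIV_bounded_above[OF this compact_Icc[of "-T" T]]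
    obtain M where "M \<ge> 0" and M: "\<And>s. s \<in> ?S \<Longrightarrow> (\<Sum>j\<in>Basis. norm (?Df s (0, 0, j))) \<le> M"
      by auto
    have "norm (?Df s (0, 0, k)) \<le> M * norm k" if s: "s \<in> ?S" for s k
    proof -
      have "linear (\<lambda>k. ?Df s (0, 0, k))"
        using linear_compose[OF _ lin, of "\<lambda>k. (0, 0, k)"]
        by (simp add: o_def linear_iff)
      from linear_eq_sum_Basis[OF this, of k]
      have "norm (?Df s (0, 0, k)) = norm (\<Sum>j\<in>Basis. (k \<bullet> j) *\<^sub>R ?Df s (0, 0, j))" by simp
      also have "\<dots> \<le> (\<Sum>j\<in>Basis. norm k * norm (?Df s (0, 0, j)))"
        by (intro sum_norm_le) (simp add: Basis_le_norm mult_right_mono)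
      also have "\<dots> = norm k * (\<Sum>j\<in>Basis. norm (?Df s (0, 0, j)))" by (simp add: sum_distrib_left)
      also have "\<dots> \<le> norm k * M" using M[OF s] by (intro mult_left_mono) auto
      finally show ?thesis by (simp add: mult.commute)
    qed
    with \<open>M \<ge> 0\<close> show thesis by (rule that)
  qed
  obtain C where "C \<ge> 0" and C: "\<And>s q. s \<in> ?S \<Longrightarrow> norm (W q s) \<le> C * norm q"
  proof -
    have cw: "continuous_on UNIV (w i)" if "i \<in> Basis" for i
      by (rule continuous_at_imp_continuous_on) (use has_vector_derivative_continuous[OF w[OF that]] in simp)
    have "continuous_on UNIV (\<lambda>s. \<Sum>i\<in>Basis. norm (w i s))"
      by (intro continuous_on_sum continuous_on_norm cw)
    from continuous_on_UNIV_bounded_above[OF this compact_Icc[of "-T" T]]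
    obtain M where "M \<ge> 0" and M: "\<And>s. s \<in> ?S \<Longrightarrow> (\<Sum>i\<in>Basis. norm (w i s)) \<le> M"
      by auto
    have "norm (W q s) \<le> M * norm q" if s: "s \<in> ?S" for s q
    proof -
      have "norm (W q s) \<le> (\<Sum>i\<in>Basis. norm q * norm (w i s))"
        unfolding W_def by (intro sum_norm_le) (simp add: Basis_le_norm mult_right_mono)
      also have "\<dots> = norm q * (\<Sum>i\<in>Basis. norm (w i s))" by (simp add: sum_distrib_left)
      also have "\<dots> \<le> norm q * M" using M[OF s] by (intro mult_left_mono) auto
      finally show ?thesis by (simp add: mult.commute)
    qed
    with \<open>M \<ge> 0\<close> show thesis by (rule that)
  qed
  \<comment> \<open>Gronwall's inequality with rate \<open>L + \<eta>\<close>, where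
    \<open>\<eta>\<close> is at most 1, will bound the squared remainder by the square of
    \<open>\<eta> * norm q\<close> times \<open>B\<close>; the coefficient \<open>2 * L + 3\<close>
    is \<open>2 * (L + 1) + 1\<close>. This dictates the choice
    \<open>\<eta> = min 1 (e / sqrt B)\<close> below.\<close>
  define B where "B = exp ((2 * L + 3) * T) * (1 + (1 + C)\<^sup>2 * T)"
  have "B > 0" using \<open>C \<ge> 0\<close> \<open>T > 0\<close> by (auto simp: B_def intro!: mult_pos_pos add_pos_nonneg)
  have key: "\<exists>d>0. \<forall>q. norm q < d \<longrightarrow> norm (y (t, p + q) - y (t, p) - W q t) \<le> e * norm q"
    if "e > 0" for e
  proof -
    define \<eta> where "\<eta> = min 1 (e / sqrt B)"
    have \<eta>: "0 < \<eta>" "\<eta> \<le> 1" "\<eta> * sqrt B \<le> e"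
      using \<open>e > 0\<close> \<open>B > 0\<close> by (auto simp: \<eta>_def min_def field_simps)
    let ?K = "(\<lambda>s. (s, p, y (s, p))) ` ?S"
    have "compact ?K"
      by (intro compact_continuous_image continuous_intros continuous_on_compose2[OF cy]) auto
    from Ck_on_1_uniform_linearization[OF f this \<eta>(1)] obtain \<delta> where "\<delta> > 0"
      and \<delta>: "\<And>s h. s \<in> ?S \<Longrightarrow> norm h < \<delta> \<Longrightarrow>
        norm (f ((s, p, y (s, p)) + h) - f (s, p, y (s, p)) - ?Df s h) \<le> \<eta> * norm h"
      by auto
    have "uniformly_continuous_on (?S \<times> cball p 1) y"
      by (intro compact_uniformly_continuous compact_Times continuous_on_subset[OF cy]) auto
    then obtain d1 where "d1 > 0" and d1: "\<And>z z'. z \<in> ?S \<times> cball p 1 \<Longrightarrow> z' \<in> ?S \<times> cball p 1 \<Longrightarrow>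
        dist z' z < d1 \<Longrightarrow> dist (y z') (y z) < \<delta> / 2"
      unfolding uniformly_continuous_on_def using \<open>\<delta> > 0\<close> by (metis half_gt_zero)
    obtain d0 where "d0 > 0" and d0: "\<And>x. norm (x - p) < d0 \<Longrightarrow>
        norm (y (0, x) - y (0, p) - D0 (x - p)) \<le> \<eta> * norm (x - p)"
      using y0 \<eta>(1) unfolding has_derivative_at_alt by metis
    \<comment> \<open>Half of \<open>\<delta>\<close> is reserved for \<open>q\<close>, the other
      half, by way of \<open>d1\<close>, for the displacement \<open>k\<close> of the trajectory;
      together the increment \<open>(0, q, k)\<close> stays below \<open>\<delta>\<close>.\<close>
    define d where "d = Min {d0, d1, 1, \<delta> / 2}"
    have "d > 0" using \<open>d0 > 0\<close> \<open>d1 > 0\<close> \<open>\<delta> > 0\<close> by (simp add: d_def)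
    have "norm (y (t, p + q) - y (t, p) - W q t) \<le> e * norm q" if "norm q < d" for q
    proof -
      have q: "norm q < d0" "norm q < d1" "norm q < 1" "norm q < \<delta> / 2"
        using that by (auto simp: d_def)
      define u where "u s = y (s, p + q) - y (s, p) - W q s" for s
      define u' where "u' s = f (s, p + q, y (s, p + q)) - f (s, p, y (s, p)) - ?Df s (0, q, W q s)" for s
      have der: "(u has_vector_derivative u' s) (at s within ?S)" for s
        unfolding u_def[abs_def] u'_def
        by (rule has_vector_derivative_at_within) (intro has_vector_derivative_diff y W)
      have le: "norm (u' s) \<le> (L + \<eta>) * norm (u s) + \<eta> * (1 + C) * norm q" if s: "s \<in> ?S" for s
      proof -
        define k where "k = y (s, p + q) - y (s, p)"
        have ku: "k = u s + W q s" by (simp add: k_def u_def)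
        have "dist (y (s, p + q)) (y (s, p)) < \<delta> / 2"
          by (rule d1) (use s q in \<open>auto simp: dist_Pair_Pair dist_norm\<close>)
        then have "norm k < \<delta> / 2" by (simp add: k_def dist_norm)
        have nh: "norm (0::real, q, k) \<le> norm q + norm k"
          using norm_Pair_le[of "0::real" "(q, k)"] norm_Pair_le[of q k] by simp
        have "norm (f ((s, p, y (s, p)) + (0, q, k)) - f (s, p, y (s, p)) - ?Df s (0, q, k))
            \<le> \<eta> * norm (0::real, q, k)"
          by (rule \<delta>[OF s]) (use nh q \<open>norm k < \<delta> / 2\<close> in linarith)
        also have "\<dots> \<le> \<eta> * (norm q + norm k)" using nh \<eta> by (intro mult_left_mono) auto
        also have "\<dots> \<le> \<eta> * (norm q + (norm (u s) + C * norm q))"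
        proof -
          have "norm k \<le> norm (u s) + norm (W q s)" unfolding ku by (rule norm_triangle_ineq)
          then show ?thesis using C[OF s, of q] \<eta> by (intro mult_left_mono) auto
        qed
        finally have 1: "norm (f (s, p + q, y (s, p + q)) - f (s, p, y (s, p)) - ?Df s (0, q, k))
            \<le> \<eta> * (norm q + (norm (u s) + C * norm q))" by (simp add: k_def)
        have "?Df s (0, q, k) = ?Df s (0, q, W q s) + ?Df s (0, 0, u s)"
          using linear_add[OF lin, of s "(0, q, W q s)" "(0, 0, u s)"] by (simp add: ku add.commute)
        then have "u' s = (f (s, p + q, y (s, p + q)) - f (s, p, y (s, p)) - ?Df s (0, q, k)) + ?Df s (0, 0, u s)"
          by (simp add: u'_def)
        then have "norm (u' s) \<le> norm (f (s, p + q, y (s, p + q)) - f (s, p, y (s, p)) - ?Df s (0, q, k))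
            + norm (?Df s (0, 0, u s))"
          by (metis norm_triangle_ineq)
        also have "\<dots> \<le> \<eta> * (norm q + (norm (u s) + C * norm q)) + L * norm (u s)"
          using 1 L[OF s] by (rule add_mono)
        finally show ?thesis by (simp add: algebra_simps)
      qed
      have "(norm (u t))\<^sup>2 \<le> exp ((2 * (L + \<eta>) + 1) * \<bar>t - 0\<bar>) *
          ((norm (u 0))\<^sup>2 + (\<eta> * (1 + C) * norm q)\<^sup>2 * \<bar>t - 0\<bar>)"
        using \<open>L \<ge> 0\<close> \<eta> \<open>C \<ge> 0\<close> by (intro gronwall[OF _ Tt(2,1) _ _ der le]) auto
      also have "\<dots> \<le> exp ((2 * L + 3) * T) * ((\<eta> * norm q)\<^sup>2 + (\<eta> * (1 + C) * norm q)\<^sup>2 * T)"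
      proof (intro mult_mono add_mono)
        have "(2 * (L + \<eta>) + 1) * \<bar>t\<bar> \<le> (2 * L + 3) * T"
          using \<eta> \<open>L \<ge> 0\<close> \<open>T > 0\<close> by (intro mult_mono) (auto simp: T_def)
        then show "exp ((2 * (L + \<eta>) + 1) * \<bar>t - 0\<bar>) \<le> exp ((2 * L + 3) * T)" by simp
        have "W q 0 = D0 q"
          using linear_eq_sum_Basis[OF has_derivative_linear[OF y0], of q] by (simp add: W_def w0)
        then have "norm (u 0) \<le> \<eta> * norm q" using d0[of "p + q"] q by (simp add: u_def)
        then show "(norm (u 0))\<^sup>2 \<le> (\<eta> * norm q)\<^sup>2" by (intro power_mono) auto
        show "\<bar>t - 0\<bar> \<le> T" by (simp add: T_def)
      qed auto
      also have "\<dots> = (\<eta> * norm q * sqrt B)\<^sup>2"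
      proof -
        have alg: "x * (a + a * c * z) = a * (x * (1 + c * z))" for x a c z :: real
          by (simp add: algebra_simps)
        have "(\<eta> * (1 + C) * norm q)\<^sup>2 = (\<eta> * norm q)\<^sup>2 * (1 + C)\<^sup>2"
          by (simp add: power_mult_distrib mult_ac)
        have "exp ((2 * L + 3) * T) * ((\<eta> * norm q)\<^sup>2 + (\<eta> * (1 + C) * norm q)\<^sup>2 * T) = (\<eta> * norm q)\<^sup>2 * B"
          unfolding B_def \<open>(\<eta> * (1 + C) * norm q)\<^sup>2 = (\<eta> * norm q)\<^sup>2 * (1 + C)\<^sup>2\<close> by (rule alg)
        then show ?thesis using \<open>B > 0\<close> by (simp add: power_mult_distrib)
      qed
      finally have "(norm (u t))\<^sup>2 \<le> (\<eta> * norm q * sqrt B)\<^sup>2" .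
      then have "norm (u t) \<le> \<eta> * norm q * sqrt B"
        by (rule power2_le_imp_le) (use \<eta> \<open>B > 0\<close> in simp)
      also have "\<dots> = (\<eta> * sqrt B) * norm q" by simp
      also have "\<dots> \<le> e * norm q" using \<eta> by (intro mult_right_mono) auto
      finally show ?thesis by (simp add: u_def)
    qed
    then show ?thesis using \<open>d > 0\<close> by (intro exI[of _ d]) simp
  qed
  have "bounded_linear (\<lambda>q. W q t)"
    unfolding W_def by (intro bounded_linear_sum bounded_linear_scaleR_left[THEN bounded_linear_compose]
        bounded_linear_inner_left)
  moreover have "\<exists>d>0. \<forall>x. norm (x - p) < d \<longrightarrow> norm (y (t, x) - y (t, p) - W (x - p) t) \<le> e * norm (x - p)"
    if e: "e > 0" for e
  proof -
    obtain d where "d > 0" and d: "\<And>q. norm q < d \<Longrightarrow> norm (y (t, p + q) - y (t, p) - W q t) \<le> e * norm q"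
      using key[OF e] by blast
    show ?thesis using \<open>d > 0\<close> d[of "x - p" for x] by (intro exI[of _ d]) auto
  qed
  ultimately show ?thesis unfolding has_derivative_at_alt W_def by blast
qed

text \<open>The derivatives of a solution with respect to the parameters solve a linear equation of the
  same type, so that a single induction on \<open>k\<close> suffices.\<close>

theorem ode_param_Ck:
  fixes f :: "real \<times> 'p::euclidean_space \<times> 'e::euclidean_space \<Rightarrow> 'e"
  assumes "Ck_on k UNIV f" and cy: "continuous_on UNIV y"
    and "Ck_on k UNIV (\<lambda>q. y (0, q))"
    and "\<And>t q. ((\<lambda>s. y (s, q)) has_vector_derivative f (t, q, y (t, q))) (at t)"
  shows "Ck_on k UNIV y"
  using assms
proof (induction k arbitrary: f y)
  case 0
  then show ?case by simp
next
  case (Suc k)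
  note f = Suc.prems(1) and cy = Suc.prems(2) and y0 = Suc.prems(3) and y = Suc.prems(4)
  have yk: "Ck_on k UNIV y"
    by (rule Suc.IH[OF Ck_on_SucD[OF f] cy Ck_on_SucD[OF y0] y])
  have f1: "Ck_on (Suc 0) UNIV f" using f
    by (induction k) (auto dest: Ck_on_SucD simp del: Ck_on.simps)
  let ?D = "\<lambda>z v. frechet_derivative f (at (fst z, fst (snd z), y (fst z, fst (snd z)))) v"
  have D: "Ck_on k UNIV (\<lambda>z::real \<times> 'p \<times> 'e. ?D z v)" for v
    by (rule Ck_on_compose[OF _ _ Ck_on_SucD2[OF f]])
      (auto intro!: Ck_on_intros Ck_on_compose[OF _ _ Ck_on_fst] Ck_on_compose[OF _ _ yk])
  define D0 where "D0 p = frechet_derivative (\<lambda>q. y (0, q)) (at p)" for p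
  have D0: "((\<lambda>q. y (0, q)) has_derivative D0 p) (at p)" for p
    unfolding D0_def using Ck_on_has_derivative[OF y0] by simp
  have lin: "linear (frechet_derivative f (at z))" for z
    using Ck_on_has_derivative[OF f1] has_derivative_linear by blast
  \<comment> \<open>The right-hand side of the variational equation, expanded in fixed directions so
    that \<open>Ck_on\<close> applies. It is affine in the unknown \<open>snd (snd z)\<close>, hence
    Lipschitz in it with a constant that is bounded on boxes.\<close>
  define g where "g i z = ?D z (0, i, 0) + (\<Sum>j\<in>Basis. (snd (snd z) \<bullet> j) *\<^sub>R ?D z (0, 0, j))"
    for i :: 'p and z
  have g_eq: "g i (t, p, u) = frechet_derivative f (at (t, p, y (t, p))) (0, i, u)" for i t p u
  proof -
    let ?F = "frechet_derivative f (at (t, p, y (t, p)))"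
    have "linear (\<lambda>k. ?F (0, 0, k))"
      using linear_compose[OF _ lin, of "\<lambda>k. (0, 0, k)"] by (simp add: o_def linear_iff)
    from linear_eq_sum_Basis[OF this, of u]
    have "g i (t, p, u) = ?F (0, i, 0) + ?F (0, 0, u)" by (simp add: g_def)
    also have "\<dots> = ?F (0, i, u)" by (simp flip: linear_add[OF lin])
    finally show ?thesis .
  qed
  have gk: "Ck_on k UNIV (g i)" for i
    unfolding g_def[abs_def]
    by (intro Ck_on_add Ck_on_sum Ck_on_scaleR Ck_on_inner Ck_on_const D open_UNIV
        Ck_on_compose[OF _ Ck_on_snd Ck_on_snd]) auto
  have "\<exists>w. continuous_on UNIV w \<and> (\<forall>p. w (0, p) = D0 p i) \<and>
      (\<forall>t p. ((\<lambda>s. w (s, p)) has_vector_derivative g i (t, p, w (t, p))) (at t))" for i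
  proof -
    have "\<exists>L. \<forall>t p u v. \<bar>t\<bar> \<le> R \<longrightarrow> norm p \<le> R \<longrightarrow>
        norm (g i (t, p, u) - g i (t, p, v)) \<le> L * norm (u - v)" for R
    proof -
      have cDf: "continuous_on UNIV (\<lambda>z. frechet_derivative f (at (fst z, snd z, y z)) v)" for v
        by (rule continuous_on_compose2[OF Ck_on_imp_continuous_on[OF Ck_on_SucD2[OF f]]])
          (auto intro!: continuous_intros cy)
      have "continuous_on UNIV (\<lambda>z::real \<times> 'p. \<Sum>j\<in>Basis. norm (?D (fst z, snd z, 0) (0, 0, j)))"
        using cDf by (auto intro!: continuous_on_sum continuous_on_norm)
      from continuous_on_UNIV_bounded[OF this, of "{-R..R} \<times> cball 0 R"] obtain M where
        M: "\<And>z. z \<in> {-R..R} \<times> cball 0 R \<Longrightarrow> norm (\<Sum>j\<in>Basis. norm (?D (fst z, snd z, 0) (0, 0, j))) \<le> M"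
        using compact_Times[OF compact_Icc compact_cball] by blast
      have "norm (g i (t, p, u) - g i (t, p, v)) \<le> M * norm (u - v)"
        if tp: "\<bar>t\<bar> \<le> R" "norm p \<le> R" for t p u v
      proof -
        let ?F = "frechet_derivative f (at (t, p, y (t, p)))"
        have "g i (t, p, u) - g i (t, p, v) = (\<Sum>j\<in>Basis. ((u - v) \<bullet> j) *\<^sub>R ?F (0, 0, j))"
          by (simp add: g_def inner_diff_left scaleR_diff_left sum_subtractf)
        also have "norm \<dots> \<le> (\<Sum>j\<in>Basis. norm (u - v) * norm (?F (0, 0, j)))"
          by (intro sum_norm_le) (simp add: Basis_le_norm mult_right_mono)
        also have "\<dots> = norm (u - v) * (\<Sum>j\<in>Basis. norm (?F (0, 0, j)))" by (simp add: sum_distrib_left)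
        also have "\<dots> \<le> norm (u - v) * M"
          using M[of "(t, p)"] tp by (intro mult_left_mono) (auto simp: abs_le_iff)
        finally show ?thesis by (simp add: mult.commute)
      qed
      then show ?thesis by blast
    qed
    moreover have "continuous_on UNIV (\<lambda>p. D0 p i)"
      using Ck_on_imp_continuous_on[OF Ck_on_SucD2[OF y0]] by (simp add: D0_def)
    ultimately show ?thesis
      using ode_param_exists[OF Ck_on_imp_continuous_on[OF gk], of "\<lambda>p. D0 p i" i] by metis
  qed
  then obtain w where cw: "\<And>i. continuous_on UNIV (w i)" and w0: "\<And>i p. w i (0, p) = D0 p i"
    and w: "\<And>i t p. ((\<lambda>s. w i (s, p)) has_vector_derivative g i (t, p, w i (t, p))) (at t)"
    by metis
  have wk: "Ck_on k UNIV (w i)" for i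
    by (rule Suc.IH[OF gk cw _ w]) (use Ck_on_SucD2[OF y0] in \<open>simp add: w0 D0_def\<close>)
  have dp: "((\<lambda>q. y (t, q)) has_derivative (\<lambda>q. \<Sum>i\<in>Basis. (q \<bullet> i) *\<^sub>R w i (t, p))) (at p)" for t p
    using w by (intro ode_param_has_derivative[OF f1 cy y D0]) (auto simp: w0 g_eq)
  have fk: "Ck_on k UNIV (\<lambda>z. f (fst z, snd z, y z))"
    by (rule Ck_on_compose[OF _ _ Ck_on_SucD[OF f]]) (auto intro!: Ck_on_intros yk)
  have "(y has_derivative (\<lambda>v. (\<Sum>i\<in>Basis. (snd v \<bullet> i) *\<^sub>R w i z) + fst v *\<^sub>R f (fst z, snd z, y z))) (at z)" for z
  proof -
    obtain t p where z: "z = (t, p)" by (cases z)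
    let ?h = "\<lambda>q s. blinfun_scaleR_left (f (s, q, y (s, q)))"
    \<comment> \<open>The rule for partial derivatives asks for continuity of the second one. Time
      is put in that slot because its derivative is known to be continuous from the
      equation.\<close>
    have "((\<lambda>(q, s). y (s, q)) has_derivative (\<lambda>(tx, ty). (\<Sum>i\<in>Basis. (tx \<bullet> i) *\<^sub>R w i (t, p)) + ?h p t ty))
        (at (p, t) within UNIV \<times> UNIV)"
    proof (rule has_derivative_partialsI[where f="\<lambda>q s. y (s, q)" and fy="?h"])
      show "((\<lambda>s. y (s, q)) has_derivative blinfun_apply (?h q t)) (at t within UNIV)" for q t
        using y[of q t] by (simp add: has_vector_derivative_def)
      have "continuous_on UNIV (\<lambda>z. ?h (fst z) (snd z))"
        by (intro bounded_linear.continuous_on[OF bounded_linear_blinfun_scaleR_left]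
            continuous_on_compose2[OF Ck_on_imp_continuous_on[OF fk], of _ "\<lambda>z. (snd z, fst z)", simplified])
          (auto intro!: continuous_intros)
      then have "isCont (\<lambda>z. ?h (fst z) (snd z)) (p, t)"
        by (simp add: continuous_on_eq_continuous_at)
      then show "continuous (at (p, t) within UNIV \<times> UNIV) (\<lambda>(q, s). ?h q s)"
        by (simp add: case_prod_unfold)
    qed (use dp in auto)
    then have d: "((\<lambda>(q, s). y (s, q)) has_derivative
        (\<lambda>(tx, ty). (\<Sum>i\<in>Basis. (tx \<bullet> i) *\<^sub>R w i (t, p)) + ?h p t ty)) (at (snd (t, p), fst (t, p)))"
      by simp
    have "((\<lambda>z. (snd z, fst z)) has_derivative (\<lambda>v. (snd v, fst v))) (at (t, p))"
      by (intro has_derivative_Pair has_derivative_snd has_derivative_fst has_derivative_ident)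
    from has_derivative_compose[OF this d]
    show ?thesis by (simp add: z)
  qed
  moreover have "Ck_on k UNIV (\<lambda>z. (\<Sum>i\<in>Basis. (snd v \<bullet> i) *\<^sub>R w i z) + fst v *\<^sub>R f (fst z, snd z, y z))" for v
    by (intro Ck_on_add Ck_on_sum Ck_on_scaleR Ck_on_const wk fk open_UNIV)
  ultimately show ?case by (intro Ck_on_Suc_intro[OF open_UNIV])
qed

text \<open>Off \<open>K\<close> the derivative vanishes, since \<open>K\<close> is closed; on
  \<open>K\<close> it is bounded. The mean value inequality then gives a global constant.\<close>

lemma compact_support_lipschitz:
  fixes X :: "'e::euclidean_space \<Rightarrow> 'e"
  assumes X: "Ck_on (Suc 0) UNIV X" and K: "compact K" "\<And>x. x \<notin> K \<Longrightarrow> X x = 0"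
  shows "\<exists>L\<ge>0. \<forall>x y. norm (X x - X y) \<le> L * norm (x - y)"
proof -
  let ?D = "\<lambda>x. frechet_derivative X (at x)"
  have der: "(X has_derivative ?D x) (at x)" for x using Ck_on_has_derivative[OF X] by simp
  have "continuous_on UNIV (\<lambda>x. \<Sum>i\<in>Basis. norm (?D x i))"
    using Ck_on_SucD2[OF X] by (intro continuous_intros) auto
  from continuous_on_UNIV_bounded_above[OF this K(1)]
    obtain M where "M \<ge> 0" and M: "\<And>x. x \<in> K \<Longrightarrow> (\<Sum>i\<in>Basis. norm (?D x i)) \<le> M"
      by auto
  have D0: "?D x v = 0" if "x \<notin> K" for x v
  proof -
    have "((\<lambda>x. 0) has_derivative (\<lambda>v. 0)) (at x)" by simp
    then have "(X has_derivative (\<lambda>v. 0)) (at x)"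
      by (rule has_derivative_transform_within_open[of _ _ _ _ "- K"])
        (use that K in \<open>auto simp: compact_imp_closed open_Compl\<close>)
    then show ?thesis by (metis frechet_derivative_at)
  qed
  have on: "onorm (?D x) \<le> M" for x
  proof (rule onorm_le)
    fix v
    have "norm (?D x v) = norm (\<Sum>i\<in>Basis. (v \<bullet> i) *\<^sub>R ?D x i)"
      using linear_eq_sum_Basis[OF has_derivative_linear[OF der], of x v] by simp
    also have "\<dots> \<le> (\<Sum>i\<in>Basis. norm v * norm (?D x i))"
      by (intro sum_norm_le) (simp add: Basis_le_norm mult_right_mono)
    also have "\<dots> = norm v * (\<Sum>i\<in>Basis. norm (?D x i))" by (simp add: sum_distrib_left)
    also have "\<dots> \<le> norm v * M"
      using M[of x] D0[of x] \<open>M \<ge> 0\<close> by (cases "x \<in> K") (auto intro: mult_left_mono)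
    finally show "norm (?D x v) \<le> M * norm v" by (simp add: mult.commute)
  qed
  have "norm (X x - X y) \<le> M * norm (x - y)" for x y
    using on der by (intro differentiable_bound[of UNIV X ?D M]) auto
  with \<open>M \<ge> 0\<close> show ?thesis by blast
qed

text \<open>The starting point is taken as the parameter, with the identity as initial value, and
  the right-hand side does not depend on it. Compact support supplies the Lipschitz
  constant.\<close>

theorem smooth_global_flow:
  fixes X :: "'e::euclidean_space \<Rightarrow> 'e"
  assumes X: "\<And>k. Ck_on k UNIV X" and K: "compact K" "\<And>x. x \<notin> K \<Longrightarrow> X x = 0"
  obtains \<Phi> where "\<And>k. Ck_on k UNIV \<Phi>" "\<And>p. \<Phi> (0, p) = p"
    "\<And>t p. ((\<lambda>s. \<Phi> (s, p)) has_vector_derivative X (\<Phi> (t, p))) (at t)"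
proof -
  let ?f = "\<lambda>z::real \<times> 'e \<times> 'e. X (snd (snd z))"
  have f: "Ck_on k UNIV ?f" for k
    by (rule Ck_on_compose[OF _ _ X]) (auto intro: Ck_on_compose[OF _ Ck_on_snd Ck_on_snd])
  obtain L where "\<And>x y. norm (X x - X y) \<le> L * norm (x - y)"
    using compact_support_lipschitz[OF X K] by auto
  then have lip: "\<exists>L. \<forall>t p x y. \<bar>t\<bar> \<le> R \<longrightarrow> norm p \<le> R \<longrightarrow>
      norm (?f (t, p, x) - ?f (t, p, y)) \<le> L * norm (x - y)" for R
    by auto
  obtain \<Phi> where c: "continuous_on UNIV \<Phi>" and 0: "\<And>p. \<Phi> (0, p) = p"
    and der: "\<And>t p. ((\<lambda>s. \<Phi> (s, p)) has_vector_derivative ?f (t, p, \<Phi> (t, p))) (at t)"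
    using ode_param_exists[OF Ck_on_imp_continuous_on[OF f[of 0]] continuous_on_id lip] by auto
  have "Ck_on k UNIV \<Phi>" for k
    by (rule ode_param_Ck[OF f c _ der]) (simp add: 0 Ck_on_id)
  with 0 der show thesis by (intro that[of \<Phi>]) auto
qed

text \<open>By the Leibniz rule the derivative in direction \<open>v\<close> is again an integral of
  this form, with \<open>h\<close> replaced by its derivative in direction \<open>(0, v)\<close>.
  The set \<open>N\<close> is general because the integrand of the lift is smooth only on a part of
  the space.\<close>

lemma Ck_on_integral:
  fixes h :: "real \<times> 'z::euclidean_space \<Rightarrow> 'b::euclidean_space"
  assumes "{0..1} \<times> Z \<subseteq> N" "open Z" "Ck_on k N h"
  shows "Ck_on k Z (\<lambda>z. integral {0..1} (\<lambda>s. h (s, z)))"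
  using assms(3)
proof (induction k arbitrary: h)
  case 0
  have "continuous_on (Z \<times> cbox 0 1) (\<lambda>(z, s). h (s, z))"
    unfolding case_prod_beta
    by (rule continuous_on_compose2[of N h]) (use 0 assms(1) in \<open>auto intro!: continuous_intros\<close>)
  from integral_continuous_on_param[OF this] show ?case by simp
next
  case (Suc k)
  let ?D = "\<lambda>z s v. frechet_derivative h (at (s, z)) (0, v)"
  have der: "((\<lambda>z. h (s, z)) has_derivative ?D z s) (at z within S)" if "z \<in> Z" "s \<in> {0..1}" for z s S
    using has_derivative_Pair_right[OF Ck_on_has_derivative[OF Suc.prems]] that assms(1) by blast
  have bl: "blinfun_apply (Blinfun (?D z s)) = ?D z s" if "z \<in> Z" "s \<in> {0..1}" for z s
    using has_derivative_bounded_linear[OF der[OF that]] by (rule bounded_linear_Blinfun_apply)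
  have cD: "continuous_on (Z \<times> {0..1}) (\<lambda>(z, s). ?D z s v)" for v
    unfolding case_prod_beta
    by (rule continuous_on_compose2[of N "\<lambda>x. frechet_derivative h (at x) (0, v)" _ "\<lambda>x. (snd x, fst x)"])
      (use Ck_on_imp_continuous_on[OF Ck_on_SucD2[OF Suc.prems]] assms(1) in \<open>auto intro!: continuous_intros\<close>)
  have cB: "continuous_on (Z \<times> {0..1}) (\<lambda>(z, s). Blinfun (?D z s))"
  proof (rule continuous_on_blinfun_componentwise)
    fix i :: 'z
    show "continuous_on (Z \<times> {0..1}) (\<lambda>x. blinfun_apply (case x of (z, s) \<Rightarrow> Blinfun (?D z s)) i)"
      by (rule continuous_on_eq[OF cD[of i]]) (auto simp: bl)
  qed
  show ?case
  proof (rule Ck_on_Suc_intro[OF \<open>open Z\<close>])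
    fix z assume z: "z \<in> Z"
    then obtain r where "r > 0" and r: "ball z r \<subseteq> Z" using \<open>open Z\<close> openE by blast
    have ch: "continuous_on {0..1} (\<lambda>s. h (s, x))" if "x \<in> Z" for x
      by (rule continuous_on_compose2[OF Ck_on_imp_continuous_on[OF Suc.prems]])
        (use that assms(1) in \<open>auto intro!: continuous_intros\<close>)
    have "((\<lambda>x. integral (cbox 0 1) (\<lambda>s. h (s, x))) has_derivative
        blinfun_apply (integral (cbox 0 1) (\<lambda>s. Blinfun (?D z s)))) (at z within ball z r)"
    proof (rule leibniz_rule)
      show "((\<lambda>x. h (s, x)) has_derivative blinfun_apply (Blinfun (?D x s))) (at x within ball z r)"
        if "x \<in> ball z r" "s \<in> cbox 0 1" for x s
      proof -
        have "x \<in> Z" "s \<in> {0..1}" using that r by auto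
        then show ?thesis using der bl by simp
      qed
      show "(\<lambda>s. h (s, x)) integrable_on cbox 0 1" if "x \<in> ball z r" for x
        using ch that r by (auto intro!: integrable_continuous_real)
      show "continuous_on (ball z r \<times> cbox 0 1) (\<lambda>(z, s). Blinfun (?D z s))"
        by (rule continuous_on_subset[OF cB]) (use r in auto)
    qed (use \<open>r > 0\<close> in auto)
    moreover have "blinfun_apply (integral (cbox 0 1) (\<lambda>s. Blinfun (?D z s))) v = integral {0..1} (\<lambda>s. ?D z s v)" for v
    proof -
      have "continuous_on {0..1} (\<lambda>s. Blinfun (?D z s))"
        using continuous_on_compose2[OF cB continuous_on_Pair[OF continuous_on_const[of "{0..1}" z] continuous_on_id]]
          z by auto
      then have "(\<lambda>s. Blinfun (?D z s)) integrable_on {0..1}" by (rule integrable_continuous_real)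
      from blinfun_apply_integral[OF this, of v] show ?thesis
        using bl[OF z] by (auto intro!: integral_cong)
    qed
    then have "blinfun_apply (integral (cbox 0 1) (\<lambda>s. Blinfun (?D z s))) = (\<lambda>v. integral {0..1} (\<lambda>s. ?D z s v))"
      by (rule ext)
    ultimately show "((\<lambda>z. integral {0..1} (\<lambda>s. h (s, z))) has_derivative (\<lambda>v. integral {0..1} (\<lambda>s. ?D z s v))) (at z)"
      using \<open>r > 0\<close> by (simp add: at_within_open[of z "ball z r"])
  next
    show "Ck_on k Z (\<lambda>z. integral {0..1} (\<lambda>s. ?D z s v))" for v
      by (rule Suc.IH[OF Ck_on_SucD2[OF Suc.prems]])
  qed
qed

section \<open>Smooth maps on subsets\<close>

lemma smooth_on_subset: "smooth_on T f \<Longrightarrow> S \<subseteq> T \<Longrightarrow> smooth_on S f"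
  unfolding smooth_on_def by (meson Int_mono order_refl subsetD)

lemma smooth_on_local:
  assumes "\<And>p. p \<in> S \<Longrightarrow> \<exists>N. open N \<and> p \<in> N \<and> smooth_on (S \<inter> N) f"
  shows "smooth_on S f"
  unfolding smooth_on_def
proof
  fix p assume p: "p \<in> S"
  obtain N where N: "open N" "p \<in> N" "smooth_on (S \<inter> N) f" using assms[OF p] by auto
  then obtain U g where "open U" "p \<in> U" "\<forall>k. Ck_on k U g" "\<forall>q\<in>S \<inter> N \<inter> U. g q = f q"
    using p unfolding smooth_on_def by (meson IntI)
  then show "\<exists>U g. open U \<and> p \<in> U \<and> (\<forall>k. Ck_on k U g) \<and> (\<forall>q\<in>S \<inter> U. g q = f q)"
    using N by (intro exI[of _ "U \<inter> N"] exI[of _ g]) (auto intro: Ck_on_subset)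
qed

lemma smooth_on_cong:
  assumes "smooth_on S f" "\<And>x. x \<in> S \<Longrightarrow> f x = g x"
  shows "smooth_on S g"
  using assms unfolding smooth_on_def by (metis IntD1)

lemma smooth_onI_Ck:
  assumes "open U" "S \<subseteq> U" "\<And>k. Ck_on k U f"
  shows "smooth_on S f"
  using assms unfolding smooth_on_def by (intro ballI exI[of _ U] exI[of _ f]) auto

lemma smooth_on_compose:
  assumes f: "smooth_on S f" and g: "smooth_on T g" and sub: "f ` S \<subseteq> T"
  shows "smooth_on S (\<lambda>x. g (f x))"
  unfolding smooth_on_def
proof
  fix p assume p: "p \<in> S"
  obtain U f1 where U: "open U" "p \<in> U" "\<forall>k. Ck_on k U f1" "\<forall>q\<in>S \<inter> U. f1 q = f q"
    using f p unfolding smooth_on_def by meson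
  have "f p \<in> T" using p sub by auto
  then obtain W g1 where W: "open W" "f p \<in> W" "\<forall>k. Ck_on k W g1" "\<forall>q\<in>T \<inter> W. g1 q = g q"
    using g unfolding smooth_on_def by meson
  define U' where "U' = U \<inter> f1 -` W"
  have "open U'"
    unfolding U'_def using U(1) W(1) Ck_on_imp_continuous_on U(3) continuous_open_preimage by blast
  moreover have "p \<in> U'" using U W p by (auto simp: U'_def)
  moreover have "Ck_on k U' (\<lambda>x. g1 (f1 x))" for k
    by (rule Ck_on_compose[OF \<open>open U'\<close> Ck_on_subset[of k U f1] W(3)[rule_format]])
      (use U(3) in \<open>auto simp: U'_def\<close>)
  moreover have "g1 (f1 q) = g (f q)" if "q \<in> S \<inter> U'" for q
    using that U W sub by (auto simp: U'_def)
  ultimately show "\<exists>U h. open U \<and> p \<in> U \<and> (\<forall>k. Ck_on k U h) \<and> (\<forall>q\<in>S \<inter> U. h q = g (f q))"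
    by (intro exI[of _ U'] exI[of _ "\<lambda>x. g1 (f1 x)"]) auto
qed

lemma smooth_on_Pair:
  assumes f: "smooth_on S f" and g: "smooth_on S g"
  shows "smooth_on S (\<lambda>x. (f x, g x))"
  unfolding smooth_on_def
proof
  fix p assume p: "p \<in> S"
  obtain U f1 where U: "open U" "p \<in> U" "\<forall>k. Ck_on k U f1" "\<forall>q\<in>S \<inter> U. f1 q = f q"
    using f p unfolding smooth_on_def by meson
  obtain W g1 where W: "open W" "p \<in> W" "\<forall>k. Ck_on k W g1" "\<forall>q\<in>S \<inter> W. g1 q = g q"
    using g p unfolding smooth_on_def by meson
  have "Ck_on k (U \<inter> W) (\<lambda>x. (f1 x, g1 x))" for k
    using U W by (intro Ck_on_Pair) (auto intro: Ck_on_subset)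
  then show "\<exists>U h. open U \<and> p \<in> U \<and> (\<forall>k. Ck_on k U h) \<and> (\<forall>q\<in>S \<inter> U. h q = (f q, g q))"
    using U W by (intro exI[of _ "U \<inter> W"] exI[of _ "\<lambda>x. (f1 x, g1 x)"]) auto
qed

lemma smooth_on_fst: "smooth_on S fst" and smooth_on_snd: "smooth_on S snd"
  and smooth_on_id: "smooth_on T (\<lambda>x. x)" and smooth_on_const: "smooth_on T' (\<lambda>x. c)"
  by (auto intro!: smooth_onI_Ck[OF open_UNIV] Ck_on_intros)

lemma smooth_on_imp_differentiable:
  assumes "smooth_on S f" "p \<in> S"
  shows "f differentiable (at p within S)"
proof -
  obtain U g where U: "open U" "p \<in> U" "\<forall>k. Ck_on k U g" "\<forall>q\<in>S \<inter> U. g q = f q"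
    using assms unfolding smooth_on_def by meson
  then have "Ck_on (Suc 0) U g" by blast
  then have "(g has_derivative frechet_derivative g (at p)) (at p within S)"
    using Ck_on_has_derivative[of 0 U g p] U(2) has_derivative_at_withinI by blast
  then have "(f has_derivative frechet_derivative g (at p)) (at p within S)"
    by (rule has_derivative_transform_eventually)
      (use U assms(2) in \<open>auto simp: eventually_at_topological intro!: exI[of _ U]\<close>)
  then show ?thesis unfolding differentiable_def by blast
qed

lemma smooth_on_imp_continuous_on: "smooth_on S f \<Longrightarrow> continuous_on S f"
  unfolding continuous_on_eq_continuous_within
  by (auto intro: differentiable_imp_continuous_within smooth_on_imp_differentiable)

text \<open>\<open>X\<close> extends \<open>f\<close> times a bump function to the whole space,
  although \<open>f\<close> lives on \<open>S\<close> only, which may have a boundary. The bump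
  \<open>h\<close> is recorded because the relation between \<open>X\<close> and \<open>f\<close> on
  \<open>S\<close> shows that \<open>X\<close> stays parallel to whatever \<open>f\<close> is
  parallel to.\<close>

definition cutoff ::
  "'a::euclidean_space set \<Rightarrow> ('a \<Rightarrow> 'b::euclidean_space) \<Rightarrow> 'a \<Rightarrow> real \<Rightarrow> ('a \<Rightarrow> 'b) \<Rightarrow> ('a \<Rightarrow> real) \<Rightarrow> bool"
where
  "cutoff S f p r X h \<longleftrightarrow> 0 < r \<and> (\<forall>k. Ck_on k UNIV X) \<and>
    (\<forall>y. y \<notin> ball p r \<longrightarrow> X y = 0 \<and> h y = 0) \<and> (\<forall>y\<in>cball p (r / 2). h y = 1) \<and>
    (\<forall>y\<in>S. X y = h y *\<^sub>R f y)"

text \<open>Multiply a local extension of \<open>f\<close> by a bump function supported inside its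
  domain, and continue by 0.\<close>

lemma smooth_on_cutoff:
  fixes f :: "'a::euclidean_space \<Rightarrow> 'b::euclidean_space"
  assumes f: "smooth_on S f" and p: "p \<in> S" and "\<epsilon> > 0"
  shows "\<exists>r X h. r \<le> \<epsilon> \<and> cutoff S f p r X h"
proof -
  obtain U g where U: "open U" "p \<in> U" "\<forall>k. Ck_on k U g" "\<forall>q\<in>S \<inter> U. g q = f q"
    using f p unfolding smooth_on_def by meson
  obtain r0 where r0: "r0 > 0" "cball p r0 \<subseteq> U"
    using U open_contains_cball by metis
  define r where "r = min r0 \<epsilon>"
  have r: "r > 0" "cball p r \<subseteq> U" using r0 \<open>\<epsilon> > 0\<close> by (auto simp: r_def)
  obtain h :: "'a \<Rightarrow> real" where h: "\<And>k. Ck_on k UNIV h" "\<And>x. x \<in> cball p (r / 2) \<Longrightarrow> h x = 1"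
    "\<And>x. x \<notin> ball p r \<Longrightarrow> h x = 0" using smooth_bump[OF r(1), of p] by metis
  define X where "X y = (if y \<in> U then h y *\<^sub>R g y else 0)" for y
  have "Ck_on k UNIV X" for k
  proof (rule Ck_on_local)
    fix x :: 'a
    show "\<exists>V. open V \<and> x \<in> V \<and> Ck_on k V X"
    proof (cases "x \<in> U")
      case True
      have "Ck_on k U (\<lambda>y. h y *\<^sub>R g y)"
        using U(1,3) h(1) by (intro Ck_on_scaleR) (auto intro: Ck_on_subset)
      then have "Ck_on k U X" by (rule Ck_on_cong[OF U(1), rotated]) (simp add: X_def)
      then show ?thesis using True U(1) by blast
    next
      case False
      have X0: "X y = 0" if "y \<notin> cball p r" for y using h(3)[of y] that by (auto simp: X_def)
      have "Ck_on k (- cball p r) X"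
        by (rule Ck_on_cong[OF _ _ Ck_on_const[of _ _ 0]]) (use X0 in \<open>auto simp: open_Compl\<close>)
      moreover have "x \<in> - cball p r" using False r by auto
      ultimately show ?thesis by (intro exI[of _ "- cball p r"]) (auto simp: open_Compl)
    qed
  qed
  moreover have "X y = h y *\<^sub>R f y" if "y \<in> S" for y
  proof (cases "y \<in> U")
    case True
    then show ?thesis using U that by (auto simp: X_def)
  next
    case False
    then have "y \<notin> ball p r" using r ball_subset_cball by blast
    then show ?thesis using h(3)[of y] False by (simp add: X_def)
  qed
  moreover have "X y = 0" if "y \<notin> ball p r" for y using h(3)[OF that] by (simp add: X_def)
  ultimately show ?thesis using r h \<open>\<epsilon> > 0\<close>
    unfolding cutoff_def by (intro exI[of _ r] exI[of _ X] exI[of _ h]) (auto simp: r_def)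
qed

lemma cutoff_lipschitz:
  fixes f :: "'a::euclidean_space \<Rightarrow> 'a"
  assumes "cutoff S f p r X h"
  shows "\<exists>L\<ge>0. \<forall>x y. norm (X x - X y) \<le> L * norm (x - y)"
proof (rule compact_support_lipschitz)
  show "Ck_on (Suc 0) UNIV X" using assms unfolding cutoff_def by blast
  show "compact (cball p r)" by simp
  show "X y = 0" if "y \<notin> cball p r" for y using assms that unfolding cutoff_def by auto
qed

section \<open>Flows preserving a half-space\<close>

text \<open>By Gronwall's inequality in both time directions \<open>z t \<bullet> b\<close> vanishes identically or nowhere.\<close>

lemma flow_preserves_half_space:
  fixes X :: "'e::euclidean_space \<Rightarrow> 'e"
  assumes L: "\<And>x y. norm (X x - X y) \<le> L * norm (x - y)" and "L \<ge> 0"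
    and z: "\<And>t. (z has_vector_derivative X (z t)) (at t)"
    and b: "b \<in> Basis" and tang: "\<And>y. y \<bullet> b = 0 \<Longrightarrow> X y \<bullet> b = 0"
    and z0: "z 0 \<in> half_space b"
  shows "z t \<in> half_space b"
proof -
  define u where "u t = z t \<bullet> b" for t
  have der: "(u has_vector_derivative X (z t) \<bullet> b) (at t)" for t
    unfolding u_def[abs_def]
    by (rule bounded_linear.has_vector_derivative[OF bounded_linear_inner_left z])
  have le: "norm (X (z t) \<bullet> b) \<le> L * norm (u t) + 0" for t
  proof -
    define y where "y = z t - (z t \<bullet> b) *\<^sub>R b"
    have "y \<bullet> b = 0" using b by (simp add: y_def inner_diff_left)
    then have "X (z t) \<bullet> b = (X (z t) - X y) \<bullet> b" by (simp add: tang inner_diff_left)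
    also have "norm \<dots> \<le> norm (X (z t) - X y) * norm b" using Cauchy_Schwarz_ineq2 by auto
    also have "\<dots> \<le> L * norm (z t - y)" using L b by simp
    also have "z t - y = u t *\<^sub>R b" by (simp add: y_def u_def)
    finally show ?thesis using b by simp
  qed
  have zero: "u t = 0" if "u s = 0" for s t
  proof -
    have "(norm (u t))\<^sup>2 \<le> exp ((2 * L + 1) * \<bar>t - s\<bar>) * ((norm (u s))\<^sup>2 + 0\<^sup>2 * \<bar>t - s\<bar>)"
      by (rule gronwall[OF is_interval_univ _ _ \<open>L \<ge> 0\<close> _ has_vector_derivative_at_within[OF der] le]) auto
    then show ?thesis using that by simp
  qed
  have cont: "continuous_on UNIV u"
    by (rule continuous_at_imp_continuous_on) (use has_vector_derivative_continuous[OF der] in simp)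
  show ?thesis
  proof (rule ccontr)
    assume "z t \<notin> half_space b"
    then have neg: "u t < 0" by (simp add: u_def half_space_def)
    have "connected (range u)" using cont by (rule connected_continuous_image) simp
    moreover have "u 0 \<ge> 0" using z0 by (simp add: u_def half_space_def)
    ultimately have "0 \<in> range u" using neg unfolding connected_iff_interval by (metis less_imp_le rangeI)
    then obtain s where "u s = 0" by auto
    then show False using zero[of s t] neg by simp
  qed
qed

section \<open>Chart systems\<close>

text \<open>Unlike \<^const>\<open>smooth_manifold\<close> this does not prescribe the images of the charts, so that
  it also covers \<open>cylinder_atlas\<close> and \<open>euclidean_atlas\<close>.\<close>

definition chart_system :: "('m::topological_space, 'e::euclidean_space) chart set \<Rightarrow> bool" where
  "chart_system A \<longleftrightarrow> (\<forall>c\<in>A. open (fst c) \<and>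
      homeomorphism (fst c) (snd c ` fst c) (snd c) (inv_into (fst c) (snd c))) \<and>
    (\<Union>c\<in>A. fst c) = UNIV \<and>
    (\<forall>c\<in>A. \<forall>d\<in>A. smooth_on (snd c ` (fst c \<inter> fst d)) (local_rep c d id))"

abbreviation chart_inv :: "('m, 'e) chart \<Rightarrow> 'e \<Rightarrow> 'm" where
  "chart_inv c \<equiv> inv_into (fst c) (snd c)"

lemma chart_inv_mem: "y \<in> snd c ` fst c \<Longrightarrow> chart_inv c y \<in> fst c"
  by (rule inv_into_into)

lemma chart_chart_inv: "y \<in> snd c ` fst c \<Longrightarrow> snd c (chart_inv c y) = y"
  by (rule f_inv_into_f)

lemma smooth_manifold_chart_system: "smooth_manifold b A \<Longrightarrow> chart_system A"
  unfolding smooth_manifold_def chart_system_def is_chart_def by blast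

context
  fixes A :: "('m::topological_space, 'e::euclidean_space) chart set"
  assumes A: "chart_system A"
begin

lemma chart_open: "c \<in> A \<Longrightarrow> open (fst c)"
  using A unfolding chart_system_def by blast

lemma chart_homeomorphism: "c \<in> A \<Longrightarrow> homeomorphism (fst c) (snd c ` fst c) (snd c) (chart_inv c)"
  using A unfolding chart_system_def by blast

lemma chart_inv_chart [simp]: "c \<in> A \<Longrightarrow> x \<in> fst c \<Longrightarrow> chart_inv c (snd c x) = x"
  using chart_homeomorphism homeomorphism_apply1 by metis

lemma chart_inj: "c \<in> A \<Longrightarrow> x \<in> fst c \<Longrightarrow> y \<in> fst c \<Longrightarrow> snd c x = snd c y \<Longrightarrow> x = y"
  using chart_inv_chart by metis

lemma chart_continuous: "c \<in> A \<Longrightarrow> continuous_on (fst c) (snd c)"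
  using chart_homeomorphism homeomorphism_cont1 by metis

lemma chart_inv_continuous: "c \<in> A \<Longrightarrow> continuous_on (snd c ` fst c) (chart_inv c)"
  using chart_homeomorphism homeomorphism_cont2 by metis

lemma chart_cover: "\<exists>c\<in>A. x \<in> fst c"
  using A unfolding chart_system_def by blast

lemma chart_transition: "c \<in> A \<Longrightarrow> d \<in> A \<Longrightarrow> smooth_on (snd c ` (fst c \<inter> fst d)) (local_rep c d id)"
  using A unfolding chart_system_def by blast

lemma chart_image_open:
  assumes "c \<in> A" "open V"
  shows "\<exists>N. open N \<and> snd c ` (fst c \<inter> V) = snd c ` fst c \<inter> N"
proof -
  have "openin (top_of_set (fst c)) (fst c \<inter> V)" using assms(2) by (rule openin_open_Int)
  then have "openin (top_of_set (snd c ` fst c)) (snd c ` (fst c \<inter> V))"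
    using homeomorphism_imp_open_map[OF chart_homeomorphism[OF assms(1)]] by blast
  then show ?thesis unfolding openin_open by blast
qed

text \<open>Smoothness of \<open>h\<close> may be tested near each point in a single pair of charts.\<close>

lemma smooth_mapI:
  fixes B :: "('n::topological_space, 'f::euclidean_space) chart set"
  assumes B: "chart_system B" and h: "continuous_on W h"
    and loc: "\<And>x. x \<in> W \<Longrightarrow> \<exists>V c0 d0. open V \<and> x \<in> V \<and> c0 \<in> A \<and> d0 \<in> B \<and> x \<in> fst c0 \<and> h x \<in> fst d0 \<and>
      smooth_on (snd c0 ` {y \<in> fst c0 \<inter> W \<inter> V. h y \<in> fst d0}) (local_rep c0 d0 h)"
  shows "smooth_map A B W h"
  unfolding smooth_map_def
proof (intro conjI ballI h)
  fix c d assume c: "c \<in> A" and d: "d \<in> B"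
  let ?S = "snd c ` {x \<in> fst c \<inter> W. h x \<in> fst d}"
  show "smooth_on ?S (local_rep c d h)"
  proof (rule smooth_on_local)
    fix p assume "p \<in> ?S"
    then obtain x where x: "p = snd c x" "x \<in> fst c" "x \<in> W" "h x \<in> fst d" by auto
    from loc[OF x(3)] obtain V c0 d0 where V: "open V" "x \<in> V" and c0: "c0 \<in> A" "x \<in> fst c0"
      and d0: "d0 \<in> B" "h x \<in> fst d0"
      and sm: "smooth_on (snd c0 ` {y \<in> fst c0 \<inter> W \<inter> V. h y \<in> fst d0}) (local_rep c0 d0 h)"
      by blast
    have "openin (top_of_set W) (W \<inter> h -` fst d0)"
      using h B d0(1) by (intro continuous_openin_preimage_gen) (auto simp: chart_system_def)
    then obtain T where T: "open T" "W \<inter> h -` fst d0 = W \<inter> T" unfolding openin_open by auto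
    define V' where "V' = V \<inter> T \<inter> fst c0"
    have "open V'" using V T chart_open[OF c0(1)] by (auto simp: V'_def)
    then obtain N where N: "open N" "snd c ` (fst c \<inter> V') = snd c ` fst c \<inter> N"
      using chart_image_open[OF c] by blast
    have "x \<in> T" using T(2) x d0 by auto
    then have pN: "p \<in> N" using N(2) x V c0 by (auto simp: V'_def)
    have SN: "?S \<inter> N \<subseteq> snd c ` {y \<in> fst c \<inter> fst c0 \<inter> W \<inter> V. h y \<in> fst d \<inter> fst d0}"
    proof
      fix q assume q: "q \<in> ?S \<inter> N"
      then obtain y where y: "q = snd c y" "y \<in> fst c" "y \<in> W" "h y \<in> fst d" by auto
      have "q \<in> snd c ` (fst c \<inter> V')" using N(2) q y by auto
      then obtain y' where y': "q = snd c y'" "y' \<in> fst c" "y' \<in> V'" by auto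
      then have "y' = y" using chart_inj[OF c] y by metis
      then show "q \<in> snd c ` {y \<in> fst c \<inter> fst c0 \<inter> W \<inter> V. h y \<in> fst d \<inter> fst d0}"
        using y y' T(2) by (auto simp: V'_def)
    qed
    have s1: "smooth_on (?S \<inter> N) (local_rep c c0 id)"
      by (rule smooth_on_subset[OF chart_transition[OF c c0(1)]]) (use SN in blast)
    have e1: "local_rep c c0 id (snd c y) = snd c0 y" if "y \<in> fst c" for y
      using that c by (simp add: local_rep_def)
    have e2: "local_rep c0 d0 h (snd c0 y) = snd d0 (h y)" if "y \<in> fst c0" for y
      using that c0 by (simp add: local_rep_def)
    have e3: "local_rep d0 d id (snd d0 w) = snd d w" if "w \<in> fst d0" for w
      using that homeomorphism_apply1[of "fst d0" _ "snd d0" "chart_inv d0" w] B d0(1)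
      by (auto simp: local_rep_def chart_system_def)
    have s2: "smooth_on (?S \<inter> N) (\<lambda>q. local_rep c0 d0 h (local_rep c c0 id q))"
    proof (rule smooth_on_compose[OF s1 sm], rule image_subsetI)
      fix q assume "q \<in> ?S \<inter> N"
      then obtain y where "q = snd c y" "y \<in> fst c" "y \<in> fst c0" "y \<in> W" "y \<in> V" "h y \<in> fst d0"
        using SN by fast
      then show "local_rep c c0 id q \<in> snd c0 ` {y \<in> fst c0 \<inter> W \<inter> V. h y \<in> fst d0}"
        by (auto simp: e1)
    qed
    have tr: "smooth_on (snd d0 ` (fst d0 \<inter> fst d)) (local_rep d0 d id)"
      using B d d0(1) by (auto simp: chart_system_def)
    have "smooth_on (?S \<inter> N) (\<lambda>q. local_rep d0 d id (local_rep c0 d0 h (local_rep c c0 id q)))"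
    proof (rule smooth_on_compose[OF s2 tr], rule image_subsetI)
      fix q assume "q \<in> ?S \<inter> N"
      then obtain y where "q = snd c y" "y \<in> fst c" "y \<in> fst c0" "h y \<in> fst d0" "h y \<in> fst d"
        using SN by fast
      then show "local_rep c0 d0 h (local_rep c c0 id q) \<in> snd d0 ` (fst d0 \<inter> fst d)"
        by (auto simp: e1 e2)
    qed
    moreover have "local_rep d0 d id (local_rep c0 d0 h (local_rep c c0 id q)) = local_rep c d h q"
      if q: "q \<in> ?S \<inter> N" for q
    proof -
      obtain y where "q = snd c y" "y \<in> fst c" "y \<in> fst c0" "h y \<in> fst d0" "h y \<in> fst d"
        using q SN by fast
      then show ?thesis using c by (simp add: e1 e2 e3) (simp add: local_rep_def)
    qed
    ultimately have "smooth_on (?S \<inter> N) (local_rep c d h)" by (rule smooth_on_cong)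
    then show "\<exists>N. open N \<and> p \<in> N \<and> smooth_on (?S \<inter> N) (local_rep c d h)"
      using N(1) pN by blast
  qed
qed

end

lemma smooth_map_cong:
  assumes "smooth_map A B W h" "\<And>x. x \<in> W \<Longrightarrow> h x = h' x" "chart_system A"
  shows "smooth_map A B W h'"
  unfolding smooth_map_def
proof (intro conjI ballI)
  show "continuous_on W h'"
    using assms(1,2) continuous_on_eq unfolding smooth_map_def by blast
  fix c d assume c: "c \<in> A" and d: "d \<in> B"
  have "{x \<in> fst c \<inter> W. h' x \<in> fst d} = {x \<in> fst c \<inter> W. h x \<in> fst d}" using assms(2) by auto
  moreover have "smooth_on (snd c ` {x \<in> fst c \<inter> W. h x \<in> fst d}) (local_rep c d h)"
    using assms(1) c d unfolding smooth_map_def by blast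
  then have "smooth_on (snd c ` {x \<in> fst c \<inter> W. h x \<in> fst d}) (local_rep c d h')"
    by (rule smooth_on_cong) (use chart_inv_chart[OF assms(3) c] assms(2) in \<open>auto simp: local_rep_def\<close>)
  ultimately show "smooth_on (snd c ` {x \<in> fst c \<inter> W. h' x \<in> fst d}) (local_rep c d h')" by simp
qed

lemma smooth_map_subset:
  assumes "smooth_map A B W h" "W' \<subseteq> W"
  shows "smooth_map A B W' h"
  unfolding smooth_map_def
proof (intro conjI ballI)
  show "continuous_on W' h" using assms continuous_on_subset unfolding smooth_map_def by blast
  fix c d assume "c \<in> A" "d \<in> B"
  then have "smooth_on (snd c ` {x \<in> fst c \<inter> W. h x \<in> fst d}) (local_rep c d h)"
    using assms unfolding smooth_map_def by blast
  then show "smooth_on (snd c ` {x \<in> fst c \<inter> W'. h x \<in> fst d}) (local_rep c d h)"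
    by (rule smooth_on_subset) (use assms(2) in auto)
qed

lemma smooth_mapD:
  "smooth_map A B W h \<Longrightarrow> c \<in> A \<Longrightarrow> d \<in> B \<Longrightarrow>
    smooth_on (snd c ` {x \<in> fst c \<inter> W. h x \<in> fst d}) (local_rep c d h)"
  unfolding smooth_map_def by blast

lemma chart_system_euclidean: "chart_system (euclidean_atlas :: ('e::euclidean_space, 'e) chart set)"
  by (auto simp: chart_system_def euclidean_atlas_def homeomorphism_def local_rep_def inv_id id_def o_def
      intro: smooth_on_id continuous_on_id)

lemma cylinder_chart_inv:
  assumes "inj_on (snd c) (fst c)" "y \<in> snd c ` fst c"
  shows "inv_into (fst c \<times> UNIV) (map_prod (snd c) id) (y, t) = (chart_inv c y, t)"
  by (rule inv_into_f_eq) (use assms in \<open>auto intro: map_prod_inj_on f_inv_into_f inv_into_into\<close>)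

lemma chart_system_cylinder:
  fixes A :: "('m::topological_space, 'e::euclidean_space) chart set"
  assumes A: "chart_system A"
  shows "chart_system (cylinder_atlas A)"
proof -
  have inj: "inj_on (snd c) (fst c)" if "c \<in> A" for c
    using chart_inj[OF A that] by (auto intro: inj_onI)
  have im: "map_prod f id ` (S \<times> UNIV) = f ` S \<times> UNIV" for f :: "'m \<Rightarrow> 'e" and S
    by (auto simp: image_iff)
  have "open (fst c \<times> (UNIV :: real set)) \<and> homeomorphism (fst c \<times> UNIV) (map_prod (snd c) id ` (fst c \<times> UNIV))
      (map_prod (snd c) id) (inv_into (fst c \<times> UNIV) (map_prod (snd c) (id :: real \<Rightarrow> real)))"
    if c: "c \<in> A" for c
  proof
    show "open (fst c \<times> (UNIV :: real set))" using chart_open[OF A c] by (intro open_Times) auto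
    have "continuous_on (fst c \<times> UNIV) (\<lambda>x. (snd c (fst x), snd x :: real))"
      by (intro continuous_intros continuous_on_compose2[OF chart_continuous[OF A c]]) auto
    moreover have "map_prod (snd c) (id :: real \<Rightarrow> real) = (\<lambda>x. (snd c (fst x), snd x))" by auto
    ultimately have 1: "continuous_on (fst c \<times> UNIV) (map_prod (snd c) (id :: real \<Rightarrow> real))" by simp
    have "continuous_on (snd c ` fst c \<times> UNIV) (\<lambda>y. (chart_inv c (fst y), snd y :: real))"
      by (intro continuous_intros continuous_on_compose2[OF chart_inv_continuous[OF A c]]) auto
    then have 2: "continuous_on (snd c ` fst c \<times> UNIV)
        (inv_into (fst c \<times> UNIV) (map_prod (snd c) (id :: real \<Rightarrow> real)))"
      by (rule continuous_on_eq) (auto simp: cylinder_chart_inv[OF inj[OF c]])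
    show "homeomorphism (fst c \<times> UNIV) (map_prod (snd c) id ` (fst c \<times> UNIV))
      (map_prod (snd c) id) (inv_into (fst c \<times> UNIV) (map_prod (snd c) (id :: real \<Rightarrow> real)))"
      unfolding im
    proof (rule homeomorphismI[OF 1 2])
    qed (auto simp: cylinder_chart_inv[OF inj[OF c]] chart_inv_chart[OF A c] intro: inv_into_into)
  qed
  moreover have "(\<Union>c\<in>A. fst c \<times> (UNIV :: real set)) = UNIV"
    using chart_cover[OF A] by fast
  moreover have "smooth_on (map_prod (snd c) id ` (fst c \<times> UNIV \<inter> fst d \<times> UNIV))
      (local_rep (fst c \<times> UNIV, map_prod (snd c) id) (fst d \<times> (UNIV :: real set), map_prod (snd d) id) id)"
    if c: "c \<in> A" and d: "d \<in> A" for c d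
  proof -
    let ?T = "snd c ` (fst c \<inter> fst d)"
    have "smooth_on (?T \<times> UNIV) (\<lambda>x :: 'e \<times> real. (local_rep c d id (fst x), snd x))"
      by (rule smooth_on_Pair[OF smooth_on_compose[OF smooth_on_fst chart_transition[OF A c d]] smooth_on_snd]) auto
    then have "smooth_on (?T \<times> UNIV)
      (local_rep (fst c \<times> UNIV, map_prod (snd c) id) (fst d \<times> (UNIV :: real set), map_prod (snd d) id) id)"
      by (rule smooth_on_cong) (auto simp: local_rep_def cylinder_chart_inv[OF inj[OF c]])
    moreover have "fst c \<times> (UNIV :: real set) \<inter> fst d \<times> UNIV = (fst c \<inter> fst d) \<times> UNIV" by auto
    ultimately show ?thesis by (simp only: im)
  qed
  ultimately show ?thesis
    by (simp only: chart_system_def cylinder_atlas_def ball_simps image_image fst_conv snd_conv) blast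
qed

section \<open>Integral curves\<close>

text \<open>Solutions of the non-autonomous equation \<open>\<gamma>' = \<beta>(t) X(\<gamma>)\<close>.  An integral curve of \<open>\<alpha> F\<close> is
  such a curve for \<open>F\<close>, which is how integral curves of \<open>G\<close> are compared with those of \<open>F\<close>.\<close>

definition weighted_curve ::
  "('m::topological_space, 'e::euclidean_space) chart set \<Rightarrow> ('m, 'e) vector_field \<Rightarrow>
   (real \<Rightarrow> real) \<Rightarrow> real set \<Rightarrow> (real \<Rightarrow> 'm) \<Rightarrow> bool" where
  "weighted_curve A X \<beta> J \<gamma> \<longleftrightarrow> is_interval J \<and> continuous_on J \<gamma> \<and>
     (\<forall>t\<in>J. \<forall>c\<in>A. \<gamma> t \<in> fst c \<longrightarrow>
        ((snd c \<circ> \<gamma>) has_vector_derivative \<beta> t *\<^sub>R X (\<gamma> t) c) (at t within J))"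

lemma integral_curve_weighted: "integral_curve A X J \<gamma> \<longleftrightarrow> weighted_curve A X (\<lambda>t. 1) J \<gamma>"
  by (simp add: integral_curve_def weighted_curve_def)

lemma weighted_curve_subset:
  "weighted_curve A X \<beta> J \<gamma> \<Longrightarrow> is_interval J' \<Longrightarrow> J' \<subseteq> J \<Longrightarrow> weighted_curve A X \<beta> J' \<gamma>"
  unfolding weighted_curve_def
  by (meson continuous_on_subset has_vector_derivative_within_subset subsetD)

lemma tangent_space_change:
  "v \<in> tangent_space A x \<Longrightarrow> c \<in> A \<Longrightarrow> d \<in> A \<Longrightarrow> x \<in> fst c \<Longrightarrow> x \<in> fst d \<Longrightarrow>
    v d = frechet_derivative (local_rep c d id) (at (snd c x) within snd c ` (fst c \<inter> fst d)) (v c)"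
  unfolding tangent_space_def by blast

text \<open>The other coordinate vectors are images of \<open>v c\<close> under derivatives of
  coordinate changes, which are linear; one chart therefore decides.\<close>

lemma tangent_space_chart_zero:
  assumes "v \<in> tangent_space A x" "c \<in> A" "x \<in> fst c" "v c = 0" "chart_system A"
  shows "v = (\<lambda>d. 0)"
proof
  fix d
  show "v d = 0"
  proof (cases "d \<in> A \<and> x \<in> fst d")
    case True
    let ?D = "frechet_derivative (local_rep c d id) (at (snd c x) within snd c ` (fst c \<inter> fst d))"
    have "v d = ?D (v c)" using assms True unfolding tangent_space_def by blast
    moreover have "local_rep c d id differentiable (at (snd c x) within snd c ` (fst c \<inter> fst d))"
      using smooth_on_imp_differentiable[OF chart_transition[OF assms(5)]] assms True by auto
    then have "linear ?D" using frechet_derivative_works has_derivative_linear by blast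
    ultimately show ?thesis using assms(4) linear_0 by metis
  next
    case False
    then show ?thesis using assms(1) unfolding tangent_space_def by blast
  qed
qed

lemma tangent_space_chart_scale:
  assumes "v \<in> tangent_space A x" "w \<in> tangent_space A x" "c \<in> A" "x \<in> fst c" "v c = a *\<^sub>R w c"
    "chart_system A"
  shows "v = (\<lambda>d. a *\<^sub>R w d)"
proof
  fix d
  show "v d = a *\<^sub>R w d"
  proof (cases "d \<in> A \<and> x \<in> fst d")
    case True
    let ?D = "frechet_derivative (local_rep c d id) (at (snd c x) within snd c ` (fst c \<inter> fst d))"
    have "v d = ?D (v c)" "w d = ?D (w c)" using assms True unfolding tangent_space_def by blast+
    moreover have "local_rep c d id differentiable (at (snd c x) within snd c ` (fst c \<inter> fst d))"
      using smooth_on_imp_differentiable[OF chart_transition[OF assms(6)]] assms True by auto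
    then have "linear ?D" using frechet_derivative_works has_derivative_linear by blast
    ultimately show ?thesis using assms(5) linear_scale by metis
  next
    case False
    then have "v d = 0" "w d = 0" using assms(1,2) unfolding tangent_space_def by blast+
    then show ?thesis by simp
  qed
qed

text \<open>The chain rule, after shrinking \<open>J\<close> to the times at which the curve lies in
  both charts; these form a relatively open set, so \<open>at t within J\<close> is
  unchanged.\<close>

lemma velocity_chart_change:
  assumes A: "chart_system A" and v: "v \<in> tangent_space A (\<gamma> t)" and c: "c \<in> A" and d: "d \<in> A"
    and mem: "\<gamma> t \<in> fst c" "\<gamma> t \<in> fst d" and \<gamma>: "continuous_on J \<gamma>" and t: "t \<in> J"
    and der: "((snd c \<circ> \<gamma>) has_vector_derivative a *\<^sub>R v c) (at t within J)"
  shows "((snd d \<circ> \<gamma>) has_vector_derivative a *\<^sub>R v d) (at t within J)"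
proof -
  let ?T = "snd c ` (fst c \<inter> fst d)" and ?L = "local_rep c d id"
  let ?D = "frechet_derivative ?L (at (snd c (\<gamma> t)) within ?T)"
  have "openin (top_of_set J) (J \<inter> \<gamma> -` (fst c \<inter> fst d))"
    using \<gamma> chart_open[OF A c] chart_open[OF A d] by (intro continuous_openin_preimage_gen) auto
  then obtain N where N: "open N" "J \<inter> \<gamma> -` (fst c \<inter> fst d) = J \<inter> N" unfolding openin_open by auto
  let ?J = "J \<inter> N"
  have J: "\<gamma> s \<in> fst c \<inter> fst d" if "s \<in> ?J" for s using N(2) that by auto
  have tN: "t \<in> N" using N(2) t mem by auto
  have at: "at t within J = at t within ?J"
    by (rule at_within_nhd[OF tN N(1)]) auto
  have "?L differentiable (at (snd c (\<gamma> t)) within ?T)"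
    using smooth_on_imp_differentiable[OF chart_transition[OF A c d]] mem by auto
  then have D: "(?L has_derivative ?D) (at (snd c (\<gamma> t)) within ?T)"
    using frechet_derivative_works by blast
  have "((snd c \<circ> \<gamma>) has_vector_derivative a *\<^sub>R v c) (at t within ?J)" using der at by simp
  moreover have "(?L has_derivative ?D) (at ((snd c \<circ> \<gamma>) t) within (snd c \<circ> \<gamma>) ` ?J)"
    unfolding o_apply by (rule has_derivative_subset[OF D]) (use J in force)
  ultimately have d1: "(?L \<circ> (snd c \<circ> \<gamma>) has_vector_derivative ?D (a *\<^sub>R v c)) (at t within ?J)"
    by (rule vector_derivative_diff_chain_within)
  have eq: "(snd d \<circ> \<gamma>) s = (?L \<circ> (snd c \<circ> \<gamma>)) s" if "s \<in> ?J" for s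
    using J[OF that] chart_inv_chart[OF A c] by (simp add: local_rep_def)
  have "t \<in> ?J" using t tN by simp
  from has_vector_derivative_transform[OF this eq d1]
  have "(snd d \<circ> \<gamma> has_vector_derivative ?D (a *\<^sub>R v c)) (at t within ?J)" .
  moreover have "?D (a *\<^sub>R v c) = a *\<^sub>R ?D (v c)"
    using has_derivative_linear[OF D] by (rule linear_scale)
  moreover have "?D (v c) = v d"
    using tangent_space_change[OF v c d mem] by simp
  ultimately show ?thesis using at by simp
qed

lemma weighted_curveI:
  assumes A: "chart_system A" and X: "\<And>x. X x \<in> tangent_space A x"
    and "is_interval J" and \<gamma>: "continuous_on J \<gamma>"
    and der: "\<And>t. t \<in> J \<Longrightarrow> \<exists>c\<in>A. \<gamma> t \<in> fst c \<and>
      ((snd c \<circ> \<gamma>) has_vector_derivative \<beta> t *\<^sub>R X (\<gamma> t) c) (at t within J)"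
  shows "weighted_curve A X \<beta> J \<gamma>"
  unfolding weighted_curve_def
proof (intro conjI ballI impI assms(3) \<gamma>)
  fix t d assume t: "t \<in> J" and d: "d \<in> A" "\<gamma> t \<in> fst d"
  obtain c where "c \<in> A" "\<gamma> t \<in> fst c"
    "((snd c \<circ> \<gamma>) has_vector_derivative \<beta> t *\<^sub>R X (\<gamma> t) c) (at t within J)"
    using der[OF t] by auto
  then show "((snd d \<circ> \<gamma>) has_vector_derivative \<beta> t *\<^sub>R X (\<gamma> t) d) (at t within J)"
    using velocity_chart_change[OF A X _ d(1) _ d(2) \<gamma> t] by blast
qed

lemma weighted_curve_of_chart:
  assumes A: "chart_system A" and X: "\<And>x. X x \<in> tangent_space A x" and c: "c \<in> A"
    and J: "is_interval J" and im: "\<And>t. t \<in> J \<Longrightarrow> z t \<in> snd c ` fst c"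
    and der: "\<And>t. t \<in> J \<Longrightarrow> (z has_vector_derivative \<beta> t *\<^sub>R X (chart_inv c (z t)) c) (at t within J)"
  shows "weighted_curve A X \<beta> J (chart_inv c \<circ> z)"
proof (rule weighted_curveI[OF A X J])
  have "continuous_on J z" using der by (rule continuous_on_vector_derivative)
  then show "continuous_on J (chart_inv c \<circ> z)"
    unfolding o_def by (rule continuous_on_compose2[OF chart_inv_continuous[OF A c]]) (use im in auto)
  fix t assume t: "t \<in> J"
  have "((snd c \<circ> (chart_inv c \<circ> z)) has_vector_derivative \<beta> t *\<^sub>R X ((chart_inv c \<circ> z) t) c) (at t within J)"
    unfolding o_apply
    by (rule has_vector_derivative_transform[OF t _ der[OF t]]) (simp add: chart_chart_inv im)
  moreover have "(chart_inv c \<circ> z) t \<in> fst c" using im[OF t] by (simp add: chart_inv_mem)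
  ultimately show "\<exists>c'\<in>A. (chart_inv c \<circ> z) t \<in> fst c' \<and>
      ((snd c' \<circ> (chart_inv c \<circ> z)) has_vector_derivative \<beta> t *\<^sub>R X ((chart_inv c \<circ> z) t) c') (at t within J)"
    using c by blast
qed

lemma smooth_vector_field_tangent: "smooth_vector_field A X \<Longrightarrow> X x \<in> tangent_space A x"
  unfolding smooth_vector_field_def by blast

lemma smooth_vector_field_chart:
  "smooth_vector_field A X \<Longrightarrow> c \<in> A \<Longrightarrow> smooth_on (snd c ` fst c) (\<lambda>y. X (chart_inv c y) c)"
  unfolding smooth_vector_field_def by blast

text \<open>The coincidence set is clopen in \<open>J\<close>. Its complement is open by the
  Hausdorff property; the set itself is open by Gronwall's inequality in a chart, where a cut-off
  makes the field globally Lipschitz and \<open>\<beta>\<close> is bounded near the given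
  time.\<close>

theorem weighted_curve_unique:
  fixes A :: "('m::t2_space, 'e::euclidean_space) chart set"
  assumes A: "chart_system A" and X: "smooth_vector_field A X"
    and \<gamma>: "weighted_curve A X \<beta> J \<gamma>" and \<delta>: "weighted_curve A X \<beta> J \<delta>" and \<beta>: "continuous_on J \<beta>"
    and t0: "t0 \<in> J" "\<gamma> t0 = \<delta> t0" and "t \<in> J"
  shows "\<gamma> t = \<delta> t"
proof -
  have J: "is_interval J" and c\<gamma>: "continuous_on J \<gamma>" and c\<delta>: "continuous_on J \<delta>"
    using \<gamma> \<delta> by (auto simp: weighted_curve_def)
  define E where "E = {s \<in> J. \<gamma> s = \<delta> s}"
  have near: "\<exists>e>0. \<forall>s\<in>J. dist s t < e \<longrightarrow> \<gamma> s \<in> U \<and> \<delta> s \<in> V"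
    if "t \<in> J" "open U" "open V" "\<gamma> t \<in> U" "\<delta> t \<in> V" for t U V
  proof -
    have "openin (top_of_set J) (J \<inter> \<gamma> -` U \<inter> (J \<inter> \<delta> -` V))"
      using that c\<gamma> c\<delta> by (intro openin_Int continuous_openin_preimage_gen)
    moreover have "t \<in> J \<inter> \<gamma> -` U \<inter> (J \<inter> \<delta> -` V)" using that by auto
    ultimately obtain e where "e > 0" "\<forall>s\<in>J. dist s t < e \<longrightarrow> s \<in> J \<inter> \<gamma> -` U \<inter> (J \<inter> \<delta> -` V)"
      unfolding openin_euclidean_subtopology_iff by blast
    then show ?thesis by blast
  qed
  have "openin (top_of_set J) (J - E)"
    unfolding openin_euclidean_subtopology_iff
  proof (intro conjI ballI)
    fix t assume t: "t \<in> J - E"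
    then obtain U V where "open U" "open V" "\<gamma> t \<in> U" "\<delta> t \<in> V" "U \<inter> V = {}"
      using hausdorff[of "\<gamma> t" "\<delta> t"] by (auto simp: E_def)
    then show "\<exists>e>0. \<forall>s\<in>J. dist s t < e \<longrightarrow> s \<in> J - E"
      using near[of t U V] t unfolding E_def by fastforce
  qed auto
  moreover have "openin (top_of_set J) E"
    unfolding openin_euclidean_subtopology_iff
  proof (intro conjI ballI)
    fix t assume "t \<in> E"
    then have t: "t \<in> J" "\<gamma> t = \<delta> t" by (auto simp: E_def)
    obtain c where c: "c \<in> A" "\<gamma> t \<in> fst c" using chart_cover[OF A] by blast
    let ?f = "\<lambda>y. X (chart_inv c y) c"
    have "snd c (\<gamma> t) \<in> snd c ` fst c" using c by auto
    from smooth_on_cutoff[OF smooth_vector_field_chart[OF X c(1)] this zero_less_one]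
    obtain r Y h where co: "cutoff (snd c ` fst c) ?f (snd c (\<gamma> t)) r Y h" by blast
    then have r: "r > 0" and h: "\<And>y. y \<in> cball (snd c (\<gamma> t)) (r / 2) \<Longrightarrow> h y = 1"
      and Yf: "\<And>y. y \<in> snd c ` fst c \<Longrightarrow> Y y = h y *\<^sub>R ?f y"
      unfolding cutoff_def by blast+
    obtain L where L: "L \<ge> 0" "\<And>x y. norm (Y x - Y y) \<le> L * norm (x - y)"
      using cutoff_lipschitz[OF co] by blast
    obtain U where U: "open U" "fst c \<inter> snd c -` ball (snd c (\<gamma> t)) (r / 2) = fst c \<inter> U"
      using continuous_openin_preimage_gen[OF chart_continuous[OF A c(1)], of "ball (snd c (\<gamma> t)) (r / 2)"]
      unfolding openin_open by auto
    have U': "\<gamma> t \<in> U" using U(2) c r by auto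
    have "open (U \<inter> fst c)" using U chart_open[OF A c(1)] by auto
    then have "\<exists>e>0. \<forall>s\<in>J. dist s t < e \<longrightarrow> \<gamma> s \<in> U \<inter> fst c \<and> \<delta> s \<in> U \<inter> fst c"
      using t c U' by (intro near) auto
    then obtain e1 where e1: "e1 > 0" "\<And>s. s \<in> J \<Longrightarrow> dist s t < e1 \<Longrightarrow> \<gamma> s \<in> U \<inter> fst c \<and> \<delta> s \<in> U \<inter> fst c"
      by auto
    have "\<exists>d>0. \<forall>s\<in>J. dist s t < d \<longrightarrow> dist (\<beta> s) (\<beta> t) < 1"
      using \<beta> t(1) unfolding continuous_on_iff by simp
    then obtain e2 where e2: "e2 > 0" "\<And>s. s \<in> J \<Longrightarrow> dist s t < e2 \<Longrightarrow> dist (\<beta> s) (\<beta> t) < 1"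
      by auto
    define e where "e = min e1 e2"
    define J' where "J' = J \<inter> {t-e<..<t+e}"
    have J': "is_interval J'" unfolding J'_def by (intro is_interval_Int J is_interval_oo)
    have "e > 0" using e1 e2 by (simp add: e_def)
    then have tJ': "t \<in> J'" using t by (simp add: J'_def)
    have mem: "\<gamma> s \<in> fst c" "\<delta> s \<in> fst c" "snd c (\<gamma> s) \<in> cball (snd c (\<gamma> t)) (r / 2)"
      "snd c (\<delta> s) \<in> cball (snd c (\<gamma> t)) (r / 2)" "\<bar>\<beta> s\<bar> \<le> \<bar>\<beta> t\<bar> + 1" if "s \<in> J'" for s
    proof -
      have s: "s \<in> J" "dist s t < e1" "dist s t < e2" using that by (auto simp: J'_def e_def dist_real_def)
      show "\<gamma> s \<in> fst c" "\<delta> s \<in> fst c" using e1(2)[OF s(1,2)] by auto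
      have "\<gamma> s \<in> fst c \<inter> U" "\<delta> s \<in> fst c \<inter> U" using e1(2)[OF s(1,2)] by auto
      then show "snd c (\<gamma> s) \<in> cball (snd c (\<gamma> t)) (r / 2)" "snd c (\<delta> s) \<in> cball (snd c (\<gamma> t)) (r / 2)"
        unfolding U(2)[symmetric] by auto
      show "\<bar>\<beta> s\<bar> \<le> \<bar>\<beta> t\<bar> + 1" using e2(2)[OF s(1,3)] by (auto simp: dist_real_def)
    qed
    have der: "((snd c \<circ> \<eta>) has_vector_derivative \<beta> s *\<^sub>R Y (snd c (\<eta> s))) (at s within J')"
      if "weighted_curve A X \<beta> J \<eta>" "s \<in> J'" "\<eta> s \<in> fst c" "snd c (\<eta> s) \<in> cball (snd c (\<gamma> t)) (r / 2)" for \<eta> s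
    proof -
      have "((snd c \<circ> \<eta>) has_vector_derivative \<beta> s *\<^sub>R X (\<eta> s) c) (at s within J)"
        using that c unfolding weighted_curve_def J'_def by blast
      then have "((snd c \<circ> \<eta>) has_vector_derivative \<beta> s *\<^sub>R X (\<eta> s) c) (at s within J')"
        by (rule has_vector_derivative_within_subset) (auto simp: J'_def)
      moreover have "Y (snd c (\<eta> s)) = X (\<eta> s) c"
        using Yf[of "snd c (\<eta> s)"] that h chart_inv_chart[OF A c(1)] by simp
      ultimately show ?thesis by simp
    qed
    define u where "u s = snd c (\<gamma> s) - snd c (\<delta> s)" for s
    have "\<gamma> s = \<delta> s" if s: "s \<in> J'" for s
    proof -
      have "(norm (u s))\<^sup>2 \<le> exp ((2 * ((\<bar>\<beta> t\<bar> + 1) * L) + 1) * \<bar>s - t\<bar>) * ((norm (u t))\<^sup>2 + 0\<^sup>2 * \<bar>s - t\<bar>)"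
      proof (rule gronwall[OF J' tJ' s])
        fix \<tau> assume \<tau>: "\<tau> \<in> J'"
        show "(u has_vector_derivative \<beta> \<tau> *\<^sub>R Y (snd c (\<gamma> \<tau>)) - \<beta> \<tau> *\<^sub>R Y (snd c (\<delta> \<tau>))) (at \<tau> within J')"
          using has_vector_derivative_diff[OF der[OF \<gamma> \<tau> mem(1,3)[OF \<tau>]] der[OF \<delta> \<tau> mem(2,4)[OF \<tau>]]]
          by (simp add: u_def[abs_def])
        have "norm (\<beta> \<tau> *\<^sub>R Y (snd c (\<gamma> \<tau>)) - \<beta> \<tau> *\<^sub>R Y (snd c (\<delta> \<tau>)))
            = \<bar>\<beta> \<tau>\<bar> * norm (Y (snd c (\<gamma> \<tau>)) - Y (snd c (\<delta> \<tau>)))"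
          by (simp flip: scaleR_diff_right)
        also have "\<dots> \<le> (\<bar>\<beta> t\<bar> + 1) * (L * norm (u \<tau>))"
          unfolding u_def by (intro mult_mono L mem \<tau>) auto
        finally show "norm (\<beta> \<tau> *\<^sub>R Y (snd c (\<gamma> \<tau>)) - \<beta> \<tau> *\<^sub>R Y (snd c (\<delta> \<tau>)))
            \<le> (\<bar>\<beta> t\<bar> + 1) * L * norm (u \<tau>) + 0" by (simp add: mult.assoc)
      qed (use L(1) in auto)
      then have "u s = 0" using t(2) by (simp add: u_def)
      then show ?thesis using chart_inj[OF A c(1) mem(1,2)[OF s]] by (simp add: u_def)
    qed
    then show "\<exists>e>0. \<forall>s\<in>J. dist s t < e \<longrightarrow> s \<in> E"
      using \<open>e > 0\<close> by (intro exI[of _ e]) (auto simp: J'_def E_def dist_real_def abs_diff_less_iff)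
  qed (auto simp: E_def)
  ultimately have "closedin (top_of_set J) E" "openin (top_of_set J) E"
    by (auto simp: closedin_def E_def)
  moreover have "connected J" using J by (simp add: is_interval_connected)
  ultimately have "E = {} \<or> E = J" unfolding connected_clopen by blast
  then show ?thesis using t0 \<open>t \<in> J\<close> by (auto simp: E_def)
qed

section \<open>Existence of integral curves\<close>

lemma
  assumes "cutoff S f p r X h"
  shows cutoff_pos: "r > 0" and cutoff_Ck: "Ck_on k UNIV X"
    and cutoff_outside: "y \<notin> ball p r \<Longrightarrow> X y = 0" "y \<notin> ball p r \<Longrightarrow> h y = 0"
    and cutoff_eq: "y \<in> S \<Longrightarrow> X y = h y *\<^sub>R f y"
    and cutoff_inner: "y \<in> S \<Longrightarrow> y \<in> cball p (r / 2) \<Longrightarrow> X y = f y"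
  using assms unfolding cutoff_def by (blast, blast, blast, blast, blast, simp)

section \<open>Global flows of cut-off fields\<close>

definition is_flow :: "('e::euclidean_space \<Rightarrow> 'e) \<Rightarrow> (real \<times> 'e \<Rightarrow> 'e) \<Rightarrow> bool" where
  "is_flow X \<Phi> \<longleftrightarrow> (\<forall>k. Ck_on k UNIV \<Phi>) \<and> (\<forall>p. \<Phi> (0, p) = p) \<and>
    (\<forall>t p. ((\<lambda>s. \<Phi> (s, p)) has_vector_derivative X (\<Phi> (t, p))) (at t))"

lemma is_flow_Ck: "is_flow X \<Phi> \<Longrightarrow> Ck_on k UNIV \<Phi>"
  and is_flow_zero: "is_flow X \<Phi> \<Longrightarrow> \<Phi> (0, p) = p"
  and is_flow_derivative: "is_flow X \<Phi> \<Longrightarrow> ((\<lambda>s. \<Phi> (s, p)) has_vector_derivative X (\<Phi> (t, p))) (at t)"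
  unfolding is_flow_def by blast+

lemma is_flow_continuous: "is_flow X \<Phi> \<Longrightarrow> continuous_on UNIV \<Phi>"
  using is_flow_Ck Ck_on_imp_continuous_on by blast

lemma is_flow_exists:
  fixes f :: "'e::euclidean_space \<Rightarrow> 'e"
  assumes "cutoff S f p r X h"
  shows "\<exists>\<Phi>. is_flow X \<Phi>"
proof -
  have X: "Ck_on k UNIV X" for k using assms unfolding cutoff_def by blast
  have "X y = 0" if "y \<notin> cball p r" for y using assms that unfolding cutoff_def by auto
  from smooth_global_flow[OF X compact_cball this] show ?thesis unfolding is_flow_def by metis
qed

lemma lipschitz_ode_unique:
  fixes X :: "'e::euclidean_space \<Rightarrow> 'e"
  assumes "L \<ge> 0" "\<And>x y. norm (X x - X y) \<le> L * norm (x - y)"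
    and "\<And>t. (y has_vector_derivative X (y t)) (at t)" "\<And>t. (z has_vector_derivative X (z t)) (at t)"
    and "y 0 = z 0"
  shows "y t = z t"
proof -
  have "(norm (y t - z t))\<^sup>2 \<le> exp ((2 * L + 1) * \<bar>t - 0\<bar>) * ((norm (y 0 - z 0))\<^sup>2 + 0\<^sup>2 * \<bar>t - 0\<bar>)"
    by (rule gronwall[OF is_interval_univ _ _ assms(1) _
          has_vector_derivative_at_within[OF has_vector_derivative_diff[OF assms(3,4)]]])
      (use assms(2) in auto)
  then show ?thesis using assms(5) by simp
qed

lemma is_flow_add:
  assumes "L \<ge> 0" "\<And>x y. norm (X x - X y) \<le> L * norm (x - y)" and \<Phi>: "is_flow X \<Phi>"
  shows "\<Phi> (s, \<Phi> (t, p)) = \<Phi> (s + t, p)"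
proof (rule lipschitz_ode_unique[OF assms(1,2), of "\<lambda>s. \<Phi> (s, \<Phi> (t, p))" "\<lambda>s. \<Phi> (s + t, p)" s])
  show "((\<lambda>s. \<Phi> (s + t, p)) has_vector_derivative X (\<Phi> (s + t, p))) (at s)" for s
  proof -
    have "((\<lambda>s. s + t) has_vector_derivative 1) (at s)" by (auto intro!: derivative_eq_intros)
    from vector_diff_chain_at[OF this is_flow_derivative[OF \<Phi>, of p "s + t"]]
    show ?thesis by (simp add: o_def)
  qed
qed (use is_flow_derivative[OF \<Phi>] is_flow_zero[OF \<Phi>] in auto)

lemma is_flow_fixed:
  assumes "L \<ge> 0" "\<And>x y. norm (X x - X y) \<le> L * norm (x - y)" and \<Phi>: "is_flow X \<Phi>" and "X p = 0"
  shows "\<Phi> (t, p) = p"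
  by (rule lipschitz_ode_unique[OF assms(1,2), of "\<lambda>s. \<Phi> (s, p)" "\<lambda>s. p" t])
    (use is_flow_derivative[OF \<Phi>] is_flow_zero[OF \<Phi>] assms(4) in auto)

lemma is_flow_near:
  assumes "is_flow X \<Phi>" "r > 0"
  shows "\<exists>\<epsilon>>0. \<forall>t. \<bar>t\<bar> < \<epsilon> \<longrightarrow> \<Phi> (t, p) \<in> ball p r"
proof -
  have "continuous_on UNIV (\<lambda>t. \<Phi> (t, p))"
    by (rule continuous_on_compose2[OF is_flow_continuous[OF assms(1)]]) (auto intro!: continuous_intros)
  then have "\<exists>\<epsilon>>0. \<forall>t\<in>UNIV. dist t 0 < \<epsilon> \<longrightarrow> dist (\<Phi> (t, p)) (\<Phi> (0, p)) < r"
    using assms(2) unfolding continuous_on_iff by blast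
  then show ?thesis using is_flow_zero[OF assms(1)] by (simp add: dist_commute)
qed

text \<open>Only charts in which the point itself lies on the boundary hyperplane are tested. This
  is the form that local arguments use, and it avoids the chart invariance of the boundary.\<close>

definition chart_tangent ::
  "'e::euclidean_space \<Rightarrow> ('m, 'e) chart set \<Rightarrow> ('m, 'e) vector_field \<Rightarrow> bool" where
  "chart_tangent b A X \<longleftrightarrow> (\<forall>c\<in>A. \<forall>x\<in>fst c. snd c x \<bullet> b = 0 \<longrightarrow> X x c \<bullet> b = 0)"

lemma tangent_to_boundary_chart: "tangent_to_boundary b A X \<Longrightarrow> chart_tangent b A X"
  unfolding tangent_to_boundary_def chart_tangent_def manifold_boundary_def by blast

lemma openin_half_space_ball:
  assumes "openin (top_of_set (half_space b)) S" "p \<in> S"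
  shows "\<exists>\<epsilon>>0. ball p \<epsilon> \<inter> half_space b \<subseteq> S"
proof -
  obtain U where U: "open U" "S = half_space b \<inter> U" using assms(1) unfolding openin_open by auto
  then obtain \<epsilon> where "\<epsilon> > 0" "ball p \<epsilon> \<subseteq> U" using assms(2) openE by blast
  then show ?thesis using U by blast
qed

lemma chart_image_half_space:
  assumes "smooth_manifold b A" "c \<in> A"
  shows "openin (top_of_set (half_space b)) (snd c ` fst c)" "snd c ` fst c \<subseteq> half_space b"
  using assms openin_imp_subset unfolding smooth_manifold_def is_chart_def by blast+

text \<open>Points of the hyperplane inside the ball belong to \<open>S\<close>, where
  \<open>X\<close> is a multiple of \<open>f\<close>; at all other points of the hyperplane
  \<open>X\<close> vanishes.\<close>

lemma cutoff_tangent: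
  assumes "cutoff S f p r X h" "ball p r \<inter> half_space b \<subseteq> S" "\<And>y. y \<in> S \<Longrightarrow> y \<bullet> b = 0 \<Longrightarrow> f y \<bullet> b = 0"
    and "y \<bullet> b = 0"
  shows "X y \<bullet> b = 0"
proof (cases "y \<in> ball p r")
  case True
  then have "y \<in> S" using assms(2,4) by (auto simp: half_space_def)
  then show ?thesis using assms unfolding cutoff_def by simp
next
  case False
  then show ?thesis using assms unfolding cutoff_def by simp
qed

lemma cutoff_flow_half_space:
  fixes f :: "'e::euclidean_space \<Rightarrow> 'e"
  assumes co: "cutoff S f p r X h" "ball p r \<inter> half_space b \<subseteq> S"
    and "\<And>y. y \<in> S \<Longrightarrow> y \<bullet> b = 0 \<Longrightarrow> f y \<bullet> b = 0"
    and \<Phi>: "is_flow X \<Phi>" and b: "b \<in> Basis" and q: "q \<in> half_space b"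
  shows "\<Phi> (t, q) \<in> half_space b"
proof -
  obtain L where L: "L \<ge> 0" "\<And>x y. norm (X x - X y) \<le> L * norm (x - y)"
    using cutoff_lipschitz[OF co(1)] by blast
  have "X y \<bullet> b = 0" if "y \<bullet> b = 0" for y
    by (rule cutoff_tangent[OF co]) (use assms(3) that in auto)
  from flow_preserves_half_space[OF L(2,1) is_flow_derivative[OF \<Phi>] b this, of q t]
  show ?thesis using q is_flow_zero[OF \<Phi>] by simp
qed

lemma cutoff_integral_curve:
  assumes A: "chart_system A" and X: "smooth_vector_field A X" and c: "c \<in> A"
    and co: "cutoff (snd c ` fst c) (\<lambda>y. X (chart_inv c y) c) p r Y h" and \<Phi>: "is_flow Y \<Phi>"
    and J: "is_interval J" "\<And>t. t \<in> J \<Longrightarrow> \<Phi> (t, p) \<in> snd c ` fst c \<inter> cball p (r / 2)"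
  shows "integral_curve A X J (\<lambda>t. chart_inv c (\<Phi> (t, p)))"
proof -
  have "weighted_curve A X (\<lambda>t. 1) J (chart_inv c \<circ> (\<lambda>t. \<Phi> (t, p)))"
  proof (rule weighted_curve_of_chart[OF A smooth_vector_field_tangent[OF X] c J(1)])
    fix t assume t: "t \<in> J"
    show "\<Phi> (t, p) \<in> snd c ` fst c" using J(2)[OF t] by blast
    have "Y (\<Phi> (t, p)) = X (chart_inv c (\<Phi> (t, p))) c"
      using J(2)[OF t] cutoff_inner[OF co] by blast
    then show "((\<lambda>t. \<Phi> (t, p)) has_vector_derivative 1 *\<^sub>R X (chart_inv c (\<Phi> (t, p))) c) (at t within J)"
      using has_vector_derivative_at_within[OF is_flow_derivative[OF \<Phi>, of p t]] by simp
  qed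
  then show ?thesis by (simp add: integral_curve_weighted o_def)
qed

text \<open>The extended field is integrated in the whole Euclidean space. Tangency keeps the
  solution in the half-space, and a short piece of it stays in the ball of radius
  \<open>r / 2\<close>, where the extension coincides with \<open>X\<close>.\<close>

lemma local_integral_curve:
  assumes M: "smooth_manifold b A" and X: "smooth_vector_field A X" and tan: "chart_tangent b A X"
  shows "\<exists>\<epsilon>>0. \<exists>\<gamma>. integral_curve A X {-\<epsilon><..<\<epsilon>} \<gamma> \<and> \<gamma> 0 = x"
proof -
  note A = smooth_manifold_chart_system[OF M]
  have b: "b \<in> Basis" using M by (simp add: smooth_manifold_def)
  obtain c where c: "c \<in> A" "x \<in> fst c" using chart_cover[OF A] by blast
  let ?S = "snd c ` fst c" and ?p = "snd c x"
  have p: "?p \<in> ?S" using c by blast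
  obtain \<epsilon>0 where \<epsilon>0: "\<epsilon>0 > 0" "ball ?p \<epsilon>0 \<inter> half_space b \<subseteq> ?S"
    using openin_half_space_ball[OF chart_image_half_space(1)[OF M c(1)] p] by blast
  obtain r Y h where r: "r \<le> \<epsilon>0" and co: "cutoff ?S (\<lambda>y. X (chart_inv c y) c) ?p r Y h"
    using smooth_on_cutoff[OF smooth_vector_field_chart[OF X c(1)] p \<epsilon>0(1)] by blast
  have "r > 0" using co unfolding cutoff_def by blast
  have sub: "ball ?p r \<inter> half_space b \<subseteq> ?S" using r \<epsilon>0(2) by auto
  obtain \<Phi> where \<Phi>: "is_flow Y \<Phi>" using is_flow_exists[OF co] by blast
  obtain \<epsilon> where \<epsilon>: "\<epsilon> > 0" "\<And>t. \<bar>t\<bar> < \<epsilon> \<Longrightarrow> \<Phi> (t, ?p) \<in> ball ?p (r / 2)"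
    using is_flow_near[OF \<Phi>, of "r / 2" ?p] \<open>r > 0\<close> by auto
  have "\<Phi> (t, ?p) \<in> half_space b" for t
  proof (rule cutoff_flow_half_space[OF co sub _ \<Phi> b])
    show "?p \<in> half_space b" using chart_image_half_space(2)[OF M c(1)] p by blast
    fix y assume "y \<in> ?S" "y \<bullet> b = 0"
    then show "X (chart_inv c y) c \<bullet> b = 0"
      using tan c(1) chart_inv_mem[of y c] chart_chart_inv[of y c] unfolding chart_tangent_def by metis
  qed
  then have "\<Phi> (t, ?p) \<in> ?S \<inter> cball ?p (r / 2)" if "t \<in> {-\<epsilon><..<\<epsilon>}" for t
    using \<epsilon>(2)[of t] sub that \<open>r > 0\<close> by (auto simp: abs_less_iff)
  then have "integral_curve A X {-\<epsilon><..<\<epsilon>} (\<lambda>t. chart_inv c (\<Phi> (t, ?p)))"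
    by (intro cutoff_integral_curve[OF A X c(1) co \<Phi>] is_interval_oo)
  moreover have "chart_inv c (\<Phi> (0, ?p)) = x" using is_flow_zero[OF \<Phi>] chart_inv_chart[OF A c] by simp
  ultimately show ?thesis using \<epsilon>(1) by blast
qed

text \<open>At a boundary point where \<open>X\<close> is transversal, an integral curve exists on one side of time 0 only.\<close>

lemma transversal_integral_curve:
  assumes M: "smooth_manifold b A" and X: "smooth_vector_field A X"
    and c: "c \<in> A" "x \<in> fst c" and x: "snd c x \<bullet> b = 0" "X x c \<bullet> b \<noteq> 0"
  shows "\<exists>J \<gamma> t. integral_curve A X J \<gamma> \<and> 0 \<in> J \<and> \<gamma> 0 = x \<and> t \<in> J \<and> \<gamma> t \<noteq> x"
proof -
  note A = smooth_manifold_chart_system[OF M]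
  let ?S = "snd c ` fst c" and ?p = "snd c x"
  have p: "?p \<in> ?S" using c by blast
  obtain \<epsilon>0 where \<epsilon>0: "\<epsilon>0 > 0" "ball ?p \<epsilon>0 \<inter> half_space b \<subseteq> ?S"
    using openin_half_space_ball[OF chart_image_half_space(1)[OF M c(1)] p] by blast
  obtain r Y h where r: "r \<le> \<epsilon>0" and co: "cutoff ?S (\<lambda>y. X (chart_inv c y) c) ?p r Y h"
    using smooth_on_cutoff[OF smooth_vector_field_chart[OF X c(1)] p \<epsilon>0(1)] by blast
  have "r > 0" using co unfolding cutoff_def by blast
  have sub: "ball ?p r \<inter> half_space b \<subseteq> ?S" using r \<epsilon>0(2) by auto
  have Yp: "Y ?p = X x c"
    using cutoff_inner[OF co p] \<open>r > 0\<close> chart_inv_chart[OF A c] by simp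
  obtain \<Phi> where \<Phi>: "is_flow Y \<Phi>" using is_flow_exists[OF co] by blast
  obtain \<epsilon> where \<epsilon>: "\<epsilon> > 0" "\<And>t. \<bar>t\<bar> < \<epsilon> \<Longrightarrow> \<Phi> (t, ?p) \<in> ball ?p (r / 2)"
    using is_flow_near[OF \<Phi>, of "r / 2" ?p] \<open>r > 0\<close> by auto
  \<comment> \<open>The direction of time in which the solution enters the half-space.\<close>
  define \<sigma> where "\<sigma> = sgn (X x c \<bullet> b)"
  have \<sigma>: "\<bar>\<sigma>\<bar> = 1" "\<sigma> * (X x c \<bullet> b) > 0" using x(2) by (auto simp: \<sigma>_def sgn_if)
  define u where "u t = \<Phi> (\<sigma> * t, ?p) \<bullet> b" for t
  have "((\<lambda>t. \<sigma> * t) has_vector_derivative \<sigma>) (at 0)"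
    by (auto intro!: derivative_eq_intros)
  moreover have "((\<lambda>s. \<Phi> (s, ?p)) has_vector_derivative X x c) (at (\<sigma> * 0))"
    using is_flow_derivative[OF \<Phi>, of ?p 0] is_flow_zero[OF \<Phi>] Yp by simp
  ultimately have "((\<lambda>s. \<Phi> (s, ?p)) \<circ> (\<lambda>t. \<sigma> * t) has_vector_derivative \<sigma> *\<^sub>R X x c) (at 0)"
    by (rule vector_diff_chain_at)
  from bounded_linear.has_vector_derivative[OF bounded_linear_inner_left this, of b]
  have "(u has_real_derivative \<sigma> * (X x c \<bullet> b)) (at 0)"
    by (simp add: has_real_derivative_iff_has_vector_derivative u_def[abs_def])
  from DERIV_pos_inc_right[OF this \<sigma>(2)] obtain d where d: "d > 0" "\<And>t. 0 < t \<Longrightarrow> t < d \<Longrightarrow> u 0 < u t"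
    by auto
  have u0: "u 0 = 0" using is_flow_zero[OF \<Phi>] x(1) by (simp add: u_def)
  define T where "T = min d \<epsilon> / 2"
  have T: "T > 0" "T < d" "T < \<epsilon>" using d(1) \<epsilon>(1) by (auto simp: T_def)
  have "\<Phi> (t, ?p) \<in> ?S \<inter> cball ?p (r / 2)" if t: "t \<in> closed_segment 0 (\<sigma> * T)" for t
  proof -
    obtain a where a: "0 \<le> a" "a \<le> 1" "t = \<sigma> * (a * T)"
      using t by (auto simp: closed_segment_def)
    have aT: "0 \<le> a * T" "a * T \<le> T" using a T by (auto intro: mult_left_le_one_le)
    have "u (a * T) \<ge> 0"
      using d(2)[of "a * T"] aT T u0 by (cases "a * T = 0") auto
    then have "\<Phi> (t, ?p) \<in> half_space b" by (simp add: u_def a(3) half_space_def)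
    moreover have "\<bar>t\<bar> = a * T" using a(1) T \<sigma>(1) by (simp add: a(3) abs_mult)
    then have "\<bar>t\<bar> < \<epsilon>" using aT T by linarith
    ultimately show ?thesis using \<epsilon>(2)[of t] sub \<open>r > 0\<close> by auto
  qed
  moreover have "is_interval (closed_segment 0 (\<sigma> * T))" by (simp add: is_interval_convex_1)
  ultimately have "integral_curve A X (closed_segment 0 (\<sigma> * T)) (\<lambda>t. chart_inv c (\<Phi> (t, ?p)))"
    by (intro cutoff_integral_curve[OF A X c(1) co \<Phi>])
  moreover have "chart_inv c (\<Phi> (0, ?p)) = x" using is_flow_zero[OF \<Phi>] chart_inv_chart[OF A c] by simp
  moreover have "chart_inv c (\<Phi> (\<sigma> * T, ?p)) \<noteq> x"
  proof
    assume "chart_inv c (\<Phi> (\<sigma> * T, ?p)) = x"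
    moreover have "\<Phi> (\<sigma> * T, ?p) \<in> ?S"
      using \<open>\<And>t. t \<in> closed_segment 0 (\<sigma> * T) \<Longrightarrow> \<Phi> (t, ?p) \<in> ?S \<inter> cball ?p (r / 2)\<close> by auto
    ultimately have "\<Phi> (\<sigma> * T, ?p) = ?p" using chart_chart_inv by metis
    then have "u T = 0" using x(1) by (simp add: u_def)
    then show False using d(2)[OF T(1,2)] u0 by simp
  qed
  ultimately show ?thesis
    by (intro exI[of _ "closed_segment 0 (\<sigma> * T)"] exI[of _ "\<lambda>t. chart_inv c (\<Phi> (t, ?p))"] exI[of _ "\<sigma> * T"]) auto
qed

lemma constant_integral_curve:
  assumes A: "chart_system A" and X: "smooth_vector_field A X" and "X x = (\<lambda>c. 0)" "is_interval J"
  shows "weighted_curve A X \<beta> J (\<lambda>t. x)"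
  using assms unfolding weighted_curve_def by (auto simp: o_def)

lemma integral_curve_not_constant:
  assumes A: "chart_system A" and X: "smooth_vector_field A X" and "\<epsilon> > 0"
    and \<gamma>: "integral_curve A X {-\<epsilon><..<\<epsilon>} \<gamma>" and const: "\<And>t. t \<in> {-\<epsilon><..<\<epsilon>} \<Longrightarrow> \<gamma> t = x"
  shows "X x = (\<lambda>c. 0)"
proof -
  obtain c where c: "c \<in> A" "x \<in> fst c" using chart_cover[OF A] by blast
  have 0: "0 \<in> {-\<epsilon><..<\<epsilon>}" using \<open>\<epsilon> > 0\<close> by simp
  have "((snd c \<circ> \<gamma>) has_vector_derivative X (\<gamma> 0) c) (at 0 within {-\<epsilon><..<\<epsilon>})"
    using \<gamma> 0 c const unfolding integral_curve_def by metis
  then have "((snd c \<circ> \<gamma>) has_vector_derivative X x c) (at 0)"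
    using 0 const[OF 0] by (simp add: at_within_open[OF 0])
  moreover have "((snd c \<circ> \<gamma>) has_vector_derivative 0) (at 0)"
    by (rule has_vector_derivative_transform_within_open[OF has_vector_derivative_const[of "snd c x"] _ 0])
      (use const in auto)
  ultimately have "X x c = 0" by (rule vector_derivative_unique_at)
  then show ?thesis using tangent_space_chart_zero[OF smooth_vector_field_tangent[OF X] c _ A] by blast
qed

section \<open>Reachability along a vector field\<close>

text \<open>The graph of the flow as a relation with signed time \<open>d\<close>. It treats
  existence and value together and avoids the \<open>THE\<close> in \<open>flow\<close>.\<close>

definition reach ::
  "('m::topological_space, 'e::euclidean_space) chart set \<Rightarrow> ('m, 'e) vector_field \<Rightarrow>
   'm \<Rightarrow> 'm \<Rightarrow> real \<Rightarrow> bool" where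
  "reach A X x y d \<longleftrightarrow> (\<exists>J \<gamma>. integral_curve A X J \<gamma> \<and> 0 \<in> J \<and> d \<in> J \<and> \<gamma> 0 = x \<and> \<gamma> d = y)"

lemma integral_curve_subset:
  "integral_curve A X J \<gamma> \<Longrightarrow> is_interval J' \<Longrightarrow> J' \<subseteq> J \<Longrightarrow> integral_curve A X J' \<gamma>"
  unfolding integral_curve_weighted by (rule weighted_curve_subset)

lemma is_interval_closed_segment: "is_interval (closed_segment a (b :: real))"
  by (simp add: is_interval_convex_1)

lemma closed_segment_subset_interval: "is_interval J \<Longrightarrow> a \<in> J \<Longrightarrow> b \<in> J \<Longrightarrow> closed_segment a b \<subseteq> (J :: real set)"
  by (simp add: closed_segment_subset is_interval_convex)

lemma reach_segment:
  "reach A X x y d \<longleftrightarrow> (\<exists>\<gamma>. integral_curve A X (closed_segment 0 d) \<gamma> \<and> \<gamma> 0 = x \<and> \<gamma> d = y)"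
proof
  assume "reach A X x y d"
  then obtain J \<gamma> where \<gamma>: "integral_curve A X J \<gamma>" "0 \<in> J" "d \<in> J" "\<gamma> 0 = x" "\<gamma> d = y"
    unfolding reach_def by blast
  then have "closed_segment 0 d \<subseteq> J"
    by (intro closed_segment_subset_interval) (auto simp: integral_curve_def)
  then have "integral_curve A X (closed_segment 0 d) \<gamma>"
    using integral_curve_subset[OF \<gamma>(1) is_interval_closed_segment] by blast
  then show "\<exists>\<gamma>. integral_curve A X (closed_segment 0 d) \<gamma> \<and> \<gamma> 0 = x \<and> \<gamma> d = y"
    using \<gamma> by blast
qed (unfold reach_def, metis ends_in_segment)

lemma has_vector_derivative_within_Un:
  assumes "(f has_vector_derivative v) (at x within S)" "(f has_vector_derivative v) (at x within T)"
  shows "(f has_vector_derivative v) (at x within S \<union> T)"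
  using assms unfolding has_vector_derivative_def has_derivative_within by (auto intro: Lim_Un)

context
  fixes A :: "('m::t2_space, 'e::euclidean_space) chart set" and X :: "('m, 'e) vector_field"
  assumes A: "chart_system A" and X: "smooth_vector_field A X"
begin

lemma integral_curve_unique:
  assumes "integral_curve A X J \<gamma>" "integral_curve A X J' \<delta>" "t0 \<in> J \<inter> J'" "\<gamma> t0 = \<delta> t0" "t \<in> J \<inter> J'"
  shows "\<gamma> t = \<delta> t"
proof -
  have J: "is_interval (J \<inter> J')" using assms(1,2) by (auto simp: integral_curve_def intro: is_interval_Int)
  show ?thesis
    by (rule weighted_curve_unique[OF A X, of "\<lambda>t. 1" "J \<inter> J'"])
      (use assms J in \<open>auto simp: integral_curve_weighted intro: weighted_curve_subset continuous_intros\<close>)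
qed

lemma reach_unique: "reach A X x y d \<Longrightarrow> reach A X x z d \<Longrightarrow> y = z"
proof -
  assume "reach A X x y d" "reach A X x z d"
  then obtain J \<gamma> J' \<delta> where "integral_curve A X J \<gamma>" "0 \<in> J" "d \<in> J" "\<gamma> 0 = x" "\<gamma> d = y"
    "integral_curve A X J' \<delta>" "0 \<in> J'" "d \<in> J'" "\<delta> 0 = x" "\<delta> d = z"
    unfolding reach_def by auto
  then show "y = z" using integral_curve_unique[of J \<gamma> J' \<delta> 0 d] by simp
qed

lemma flow_eqI:
  assumes "reach A X x y d"
  shows "flow A X x d = y"
  unfolding flow_def
proof (rule the_equality)
  show "\<exists>J \<gamma>. integral_curve A X J \<gamma> \<and> 0 \<in> J \<and> \<gamma> 0 = x \<and> d \<in> J \<and> \<gamma> d = y"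
    using assms unfolding reach_def by blast
  fix z assume "\<exists>J \<gamma>. integral_curve A X J \<gamma> \<and> 0 \<in> J \<and> \<gamma> 0 = x \<and> d \<in> J \<and> \<gamma> d = z"
  then have "reach A X x z d" unfolding reach_def by blast
  then show "z = y" using assms reach_unique by blast
qed

lemma max_interval_iff: "d \<in> max_interval A X x \<longleftrightarrow> (\<exists>y. reach A X x y d)"
  unfolding max_interval_def reach_def by blast

lemma orbit_iff: "y \<in> orbit A X x \<longleftrightarrow> (\<exists>d. reach A X x y d)"
proof
  assume "y \<in> orbit A X x"
  then obtain d where d: "d \<in> max_interval A X x" "y = flow A X x d" unfolding orbit_def by blast
  then obtain z where "reach A X x z d" using max_interval_iff by auto
  then show "\<exists>d. reach A X x y d" using flow_eqI d(2) by auto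
next
  assume "\<exists>d. reach A X x y d"
  then obtain d where d: "reach A X x y d" by blast
  then have "d \<in> max_interval A X x" using max_interval_iff by auto
  then show "y \<in> orbit A X x" unfolding orbit_def using flow_eqI[OF d] by (intro image_eqI) auto
qed

text \<open>The witness is the one-point interval \<open>{0}\<close>, within which every vector is a
  derivative.\<close>

lemma reach_refl: "reach A X x x 0"
proof -
  have "integral_curve A X {0} (\<lambda>t. x)"
    by (auto simp: integral_curve_def has_vector_derivative_def has_derivative_within_singleton_iff is_interval_1
        intro: bounded_linear_scaleR_left)
  then show ?thesis unfolding reach_def by blast
qed

lemma integral_curve_shift:
  assumes "integral_curve A X J \<gamma>"
  shows "integral_curve A X {s. s + d \<in> J} (\<lambda>s. \<gamma> (s + d))"
  unfolding integral_curve_def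
proof (intro conjI ballI impI)
  show "is_interval {s. s + d \<in> J}"
    using assms unfolding integral_curve_def is_interval_1 by (smt (verit) mem_Collect_eq)
  show "continuous_on {s. s + d \<in> J} (\<lambda>s. \<gamma> (s + d))"
    using assms unfolding integral_curve_def
    by (auto intro!: continuous_on_compose2[of J \<gamma>] continuous_intros)
  fix t c assume t: "t \<in> {s. s + d \<in> J}" and c: "c \<in> A" "\<gamma> (t + d) \<in> fst c"
  have "((\<lambda>s. s + d) has_vector_derivative 1) (at t within {s. s + d \<in> J})"
    by (auto intro!: derivative_eq_intros)
  moreover have "((snd c \<circ> \<gamma>) has_vector_derivative X (\<gamma> (t + d)) c) (at (t + d) within (\<lambda>s. s + d) ` {s. s + d \<in> J})"
    by (rule has_vector_derivative_within_subset[of _ _ _ J])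
      (use assms t c in \<open>auto simp: integral_curve_def\<close>)
  ultimately have "((snd c \<circ> \<gamma>) \<circ> (\<lambda>s. s + d) has_vector_derivative 1 *\<^sub>R X (\<gamma> (t + d)) c) (at t within {s. s + d \<in> J})"
    by (rule vector_diff_chain_within)
  then show "(snd c \<circ> (\<lambda>s. \<gamma> (s + d)) has_vector_derivative X (\<gamma> (t + d)) c) (at t within {s. s + d \<in> J})"
    by (simp add: o_def)
qed

lemma reach_between:
  assumes "integral_curve A X J \<gamma>" "s \<in> J" "t \<in> J"
  shows "reach A X (\<gamma> s) (\<gamma> t) (t - s)"
  unfolding reach_def
  by (rule exI[of _ "{u. u + s \<in> J}"], rule exI[of _ "\<lambda>u. \<gamma> (u + s)"])
    (use assms integral_curve_shift[OF assms(1)] in auto)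

lemma reach_sym: "reach A X x y d \<Longrightarrow> reach A X y x (- d)"
  unfolding reach_def[of A X x y d] using reach_between by force

text \<open>At a time belonging to one interval only, closedness of the other makes the filter
  within it trivial. Hence the derivative within the union can be assembled from the two parts at
  every time.\<close>

lemma integral_curve_glue:
  assumes 1: "integral_curve A X J1 \<gamma>1" and 2: "integral_curve A X J2 \<gamma>2" and cl: "closed J1" "closed J2"
    and agree: "\<And>t. t \<in> J1 \<inter> J2 \<Longrightarrow> \<gamma>1 t = \<gamma>2 t" and J: "is_interval (J1 \<union> J2)"
  shows "integral_curve A X (J1 \<union> J2) (\<lambda>t. if t \<in> J1 then \<gamma>1 t else \<gamma>2 t)" (is "integral_curve A X _ ?\<eta>")
  unfolding integral_curve_def
proof (intro conjI ballI impI J)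
  show "continuous_on (J1 \<union> J2) ?\<eta>"
    using 1 2 cl agree unfolding integral_curve_def by (intro continuous_on_cases) auto
  have e1: "?\<eta> t = \<gamma>1 t" if "t \<in> J1" for t using that by simp
  have e2: "?\<eta> t = \<gamma>2 t" if "t \<in> J2" for t using that agree by simp
  have part: "((snd c \<circ> ?\<eta>) has_vector_derivative X (?\<eta> t) c) (at t within J)"
    if \<gamma>: "integral_curve A X J \<gamma>" and "closed J" and e: "\<And>t. t \<in> J \<Longrightarrow> ?\<eta> t = \<gamma> t"
      and c: "c \<in> A" "?\<eta> t \<in> fst c" for J \<gamma> t c
  proof (cases "t \<in> J")
    case True
    then have "((snd c \<circ> \<gamma>) has_vector_derivative X (?\<eta> t) c) (at t within J)"
      using \<gamma> c e[OF True] unfolding integral_curve_def by simp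
    then show ?thesis
      by (rule has_vector_derivative_transform[OF True, rotated]) (use e in simp)
  next
    case False
    then have "at t within J = bot"
      using \<open>closed J\<close> by (simp add: at_within_eq_bot_iff)
    then show ?thesis
      by (simp add: has_vector_derivative_def has_derivative_def bounded_linear_scaleR_left)
  qed
  fix t c assume "c \<in> A" "?\<eta> t \<in> fst c"
  then show "((snd c \<circ> ?\<eta>) has_vector_derivative X (?\<eta> t) c) (at t within J1 \<union> J2)"
    using part[OF 1 cl(1) e1] part[OF 2 cl(2) e2] by (intro has_vector_derivative_within_Un)
qed

text \<open>If \<open>d\<close> and \<open>e\<close> have opposite signs the second curve runs back
  over the first, and the two time segments overlap in more than a point. Uniqueness makes the
  curves agree there, so they can be glued.\<close>

lemma reach_trans:
  assumes "reach A X x y d" "reach A X y z e"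
  shows "reach A X x z (d + e)"
proof -
  obtain \<gamma>1 where 1: "integral_curve A X (closed_segment 0 d) \<gamma>1" "\<gamma>1 0 = x" "\<gamma>1 d = y"
    using assms(1) unfolding reach_segment by blast
  obtain J \<gamma>2 where 2: "integral_curve A X J \<gamma>2" "0 \<in> J" "e \<in> J" "\<gamma>2 0 = y" "\<gamma>2 e = z"
    using assms(2) unfolding reach_def by blast
  let ?J = "closed_segment d (d + e)"
  note sh = integral_curve_shift[OF 2(1), of "- d"]
  have 3: "integral_curve A X ?J (\<lambda>s. \<gamma>2 (s + - d))"
    by (rule integral_curve_subset[OF sh is_interval_closed_segment])
      (rule closed_segment_subset_interval, use sh 2 in \<open>auto simp: integral_curve_def\<close>)
  have agree: "\<gamma>1 t = \<gamma>2 (t + - d)" if "t \<in> closed_segment 0 d \<inter> ?J" for t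
    by (rule integral_curve_unique[OF 1(1) 3, of d]) (use that 1 2 in auto)
  have "connected (closed_segment 0 d \<union> ?J)"
    by (rule connected_Un) auto
  then have J: "is_interval (closed_segment 0 d \<union> ?J)" by (simp add: is_interval_connected_1)
  let ?\<eta> = "\<lambda>t. if t \<in> closed_segment 0 d then \<gamma>1 t else \<gamma>2 (t + - d)"
  have "integral_curve A X (closed_segment 0 d \<union> ?J) ?\<eta>"
    by (rule integral_curve_glue[OF 1(1) 3 closed_segment closed_segment agree J])
  moreover have "?\<eta> 0 = x" using 1 by simp
  moreover have "?\<eta> (d + e) = z" using agree[of "d + e"] 2 by auto
  ultimately show ?thesis
    unfolding reach_def by (intro exI[of _ "closed_segment 0 d \<union> ?J"] exI[of _ ?\<eta>]) auto
qed

lemma reach_singular: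
  assumes "X x = (\<lambda>c. 0)" "reach A X x y d"
  shows "y = x"
proof -
  have "integral_curve A X (closed_segment 0 d) (\<lambda>t. x)"
    unfolding integral_curve_weighted by (rule constant_integral_curve[OF A X assms(1) is_interval_closed_segment])
  then have "reach A X x x d" unfolding reach_segment by blast
  then show ?thesis using reach_unique assms(2) by blast
qed

lemma orbit_singular:
  assumes "X x = (\<lambda>c. 0)" "x \<in> orbit A X y"
  shows "orbit A X y = {x}"
proof -
  obtain d where "reach A X y x d" using assms(2) orbit_iff by blast
  then have "y = x" using reach_singular[OF assms(1)] reach_sym by metis
  then show ?thesis using reach_singular[OF assms(1)] reach_refl orbit_iff by blast
qed

end

text \<open>Near a time \<open>a\<close> the curve is an \<open>F\<close>-curve with the time change
  \<open>\<Lambda> s - \<Lambda> a\<close>, by uniqueness of weighted curves. Reachability with time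
  difference \<open>\<Lambda> s' - \<Lambda> s\<close> is an equivalence relation that holds
  locally, hence everywhere on the connected line; thus long \<open>F\<close>-curves arise from
  short ones.\<close>

lemma weighted_curve_reach:
  fixes A :: "('m::{t2_space,second_countable_topology}, 'e::euclidean_space) chart set"
  assumes M: "smooth_manifold b A" and F: "smooth_vector_field A F" and tan: "chart_tangent b A F"
    and g: "weighted_curve A F \<beta> UNIV g" and \<beta>: "continuous_on UNIV \<beta>"
    and \<Lambda>: "\<And>s. (\<Lambda> has_real_derivative \<beta> s) (at s)"
  shows "reach A F (g s) (g s') (\<Lambda> s' - \<Lambda> s)"
proof -
  note A = smooth_manifold_chart_system[OF M]
  have c\<Lambda>: "continuous_on UNIV \<Lambda>"
    by (rule continuous_at_imp_continuous_on) (use DERIV_isCont[OF \<Lambda>] in auto)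
  show ?thesis
  proof (rule connected_equivalence_relation[where S=UNIV and R="\<lambda>s s'. reach A F (g s) (g s') (\<Lambda> s' - \<Lambda> s)"])
    fix a :: real
    obtain \<epsilon> \<eta> where \<epsilon>: "\<epsilon> > 0" and \<eta>: "integral_curve A F {-\<epsilon><..<\<epsilon>} \<eta>" "\<eta> 0 = g a"
      using local_integral_curve[OF M F tan, of "g a"] by auto
    have "\<forall>e>0. \<exists>d>0. \<forall>s. dist s a < d \<longrightarrow> dist (\<Lambda> s) (\<Lambda> a) < e"
      using c\<Lambda> unfolding continuous_on_iff by simp
    then obtain d where d: "d > 0" "\<And>s. dist s a < d \<Longrightarrow> dist (\<Lambda> s) (\<Lambda> a) < \<epsilon>" using \<epsilon> by auto
    let ?J = "{a-d<..<a+d}"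
    have \<Lambda>J: "\<Lambda> s - \<Lambda> a \<in> {-\<epsilon><..<\<epsilon>}" if "s \<in> ?J" for s
      using d(2)[of s] that by (auto simp: dist_real_def abs_less_iff)
    have w: "weighted_curve A F \<beta> ?J (\<lambda>s. \<eta> (\<Lambda> s - \<Lambda> a))"
      unfolding weighted_curve_def
    proof (intro conjI ballI impI is_interval_oo)
      have "continuous_on {-\<epsilon><..<\<epsilon>} \<eta>" using \<eta> by (simp add: integral_curve_def)
      then show "continuous_on ?J (\<lambda>s. \<eta> (\<Lambda> s - \<Lambda> a))"
        by (rule continuous_on_compose2[where f="\<lambda>s. \<Lambda> s - \<Lambda> a"])
          (use \<Lambda>J in \<open>auto intro!: continuous_intros continuous_on_subset[OF c\<Lambda>]\<close>)
      fix s c assume s: "s \<in> ?J" and c: "c \<in> A" "\<eta> (\<Lambda> s - \<Lambda> a) \<in> fst c"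
      have "((snd c \<circ> \<eta>) has_vector_derivative F (\<eta> (\<Lambda> s - \<Lambda> a)) c) (at (\<Lambda> s - \<Lambda> a) within {-\<epsilon><..<\<epsilon>})"
        using \<eta> \<Lambda>J[OF s] c unfolding integral_curve_def by blast
      then have d2: "((snd c \<circ> \<eta>) has_vector_derivative F (\<eta> (\<Lambda> s - \<Lambda> a)) c) (at (\<Lambda> s - \<Lambda> a))"
        using at_within_open[OF \<Lambda>J[OF s]] by simp
      have d1: "((\<lambda>s. \<Lambda> s - \<Lambda> a) has_vector_derivative \<beta> s) (at s)"
        using has_vector_derivative_diff[OF \<Lambda>[of s, unfolded has_real_derivative_iff_has_vector_derivative]
            has_vector_derivative_const[of "\<Lambda> a"]] by simp
      from vector_diff_chain_at[OF d1 d2]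
      have "(snd c \<circ> (\<lambda>s. \<eta> (\<Lambda> s - \<Lambda> a)) has_vector_derivative \<beta> s *\<^sub>R F (\<eta> (\<Lambda> s - \<Lambda> a)) c) (at s)"
        by (simp add: o_def)
      then show "(snd c \<circ> (\<lambda>s. \<eta> (\<Lambda> s - \<Lambda> a)) has_vector_derivative \<beta> s *\<^sub>R F (\<eta> (\<Lambda> s - \<Lambda> a)) c) (at s within ?J)"
        by (rule has_vector_derivative_at_within)
    qed
    have g': "weighted_curve A F \<beta> ?J g" using weighted_curve_subset[OF g is_interval_oo] by blast
    have "reach A F (g a) (g s) (\<Lambda> s - \<Lambda> a)" if s: "s \<in> ?J" for s
    proof -
      have "g s = \<eta> (\<Lambda> s - \<Lambda> a)"
        by (rule weighted_curve_unique[OF A F g' w continuous_on_subset[OF \<beta>], of a])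
          (use s d(1) \<eta>(2) in auto)
      then show ?thesis
        unfolding reach_def using \<eta> \<epsilon> \<Lambda>J[OF s]
        by (intro exI[of _ "{-\<epsilon><..<\<epsilon>}"] exI[of _ \<eta>]) auto
    qed
    then show "\<exists>T. openin (top_of_set UNIV) T \<and> a \<in> T \<and> (\<forall>s\<in>T. reach A F (g a) (g s) (\<Lambda> s - \<Lambda> a))"
      using d(1) by (intro exI[of _ ?J]) auto
  next
    fix s s' assume "reach A F (g s) (g s') (\<Lambda> s' - \<Lambda> s)"
    from reach_sym[OF A F this] show "reach A F (g s') (g s) (\<Lambda> s - \<Lambda> s')" by simp
  next
    fix s s' s'' assume "reach A F (g s) (g s') (\<Lambda> s' - \<Lambda> s)" "reach A F (g s') (g s'') (\<Lambda> s'' - \<Lambda> s')"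
    from reach_trans[OF A F this] show "reach A F (g s) (g s'') (\<Lambda> s'' - \<Lambda> s)" by simp
  qed auto
qed

section \<open>Fields whose orbits lie in orbits of another field\<close>

text \<open>Rational points of \<open>D\<close> suffice for interior times, and the end points of
  \<open>D\<close> that belong to it are added. Which side of a time the rational must lie on
  depends on the sign of the time, so one is taken above it and one below.\<close>

lemma interval_countable_segments:
  fixes D :: "real set"
  assumes 0: "0 \<in> D" and D: "is_interval D"
  shows "\<exists>D0\<subseteq>D. countable D0 \<and> D \<subseteq> (\<Union>d\<in>D0. closed_segment 0 d)"
proof -
  define D0 where "D0 = {d \<in> D. d \<in> \<rat> \<or> (\<forall>e\<in>D. e \<le> d) \<or> (\<forall>e\<in>D. d \<le> e)}"
  have single: "countable S" if "\<And>x y. x \<in> S \<Longrightarrow> y \<in> S \<Longrightarrow> x = y" for S :: "real set"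
  proof (cases "S = {}")
    case False
    then obtain x where "x \<in> S" by blast
    then have "S \<subseteq> {x}" using that by blast
    then show ?thesis by (rule countable_subset) simp
  qed simp
  have "countable {d \<in> D. \<forall>e\<in>D. e \<le> d}" "countable {d \<in> D. \<forall>e\<in>D. d \<le> e}"
    by (rule single, simp add: order.antisym)+
  moreover have "D0 \<subseteq> \<rat> \<union> {d \<in> D. \<forall>e\<in>D. e \<le> d} \<union> {d \<in> D. \<forall>e\<in>D. d \<le> e}"
    by (auto simp: D0_def)
  ultimately have "countable D0"
    by (meson countable_Un countable_rat countable_subset)
  moreover have "x \<in> (\<Union>d\<in>D0. closed_segment 0 d)" if x: "x \<in> D" for x
  proof (cases "x \<in> D0")
    case False
    then obtain y y' where y: "y \<in> D" "x < y" "y' \<in> D" "y' < x" using x by (auto simp: D0_def not_le)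
    obtain q q' where q: "q \<in> \<rat>" "x < q" "q < y" "q' \<in> \<rat>" "y' < q'" "q' < x"
      using Rats_dense_in_real[OF y(2)] Rats_dense_in_real[OF y(4)] by blast
    have mid: "u \<in> D" if "a \<in> D" "b \<in> D" "a < u" "u < b" for a b u
      using D that unfolding is_interval_1 by (meson less_imp_le)
    have "q \<in> D0" "q' \<in> D0"
      using q mid[OF x y(1) q(2,3)] mid[OF y(3) x q(5,6)] by (auto simp: D0_def)
    moreover have "x \<in> closed_segment 0 q \<or> x \<in> closed_segment 0 q'"
      using q by (auto simp: closed_segment_eq_real_ivl)
    ultimately show ?thesis by blast
  qed (auto intro!: bexI[of _ x])
  moreover have "D0 \<subseteq> D" by (auto simp: D0_def)
  ultimately show ?thesis by blast
qed

text \<open>Otherwise the complements in \<open>{a..b}\<close> would be relatively open and dense,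
  with empty intersection.\<close>

lemma interval_Baire:
  fixes C :: "'i \<Rightarrow> real set"
  assumes "countable I" "a < b" "\<And>i. i \<in> I \<Longrightarrow> closed (C i)" "{a..b} \<subseteq> (\<Union>i\<in>I. C i)"
  shows "\<exists>i\<in>I. \<exists>s\<in>{a..b}. \<exists>\<rho>>0. ball s \<rho> \<inter> {a..b} \<subseteq> C i"
proof (rule ccontr)
  assume neg: "\<not> ?thesis"
  let ?G = "(\<lambda>i. {a..b} - C i) ` I"
  have "{a..b} \<subseteq> closure (\<Inter>?G)"
  proof (rule Baire)
    fix T assume "T \<in> ?G"
    then obtain i where i: "i \<in> I" "T = {a..b} - C i" by auto
    have "openin (top_of_set {a..b}) ({a..b} \<inter> - C i)"
      using assms(3)[OF i(1)] by (intro openin_open_Int) auto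
    moreover have "{a..b} \<subseteq> closure T"
    proof
      fix s assume s: "s \<in> {a..b}"
      show "s \<in> closure T"
        unfolding closure_approachable
      proof (intro allI impI)
        fix \<rho> :: real assume "\<rho> > 0"
        then have "\<not> ball s \<rho> \<inter> {a..b} \<subseteq> C i" using neg i s by blast
        then obtain y where "y \<in> ball s \<rho>" "y \<in> {a..b}" "y \<notin> C i" by blast
        then show "\<exists>y\<in>T. dist y s < \<rho>" using i(2) by (intro bexI[of _ y]) (auto simp: dist_commute)
      qed
    qed
    ultimately show "openin (top_of_set {a..b}) T \<and> {a..b} \<subseteq> closure T"
      using i(2) by (simp add: Diff_eq)
  qed (use assms(1) in auto)
  moreover have "a \<in> {a..b}" using assms(2) by simp
  moreover have "\<Inter>?G = {}"
  proof -
    obtain i where "i \<in> I" using assms(4) \<open>a \<in> {a..b}\<close> by blast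
    then have "x \<in> {a..b}" if "x \<in> \<Inter>?G" for x using that by blast
    then show ?thesis using assms(4) by blast
  qed
  ultimately show False by simp
qed

text \<open>The curves meet at parameters \<open>s k\<close> that tend to \<open>s0\<close> without
  attaining it. Each common increment is close to \<open>\<Delta>s\<close> times \<open>v\<close>
  and also to \<open>\<Delta>e\<close> times \<open>w\<close>. As \<open>w\<close> is not 0,
  \<open>\<Delta>e\<close> is bounded by a multiple of \<open>\<Delta>s\<close>, and so the
  component of \<open>v\<close> orthogonal to \<open>w\<close> must vanish.\<close>

lemma tangent_parallel:
  fixes z \<zeta> :: "real \<Rightarrow> 'e::euclidean_space"
  assumes z: "(z has_vector_derivative v) (at s0 within I)" and \<zeta>: "(\<zeta> has_vector_derivative w) (at e0 within J)"
    and "w \<noteq> 0" and s: "\<And>k. s k \<in> I" "\<And>k. s k \<noteq> s0" "s \<longlonglongrightarrow> s0"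
    and e: "\<And>k. e k \<in> J" "e \<longlonglongrightarrow> e0" and eq: "\<forall>\<^sub>F k in sequentially. z (s k) = \<zeta> (e k)" "z s0 = \<zeta> e0"
  shows "v = ((v \<bullet> w) / (w \<bullet> w)) *\<^sub>R w"
proof -
  \<comment> \<open>The component of \<open>v\<close> orthogonal to \<open>w\<close>.\<close>
  define u where "u = v - ((v \<bullet> w) / (w \<bullet> w)) *\<^sub>R w"
  have uw: "u \<bullet> w = 0" using \<open>w \<noteq> 0\<close> by (simp add: u_def inner_diff_left)
  then have uv: "u \<bullet> v = (norm u)\<^sup>2" by (simp add: u_def dot_square_norm[symmetric] inner_diff_right)
  \<comment> \<open>For small \<open>\<eta>\<close> the meeting parameters will satisfy
    \<open>\<bar>\<Delta>e\<bar> + \<bar>\<Delta>s\<bar> \<le> C * \<bar>\<Delta>s\<bar>\<close>;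
    the factor 2 comes from absorbing \<open>\<eta> * \<bar>\<Delta>e\<bar>\<close> into half of
    \<open>\<bar>\<Delta>e\<bar> * norm w\<close>.\<close>
  define C where "C = 1 + 2 * (norm v + 1) / norm w"
  have "C > 0" using \<open>w \<noteq> 0\<close> by (simp add: C_def add_pos_nonneg)
  have bound: "norm u \<le> \<eta> * C" if \<eta>: "\<eta> > 0" "\<eta> \<le> 1" "\<eta> \<le> norm w / 2" for \<eta>
  proof -
    obtain d1 where d1: "d1 > 0" "\<And>y. y \<in> I \<Longrightarrow> norm (y - s0) < d1 \<Longrightarrow>
        norm (z y - z s0 - (y - s0) *\<^sub>R v) \<le> \<eta> * norm (y - s0)"
      using z \<eta>(1) unfolding has_vector_derivative_def has_derivative_within_alt by metis
    obtain d2 where d2: "d2 > 0" "\<And>y. y \<in> J \<Longrightarrow> norm (y - e0) < d2 \<Longrightarrow>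
        norm (\<zeta> y - \<zeta> e0 - (y - e0) *\<^sub>R w) \<le> \<eta> * norm (y - e0)"
      using \<zeta> \<eta>(1) unfolding has_vector_derivative_def has_derivative_within_alt by metis
    have "\<forall>\<^sub>F k in sequentially. dist (s k) s0 < d1" "\<forall>\<^sub>F k in sequentially. dist (e k) e0 < d2"
      using s(3) e(2) d1(1) d2(1) by (auto dest: tendstoD)
    with eq(1) have "\<forall>\<^sub>F k in sequentially. z (s k) = \<zeta> (e k) \<and> dist (s k) s0 < d1 \<and> dist (e k) e0 < d2"
      by (intro eventually_conj)
    then obtain k where k: "z (s k) = \<zeta> (e k)" "dist (s k) s0 < d1" "dist (e k) e0 < d2"
      using eventually_happens[of _ sequentially] by auto
    define r where "r = z (s k) - z s0"
    define \<Delta>s where "\<Delta>s = s k - s0"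
    define \<Delta>e where "\<Delta>e = e k - e0"
    have o1: "norm (r - \<Delta>s *\<^sub>R v) \<le> \<eta> * \<bar>\<Delta>s\<bar>"
      using d1(2)[OF s(1), of k] k(2) by (simp add: r_def \<Delta>s_def dist_norm)
    have o2: "norm (r - \<Delta>e *\<^sub>R w) \<le> \<eta> * \<bar>\<Delta>e\<bar>"
      using d2(2)[OF e(1), of k] k eq(2) by (simp add: r_def \<Delta>e_def dist_norm)
    have "\<bar>\<Delta>s\<bar> > 0" using s(2)[of k] by (simp add: \<Delta>s_def)
    have "\<bar>\<Delta>e\<bar> * norm w \<le> norm r + \<eta> * \<bar>\<Delta>e\<bar>"
      using o2 norm_triangle_ineq2[of "\<Delta>e *\<^sub>R w" r] by (simp add: norm_minus_commute)
    also have "\<eta> * \<bar>\<Delta>e\<bar> \<le> norm w / 2 * \<bar>\<Delta>e\<bar>" using \<eta>(3) by (intro mult_right_mono) auto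
    finally have "\<bar>\<Delta>e\<bar> * norm w \<le> 2 * norm r" by (simp add: mult.commute[of "norm w"])
    moreover have "norm r \<le> \<bar>\<Delta>s\<bar> * (norm v + 1)"
    proof -
      have "norm r \<le> norm (\<Delta>s *\<^sub>R v) + \<eta> * \<bar>\<Delta>s\<bar>"
        using o1 norm_triangle_ineq2[of r "\<Delta>s *\<^sub>R v"] by simp
      also have "\<eta> * \<bar>\<Delta>s\<bar> \<le> 1 * \<bar>\<Delta>s\<bar>" using \<eta>(2) by (intro mult_right_mono) auto
      finally show ?thesis by (simp add: algebra_simps)
    qed
    ultimately have "\<bar>\<Delta>e\<bar> * norm w \<le> 2 * (\<bar>\<Delta>s\<bar> * (norm v + 1))" by linarith
    then have De: "\<bar>\<Delta>e\<bar> \<le> \<bar>\<Delta>s\<bar> * (2 * (norm v + 1) / norm w)"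
      using \<open>w \<noteq> 0\<close> by (simp add: field_simps)
    have "\<Delta>s * (norm u)\<^sup>2 = u \<bullet> (r - \<Delta>e *\<^sub>R w) - u \<bullet> (r - \<Delta>s *\<^sub>R v)"
      by (simp add: inner_diff_right uw uv)
    also have "\<bar>\<dots>\<bar> \<le> norm u * norm (r - \<Delta>e *\<^sub>R w) + norm u * norm (r - \<Delta>s *\<^sub>R v)"
      using Cauchy_Schwarz_ineq2[of u "r - \<Delta>e *\<^sub>R w"] Cauchy_Schwarz_ineq2[of u "r - \<Delta>s *\<^sub>R v"] by linarith
    also have "\<dots> \<le> norm u * (\<eta> * \<bar>\<Delta>e\<bar>) + norm u * (\<eta> * \<bar>\<Delta>s\<bar>)"
      by (intro add_mono mult_left_mono o1 o2) auto
    also have "\<dots> = norm u * \<eta> * (\<bar>\<Delta>e\<bar> + \<bar>\<Delta>s\<bar>)" by (simp add: algebra_simps)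
    also have "\<dots> \<le> norm u * \<eta> * (\<bar>\<Delta>s\<bar> * C)"
      using De \<eta>(1) by (intro mult_left_mono) (auto simp: C_def algebra_simps)
    finally have "\<bar>\<Delta>s\<bar> * (norm u * norm u) \<le> \<bar>\<Delta>s\<bar> * (norm u * (\<eta> * C))"
      by (simp add: abs_mult power2_eq_square mult_ac)
    then have "norm u * norm u \<le> norm u * (\<eta> * C)" using \<open>\<bar>\<Delta>s\<bar> > 0\<close> by (simp only: mult_le_cancel_left_pos)
    then show ?thesis using \<open>C > 0\<close> \<eta>(1) by (cases "norm u = 0") (auto simp: mult_le_cancel_left)
  qed
  have "norm u = 0"
  proof (rule ccontr)
    assume "norm u \<noteq> 0"
    then have pos: "norm u > 0" by simp
    \<comment> \<open>The first two terms meet the conditions of \<open>bound\<close>; the last one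
      makes its right-hand side at most half of \<open>norm u\<close>.\<close>
    define \<eta> where "\<eta> = min (min 1 (norm w / 2)) (norm u / (2 * C))"
    have "\<eta> > 0" using pos \<open>w \<noteq> 0\<close> \<open>C > 0\<close> by (simp add: \<eta>_def)
    moreover have "\<eta> * C \<le> norm u / 2"
    proof -
      have "\<eta> * C \<le> norm u / (2 * C) * C" using \<open>C > 0\<close> by (intro mult_right_mono) (auto simp: \<eta>_def)
      then show ?thesis using \<open>C > 0\<close> by simp
    qed
    moreover have "\<eta> \<le> 1" "\<eta> \<le> norm w / 2"
      unfolding \<eta>_def by (auto intro: min.coboundedI1 min.coboundedI2)
    ultimately show False using bound[of \<eta>] pos by simp
  qed
  then show ?thesis by (simp add: u_def)
qed

text \<open>The Baire argument: \<open>C d\<close> is the closed set of times at which the \<open>G\<close>-curve \<open>\<delta>\<close>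
  meets the compact arc of the \<open>F\<close>-orbit with parameters between 0 and \<open>d\<close>.\<close>

lemma parallel_nearby:
  fixes A :: "('m::{t2_space,second_countable_topology}, 'e::euclidean_space) chart set"
  assumes M: "smooth_manifold b A" and F: "smooth_vector_field A F" and G: "smooth_vector_field A G"
    and orb: "\<And>x. \<exists>y. orbit A G x \<subseteq> orbit A F y"
    and c: "c \<in> A" and p: "p \<in> snd c ` fst c" and Fp: "F (chart_inv c p) c \<noteq> 0" and "\<epsilon>' > 0"
  shows "\<exists>q\<in>snd c ` fst c \<inter> ball p \<epsilon>'.
    G (chart_inv c q) c = ((G (chart_inv c q) c \<bullet> F (chart_inv c q) c) /
      (F (chart_inv c q) c \<bullet> F (chart_inv c q) c)) *\<^sub>R F (chart_inv c q) c"
proof -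
  note A = smooth_manifold_chart_system[OF M]
  have b: "b \<in> Basis" using M by (simp add: smooth_manifold_def)
  let ?S = "snd c ` fst c" and ?f = "\<lambda>y. F (chart_inv c y) c" and ?g = "\<lambda>y. G (chart_inv c y) c"
  have "continuous_on ?S ?f"
    using smooth_vector_field_chart[OF F c] by (rule smooth_on_imp_continuous_on)
  moreover have "norm (?f p) > 0" using Fp by simp
  ultimately obtain \<epsilon>1 where \<epsilon>1: "\<epsilon>1 > 0" "\<And>y. y \<in> ?S \<Longrightarrow> dist y p < \<epsilon>1 \<Longrightarrow> dist (?f y) (?f p) < norm (?f p)"
    using p unfolding continuous_on_iff by metis
  have f0: "?f y \<noteq> 0" if "y \<in> ?S" "dist y p < \<epsilon>1" for y
    using \<epsilon>1(2)[OF that] by (auto simp: dist_norm)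
  obtain \<epsilon>0 where \<epsilon>0: "\<epsilon>0 > 0" "ball p \<epsilon>0 \<inter> half_space b \<subseteq> ?S"
    using openin_half_space_ball[OF chart_image_half_space(1)[OF M c] p] by blast
  define \<tau> where "\<tau> = min \<epsilon>0 (min \<epsilon>1 \<epsilon>') / 4"
  have \<tau>: "\<tau> > 0" "2 * \<tau> < \<epsilon>0" "2 * \<tau> < \<epsilon>1" "2 * \<tau> < \<epsilon>'"
    using \<epsilon>0(1) \<epsilon>1(1) \<open>\<epsilon>' > 0\<close> by (auto simp: \<tau>_def)
  \<comment> \<open>Moving by \<open>\<tau>\<close> along \<open>b\<close> leads into the interior
    of the half-space, with the whole ball of radius \<open>\<tau>\<close> around \<open>p'\<close>
    in the chart image. There a \<open>G\<close>-curve exists in both time directions, although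
    tangency of \<open>G\<close> to the boundary is not yet established.\<close>
  define p' where "p' = p + \<tau> *\<^sub>R b"
  have ball: "y \<in> ?S \<inter> ball p \<epsilon>' \<and> dist y p < \<epsilon>1" if "y \<in> ball p' \<tau>" for y
  proof -
    have "dist p p' = \<tau>" using b \<tau>(1) by (simp add: p'_def dist_norm)
    then have "dist p y < 2 * \<tau>" using dist_triangle[of p y p'] that by simp
    moreover have "y \<in> half_space b"
    proof -
      have "\<bar>(y - p') \<bullet> b\<bar> \<le> norm (y - p')" using Basis_le_norm[OF b] by blast
      moreover have "norm (y - p') < \<tau>" using that by (simp add: dist_norm norm_minus_commute)
      moreover have "p \<bullet> b \<ge> 0" using chart_image_half_space(2)[OF M c] p by (auto simp: half_space_def)
      moreover have "p' \<bullet> b = p \<bullet> b + \<tau>" using b by (simp add: p'_def inner_add_left)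
      ultimately show ?thesis by (simp add: half_space_def inner_diff_left)
    qed
    ultimately show ?thesis using \<epsilon>0(2) \<tau> by (auto simp: dist_commute)
  qed
  have p': "p' \<in> ?S" using ball[of p'] \<tau>(1) by simp
  obtain r Y h where r: "r \<le> \<tau>" and co: "cutoff ?S ?g p' r Y h"
    using smooth_on_cutoff[OF smooth_vector_field_chart[OF G c] p' \<tau>(1)] by blast
  note r0 = cutoff_pos[OF co]
  obtain \<Phi> where \<Phi>: "is_flow Y \<Phi>" using is_flow_exists[OF co] by blast
  obtain \<epsilon> where \<epsilon>: "\<epsilon> > 0" "\<And>t. \<bar>t\<bar> < \<epsilon> \<Longrightarrow> \<Phi> (t, p') \<in> ball p' (r / 2)"
    using is_flow_near[OF \<Phi>, of "r / 2" p'] r0 by auto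
  define I where "I = {- (\<epsilon> / 2)..\<epsilon> / 2}"
  define z where "z t = \<Phi> (t, p')" for t
  define \<delta> where "\<delta> t = chart_inv c (z t)" for t
  have zI: "z t \<in> ball p' \<tau>" "z t \<in> ?S" "z t \<in> cball p' (r / 2)" "z t \<in> ball p \<epsilon>'" "dist (z t) p < \<epsilon>1"
    if "t \<in> I" for t
  proof -
    have 1: "z t \<in> ball p' (r / 2)" using \<epsilon>(2)[of t] \<epsilon>(1) that by (auto simp: z_def I_def abs_less_iff)
    then show 2: "z t \<in> ball p' \<tau>" "z t \<in> cball p' (r / 2)" using r r0 by auto
    show "z t \<in> ?S" "z t \<in> ball p \<epsilon>'" "dist (z t) p < \<epsilon>1" using ball[OF 2(1)] by auto
  qed
  have \<delta>: "integral_curve A G I \<delta>"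
    unfolding \<delta>_def[abs_def] z_def I_def
    by (rule cutoff_integral_curve[OF A G c co \<Phi>])
      (use zI in \<open>auto simp: I_def z_def is_interval_1\<close>)
  have zder: "(z has_vector_derivative ?g (z s)) (at s within I)" if "s \<in> I" for s
  proof -
    have "Y (z s) = ?g (z s)" using cutoff_inner[OF co] zI[OF that] by blast
    then show ?thesis
      using has_vector_derivative_at_within[OF is_flow_derivative[OF \<Phi>, of p' s]]
      by (simp add: z_def[abs_def])
  qed
  have 0: "0 \<in> I" using \<epsilon>(1) by (simp add: I_def)
  obtain y0 where y0: "orbit A G (\<delta> 0) \<subseteq> orbit A F y0" using orb by blast
  have inorb: "\<delta> s \<in> orbit A F y0" if "s \<in> I" for s
    using reach_between[OF A G \<delta> 0 that] orbit_iff[OF A G] y0 by blast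
  \<comment> \<open>The times for which the \<open>F\<close>-curve from \<open>y0\<close> exists.
    They will be covered by countably many segments, each carrying a compact arc.\<close>
  define D where "D = {d. \<exists>y. reach A F y0 y d}"
  have sub: "closed_segment 0 d \<subseteq> D" if d: "d \<in> D" for d
  proof
    fix e assume e: "e \<in> closed_segment 0 d"
    obtain \<gamma> where \<gamma>: "integral_curve A F (closed_segment 0 d) \<gamma>" "\<gamma> 0 = y0"
      using d unfolding D_def reach_segment by blast
    have "reach A F (\<gamma> 0) (\<gamma> e) (e - 0)" by (rule reach_between[OF A F \<gamma>(1) _ e]) simp
    then show "e \<in> D" using \<gamma>(2) unfolding D_def by auto
  qed
  have "0 \<in> D" using reach_refl[OF A F] unfolding D_def by blast
  moreover have "is_interval D"
    unfolding is_interval_1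
  proof (intro ballI allI impI)
    fix a b x assume "a \<in> D" "b \<in> D" "a \<le> x \<and> x \<le> b"
    then show "x \<in> D" using sub[of a] sub[of b] by (cases "x \<ge> 0") (auto simp: closed_segment_eq_real_ivl)
  qed
  ultimately obtain D0 where D0: "D0 \<subseteq> D" "countable D0" "D \<subseteq> (\<Union>d\<in>D0. closed_segment 0 d)"
    using interval_countable_segments by metis
  have "\<forall>d\<in>D. \<exists>\<gamma>. integral_curve A F (closed_segment 0 d) \<gamma> \<and> \<gamma> 0 = y0"
    unfolding D_def reach_segment by blast
  then obtain \<gamma> where \<gamma>: "\<And>d. d \<in> D \<Longrightarrow> integral_curve A F (closed_segment 0 d) (\<gamma> d)" "\<And>d. d \<in> D \<Longrightarrow> \<gamma> d 0 = y0"
    by metis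
  have c\<gamma>: "continuous_on (closed_segment 0 d) (\<gamma> d)" if "d \<in> D" for d
    using \<gamma>(1)[OF that] by (simp add: integral_curve_def)
  have c\<delta>: "continuous_on I \<delta>" using \<delta> by (simp add: integral_curve_def)
  define C where "C d = {s \<in> I. \<delta> s \<in> \<gamma> d ` closed_segment 0 d}" for d
  have "\<exists>d\<in>D0. \<exists>s\<in>I. \<exists>\<rho>>0. ball s \<rho> \<inter> I \<subseteq> C d"
    unfolding I_def
  proof (rule interval_Baire[OF D0(2)])
    show "- (\<epsilon> / 2) < \<epsilon> / 2" using \<epsilon>(1) by simp
    fix d assume "d \<in> D0"
    then have "compact (\<gamma> d ` closed_segment 0 d)"
      using c\<gamma> D0(1) by (intro compact_continuous_image) auto
    then have "closedin (top_of_set I) (I \<inter> \<delta> -` (\<gamma> d ` closed_segment 0 d))"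
      using c\<delta> by (intro continuous_closedin_preimage compact_imp_closed)
    moreover have "closed I" by (simp add: I_def)
    ultimately have "closed (I \<inter> \<delta> -` (\<gamma> d ` closed_segment 0 d))" using closedin_closed_trans by blast
    moreover have "C d = I \<inter> \<delta> -` (\<gamma> d ` closed_segment 0 d)" by (auto simp: C_def)
    ultimately show "closed (C d)" by simp
  next
    have "s \<in> (\<Union>d\<in>D0. C d)" if s: "s \<in> I" for s
    proof -
      obtain e where e: "reach A F y0 (\<delta> s) e" using inorb[OF s] orbit_iff[OF A F] by blast
      then have "e \<in> D" unfolding D_def by blast
      then obtain d where d: "d \<in> D0" "e \<in> closed_segment 0 d" using D0(3) by blast
      then have dD: "d \<in> D" using D0(1) by blast
      have "reach A F (\<gamma> d 0) (\<gamma> d e) (e - 0)" by (rule reach_between[OF A F \<gamma>(1)[OF dD] _ d(2)]) simp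
      then have "\<gamma> d e = \<delta> s" using reach_unique[OF A F _ e] \<gamma>(2)[OF dD] by simp
      then show ?thesis using s d unfolding C_def by (intro UN_I[OF d(1)]) force
    qed
    then show "{- (\<epsilon> / 2)..\<epsilon> / 2} \<subseteq> (\<Union>d\<in>D0. C d)" unfolding I_def by blast
  qed
  then obtain d s0 \<rho> where d: "d \<in> D0" and s0: "s0 \<in> I" and \<rho>: "\<rho> > 0" "ball s0 \<rho> \<inter> I \<subseteq> C d" by blast
  have dD: "d \<in> D" using d D0(1) by blast
  \<comment> \<open>\<open>s0\<close> may be an end point of \<open>I\<close>, so the sequence
    \<open>s\<close> has to approach it from within \<open>I\<close>.\<close>
  define \<sigma> :: real where "\<sigma> = (if s0 \<le> 0 then 1 else - 1)"
  define m where "m = min \<rho> \<epsilon> / 2"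
  have m: "m > 0" "m < \<rho>" "m \<le> \<epsilon> / 2" using \<rho>(1) \<epsilon>(1) by (auto simp: m_def)
  define s where "s k = s0 + \<sigma> * (m * inverse (real (Suc k)))" for k
  have sk: "s k \<in> I" "s k \<in> ball s0 \<rho>" "s k \<noteq> s0" for k
  proof -
    define v where "v = m * inverse (real (Suc k))"
    have "0 < inverse (real (Suc k))" "inverse (real (Suc k)) \<le> 1" by (auto simp: field_simps)
    then have v: "0 < v" "v \<le> m"
      using m(1) mult_left_mono[of "inverse (real (Suc k))" 1 m] by (auto simp: v_def)
    have sv: "s k = s0 + \<sigma> * v" by (simp add: s_def v_def)
    show "s k \<in> I" using v m s0 by (auto simp: sv \<sigma>_def I_def)
    show "s k \<in> ball s0 \<rho>" using v m by (auto simp: sv \<sigma>_def dist_real_def)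
    show "s k \<noteq> s0" using v by (auto simp: sv \<sigma>_def)
  qed
  have "(\<lambda>k. s0 + \<sigma> * (m * inverse (real (Suc k)))) \<longlonglongrightarrow> s0 + \<sigma> * (m * 0)"
    by (intro tendsto_intros LIMSEQ_inverse_real_of_nat)
  then have slim: "s \<longlonglongrightarrow> s0" by (simp add: s_def[abs_def])
  have "\<forall>k. \<exists>e\<in>closed_segment 0 d. \<delta> (s k) = \<gamma> d e"
    using sk \<rho>(2) unfolding C_def by blast
  then obtain e where e: "\<And>k. e k \<in> closed_segment 0 d" "\<And>k. \<delta> (s k) = \<gamma> d (e k)" by metis
  \<comment> \<open>The parameters \<open>e k\<close> on the arc need not converge, but a
    subsequence does; its limit parametrises the point \<open>\<delta> s0\<close>.\<close>
  have "seq_compact (closed_segment 0 d)" by (simp add: compact_imp_seq_compact)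
  then obtain e0 \<phi> where e0: "e0 \<in> closed_segment 0 d" "strict_mono \<phi>" "(e \<circ> \<phi>) \<longlonglongrightarrow> e0"
    using e(1) unfolding seq_compact_def by metis
  have slim': "(s \<circ> \<phi>) \<longlonglongrightarrow> s0" using slim e0(2) by (rule LIMSEQ_subseq_LIMSEQ)
  have "(\<lambda>k. \<gamma> d ((e \<circ> \<phi>) k)) \<longlonglongrightarrow> \<gamma> d e0"
    by (rule continuous_on_tendsto_compose[OF c\<gamma>[OF dD] e0(3,1)]) (use e in auto)
  moreover have "(\<lambda>k. \<delta> ((s \<circ> \<phi>) k)) \<longlonglongrightarrow> \<delta> s0"
    by (rule continuous_on_tendsto_compose[OF c\<delta> slim' s0]) (use sk in auto)
  ultimately have \<gamma>e0: "\<gamma> d e0 = \<delta> s0" using e(2) by (simp add: LIMSEQ_unique)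
  have in_c: "\<delta> t \<in> fst c" "snd c (\<delta> t) = z t" if "t \<in> I" for t
    using zI(2)[OF that] by (auto simp: \<delta>_def chart_inv_mem chart_chart_inv simp del: image_iff)
  have "((snd c \<circ> \<gamma> d) has_vector_derivative F (\<delta> s0) c) (at e0 within closed_segment 0 d)"
    using \<gamma>(1)[OF dD] e0(1) c in_c[OF s0] \<gamma>e0 unfolding integral_curve_def by metis
  moreover have "F (\<delta> s0) c \<noteq> 0" using f0[of "z s0"] zI[OF s0] by (simp add: \<delta>_def)
  moreover have "\<forall>\<^sub>F k in sequentially. z ((s \<circ> \<phi>) k) = (snd c \<circ> \<gamma> d) ((e \<circ> \<phi>) k)"
    using e(2) in_c(2)[OF sk(1)] by (metis (mono_tags, lifting) always_eventually comp_apply)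
  moreover have "z s0 = (snd c \<circ> \<gamma> d) e0" using \<gamma>e0 in_c[OF s0] by simp
  ultimately have "?g (z s0) = ((?g (z s0) \<bullet> F (\<delta> s0) c) / (F (\<delta> s0) c \<bullet> F (\<delta> s0) c)) *\<^sub>R F (\<delta> s0) c"
    using sk e by (intro tangent_parallel[where \<zeta>="snd c \<circ> \<gamma> d" and J="closed_segment 0 d" and e="e \<circ> \<phi>",
          OF zder[OF s0] _ _ _ _ slim' _ e0(3)]) auto
  then show ?thesis using zI(2,4)[OF s0] by (intro bexI[of _ "z s0"]) (auto simp: \<delta>_def simp del: image_iff)
qed

text \<open>Points where the identity holds accumulate at the given one, and both sides are
  continuous there because \<open>F\<close> does not vanish.\<close>

lemma parallel_chart:
  fixes A :: "('m::{t2_space,second_countable_topology}, 'e::euclidean_space) chart set"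
  assumes M: "smooth_manifold b A" and F: "smooth_vector_field A F" and G: "smooth_vector_field A G"
    and orb: "\<And>x. \<exists>y. orbit A G x \<subseteq> orbit A F y"
    and c: "c \<in> A" "x \<in> fst c" and Fx: "F x c \<noteq> 0"
  shows "G x c = ((G x c \<bullet> F x c) / (F x c \<bullet> F x c)) *\<^sub>R F x c"
proof -
  note A = smooth_manifold_chart_system[OF M]
  let ?S = "snd c ` fst c" and ?f = "\<lambda>y. F (chart_inv c y) c" and ?g = "\<lambda>y. G (chart_inv c y) c"
  define p where "p = snd c x"
  have p: "p \<in> ?S" using c by (simp add: p_def)
  have inv: "chart_inv c p = x" using chart_inv_chart[OF A c] by (simp add: p_def)
  define D where "D y = ?g y - ((?g y \<bullet> ?f y) / (?f y \<bullet> ?f y)) *\<^sub>R ?f y" for y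
  have "\<forall>n. \<exists>q\<in>?S \<inter> ball p (inverse (real (Suc n))). D q = 0"
    using parallel_nearby[OF M F G orb c(1) p] Fx inv unfolding D_def by simp
  then obtain q where "\<forall>n. q n \<in> ?S \<inter> ball p (inverse (real (Suc n))) \<and> D (q n) = 0" by metis
  then have q: "q n \<in> ?S" "dist p (q n) < inverse (real (Suc n))" "D (q n) = 0" for n
    by (blast, simp, blast)
  have qlim: "q \<longlonglongrightarrow> p"
  proof (rule metric_LIMSEQ_I)
    fix r :: real assume "r > 0"
    then obtain N where N: "inverse (real (Suc N)) < r" using reals_Archimedean by blast
    have "dist (q n) p < r" if "n \<ge> N" for n
    proof -
      have "inverse (real (Suc n)) \<le> inverse (real (Suc N))" using that by (intro le_imp_inverse_le) auto
      then show ?thesis using q(2)[of n] N dist_commute[of p "q n"] by linarith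
    qed
    then show "\<exists>N. \<forall>n\<ge>N. dist (q n) p < r" by blast
  qed
  have cont: "continuous_on ?S ?f" "continuous_on ?S ?g"
    using smooth_vector_field_chart[OF F c(1)] smooth_vector_field_chart[OF G c(1)]
    by (auto intro: smooth_on_imp_continuous_on)
  have lim: "(\<lambda>n. ?f (q n)) \<longlonglongrightarrow> ?f p" "(\<lambda>n. ?g (q n)) \<longlonglongrightarrow> ?g p"
    using continuous_on_tendsto_compose[OF cont(1) qlim p] continuous_on_tendsto_compose[OF cont(2) qlim p] q(1)
    by auto
  have "?f p \<bullet> ?f p \<noteq> 0" using Fx inv by simp
  then have "(\<lambda>n. D (q n)) \<longlonglongrightarrow> D p"
    unfolding D_def by (intro tendsto_intros lim)
  then have "D p = 0" using q(3) by (simp add: LIMSEQ_const_iff)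
  then show ?thesis by (simp add: D_def inv)
qed

text \<open>The \<open>F\<close>-orbit through a zero of \<open>F\<close> is a single point, so
  every \<open>G\<close>-curve starting there is constant. At a boundary point this excludes a
  transversal \<open>G\<close>; where \<open>F\<close> does not vanish, \<open>G\<close> is a
  multiple of the tangent field \<open>F\<close>. Once \<open>G\<close> is known to be tangent,
  two-sided \<open>G\<close>-curves exist at every point, and a constant one forces \<open>G\<close>
  to vanish.\<close>

lemma subordinate_field_singular:
  fixes A :: "('m::{t2_space,second_countable_topology}, 'e::euclidean_space) chart set"
  assumes M: "smooth_manifold b A" and F: "smooth_vector_field A F" and G: "smooth_vector_field A G"
    and tan: "chart_tangent b A F" and orb: "\<And>x. \<exists>y. orbit A G x \<subseteq> orbit A F y"
  shows "chart_tangent b A G" and "F x = (\<lambda>c. 0) \<Longrightarrow> G x = (\<lambda>c. 0)"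
proof -
  note A = smooth_manifold_chart_system[OF M]
  have stationary: "\<gamma> t = x" if "F x = (\<lambda>c. 0)" "integral_curve A G J \<gamma>" "0 \<in> J" "t \<in> J" "\<gamma> 0 = x" for x J \<gamma> t
  proof -
    obtain y where y: "orbit A G x \<subseteq> orbit A F y" using orb by blast
    have "x \<in> orbit A G x" using orbit_iff[OF A G] reach_refl[OF A G] by blast
    then have "orbit A F y = {x}" using orbit_singular[OF A F that(1)] y by blast
    moreover have "\<gamma> t \<in> orbit A G x" using that orbit_iff[OF A G] unfolding reach_def by blast
    ultimately show ?thesis using y by blast
  qed
  show tG: "chart_tangent b A G"
    unfolding chart_tangent_def
  proof (intro ballI impI)
    fix c x assume c: "c \<in> A" "x \<in> fst c" and x: "snd c x \<bullet> b = 0"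
    show "G x c \<bullet> b = 0"
    proof (cases "F x c = 0")
      case True
      then have F0: "F x = (\<lambda>c. 0)"
        using tangent_space_chart_zero[OF smooth_vector_field_tangent[OF F] c _ A] by blast
      show ?thesis
      proof (rule ccontr)
        assume "G x c \<bullet> b \<noteq> 0"
        from transversal_integral_curve[OF M G c x this] show False using stationary[OF F0] by blast
      qed
    next
      case False
      have "F x c \<bullet> b = 0" using tan c x unfolding chart_tangent_def by blast
      then show ?thesis by (subst parallel_chart[OF M F G orb c False]) simp
    qed
  qed
  assume F0: "F x = (\<lambda>c. 0)"
  obtain \<epsilon> \<gamma> where \<gamma>: "\<epsilon> > 0" "integral_curve A G {-\<epsilon><..<\<epsilon>} \<gamma>" "\<gamma> 0 = x"
    using local_integral_curve[OF M G tG, of x] by auto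
  then show "G x = (\<lambda>c. 0)"
    using integral_curve_not_constant[OF A G \<gamma>(1,2)] stationary[OF F0 \<gamma>(2)] by simp
qed

section \<open>Continuity of homotopies in the weak Whitney topologies\<close>

lemma Ck_on_partials:
  assumes "\<And>k. Ck_on k U g"
  shows "Ck_on k U (partials UNIV vs g)"
proof (induction vs arbitrary: k)
  case Nil
  then show ?case using assms by simp
next
  case (Cons v vs)
  show ?case using Ck_on_SucD2[OF Cons.IH[of "Suc k"], of v] by simp
qed

text \<open>Each \<open>i\<close> in \<open>Basis\<close> has \<open>i \<bullet> b \<ge> 0\<close>,
  so small positive steps along \<open>i\<close> stay in the half-space, and these directions
  determine a derivative within \<open>S\<close>.\<close>

lemma half_space_unique_derivative:
  assumes b: "b \<in> Basis" and S: "openin (top_of_set (half_space b)) S" and x: "x \<in> S"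
    and "(f has_derivative f') (at x within S)" "(f has_derivative f'') (at x within S)"
  shows "f' = f''"
proof (rule frechet_derivative_unique_within[OF assms(4,5)])
  fix i :: 'a and e :: real assume i: "i \<in> Basis" and "e > 0"
  obtain \<epsilon> where \<epsilon>: "\<epsilon> > 0" "ball x \<epsilon> \<inter> half_space b \<subseteq> S"
    using openin_half_space_ball[OF S x] by blast
  define d where "d = min e \<epsilon> / 2"
  have d: "0 < d" "d < e" "d < \<epsilon>" using \<open>e > 0\<close> \<epsilon>(1) by (auto simp: d_def)
  have "x \<in> half_space b" using S x openin_imp_subset by blast
  moreover have "i \<bullet> b \<ge> 0" using i b by (simp add: inner_Basis)
  ultimately have "x + d *\<^sub>R i \<in> half_space b" using d(1) by (simp add: half_space_def inner_add_left)
  moreover have "x + d *\<^sub>R i \<in> ball x \<epsilon>" using d i by (simp add: dist_norm)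
  ultimately show "\<exists>d. 0 < \<bar>d\<bar> \<and> \<bar>d\<bar> < e \<and> x + d *\<^sub>R i \<in> S"
    using d \<epsilon>(2) by (intro exI[of _ d]) auto
qed

text \<open>Derivatives within \<open>S\<close>, which may have boundary points, are replaced by
  derivatives of one smooth map \<open>g\<close> on an open set of space and time, in directions
  \<open>(v, 0)\<close>. These are jointly continuous in the point and in \<open>t\<close>, as
  continuity of a path in the Whitney topology requires.\<close>

lemma partials_slice:
  fixes g :: "'e::euclidean_space \<times> real \<Rightarrow> 'b::euclidean_space"
  assumes b: "b \<in> Basis" and S: "openin (top_of_set (half_space b)) S"
    and U: "open U" and g: "\<And>k. Ck_on k U g"
    and eq: "\<And>y. y \<in> S \<Longrightarrow> (y, t) \<in> U \<Longrightarrow> \<phi> y = g (y, t)"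
    and "y \<in> S" "(y, t) \<in> U"
  shows "partials S vs \<phi> y = partials UNIV (map (\<lambda>v. (v, 0)) vs) g (y, t)"
  using assms(6,7)
proof (induction vs arbitrary: y)
  case Nil
  then show ?case using eq by simp
next
  case (Cons v vs)
  let ?G = "partials UNIV (map (\<lambda>v. (v, 0)) vs) g"
  let ?D = "frechet_derivative ?G (at (y, t))"
  have "(?G has_derivative ?D) (at (y, t))"
    using Ck_on_has_derivative[OF Ck_on_partials[OF g]] Cons.prems(2) by blast
  moreover have "((\<lambda>y. (y, t)) has_derivative (\<lambda>v. (v, 0))) (at y within S)"
    by (intro has_derivative_Pair has_derivative_ident has_derivative_const)
  ultimately have d: "((\<lambda>y. ?G (y, t)) has_derivative (\<lambda>v. ?D (v, 0))) (at y within S)"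
    using has_derivative_compose[of "\<lambda>y. (y, t)" _ y S ?G ?D] by simp
  have "open ((\<lambda>y. (y, t)) -` U)"
    using U by (intro open_vimage continuous_intros)
  then have "\<forall>\<^sub>F y' in at y within S. y' \<in> (\<lambda>y. (y, t)) -` U"
    using Cons.prems(2) unfolding eventually_at_topological by blast
  moreover have "\<forall>\<^sub>F y' in at y within S. y' \<in> S"
    by (simp add: eventually_at_filter)
  ultimately have "\<forall>\<^sub>F y' in at y within S. ?G (y', t) = partials S vs \<phi> y'"
    by eventually_elim (simp add: Cons.IH)
  then have d': "(partials S vs \<phi> has_derivative (\<lambda>v. ?D (v, 0))) (at y within S)"
    by (intro has_derivative_transform_eventually[OF d]) (use Cons in auto)
  then have "(partials S vs \<phi> has_derivative frechet_derivative (partials S vs \<phi>) (at y within S)) (at y within S)"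
    unfolding frechet_derivative_works[symmetric] differentiable_def by blast
  from half_space_unique_derivative[OF b S Cons.prems(1) this d'] show ?case by simp
qed

section \<open>Charts of the cylinder and time slices\<close>

lemma cylinder_atlas_mem: "c \<in> A \<Longrightarrow> (fst c \<times> UNIV, map_prod (snd c) id) \<in> cylinder_atlas A"
  by (simp add: cylinder_atlas_def)

abbreviation cyl :: "('m, 'e) chart \<Rightarrow> ('m \<times> real, 'e \<times> real) chart" where
  "cyl c \<equiv> (fst c \<times> UNIV, map_prod (snd c) id)"

lemma cyl_local_rep:
  assumes A: "chart_system A" and c: "c \<in> A" and y: "y \<in> snd c ` fst c"
  shows "local_rep (cyl c) d h (y, t) = snd d (h (chart_inv c y, t))"
proof -
  have "inj_on (snd c) (fst c)" using chart_inj[OF A c] by (auto intro: inj_onI)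
  then show ?thesis by (simp add: local_rep_def cylinder_chart_inv[OF _ y])
qed

lemma smooth_map_slice:
  assumes A: "chart_system A" and B: "chart_system B" and H: "smooth_map (cylinder_atlas A) B (V \<times> T) H"
    and t: "t \<in> T"
  shows "smooth_map A B V (\<lambda>x. H (x, t))"
  unfolding smooth_map_def
proof (intro conjI ballI)
  have "continuous_on (V \<times> T) H" using H by (simp add: smooth_map_def)
  then show "continuous_on V (\<lambda>x. H (x, t))"
    by (rule continuous_on_compose2) (use t in \<open>auto intro!: continuous_intros\<close>)
  fix c d assume c: "c \<in> A" and d: "d \<in> B"
  let ?S = "snd c ` {x \<in> fst c \<inter> V. H (x, t) \<in> fst d}"
  let ?S' = "snd (cyl c) ` {p \<in> fst (cyl c) \<inter> V \<times> T. H p \<in> fst d}"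
  have s1: "smooth_on ?S (\<lambda>y. (y, t))" by (intro smooth_on_Pair smooth_on_id smooth_on_const)
  have "smooth_on ?S (\<lambda>y. local_rep (cyl c) d H (y, t))"
  proof (rule smooth_on_compose[OF s1 smooth_mapD[OF H cylinder_atlas_mem[OF c] d]], rule image_subsetI)
    fix y assume "y \<in> ?S"
    then obtain x where "y = snd c x" "x \<in> fst c" "x \<in> V" "H (x, t) \<in> fst d" by auto
    then show "(y, t) \<in> ?S'" using t by (intro image_eqI[of _ _ "(x, t)"]) auto
  qed
  then show "smooth_on ?S (local_rep c d (\<lambda>x. H (x, t)))"
  proof (rule smooth_on_cong)
    fix y assume "y \<in> ?S"
    then have "y \<in> snd c ` fst c" by auto
    from cyl_local_rep[OF A c this, of d H t]
    show "local_rep (cyl c) d H (y, t) = local_rep c d (\<lambda>x. H (x, t)) y"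
      by (simp add: local_rep_def[of c d])
  qed
qed

text \<open>\<open>T\<close> is relatively open in \<open>S\<close>, so after shrinking the
  neighbourhood all its points in \<open>S\<close> belong to \<open>T\<close>.\<close>

lemma smooth_on_openD:
  assumes "smooth_on T f" "p \<in> T" "T = S \<inter> N" "open N"
  shows "\<exists>U g. open U \<and> p \<in> U \<and> (\<forall>k. Ck_on k U g) \<and> (\<forall>q\<in>S \<inter> U. q \<in> T \<and> g q = f q)"
proof -
  obtain U g where "open U" "p \<in> U" "\<forall>k. Ck_on k U g" "\<forall>q\<in>T \<inter> U. g q = f q"
    using assms(1,2) unfolding smooth_on_def by meson
  then show ?thesis
    using assms by (intro exI[of _ "U \<inter> N"] exI[of _ g]) (auto intro: Ck_on_subset)
qed

text \<open>At one point of \<open>K\<close> a subbasic condition involves finitely many partial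
  derivatives, which are jointly continuous in point and time. It persists for nearby points and
  times, and finitely many such neighbourhoods cover \<open>K\<close>.\<close>

theorem continuous_map_whitney_topology:
  fixes A :: "('m::{t2_space,second_countable_topology}, 'e::euclidean_space) chart set"
  assumes M: "smooth_manifold b A" and V: "open V" and H: "smooth_map (cylinder_atlas A) A (V \<times> UNIV) H"
  shows "continuous_map euclideanreal (whitney_topology A r V) (\<lambda>t. \<lambda>x\<in>V. H (x, t))"
proof -
  note A = smooth_manifold_chart_system[OF M]
  have b: "b \<in> Basis" using M by (simp add: smooth_manifold_def)
  define h where "h t = (\<lambda>x\<in>V. H (x, t))" for t
  have h: "h t \<in> smooth_maps A A V" for t
  proof -
    have "smooth_map A A V (h t)"
      by (rule smooth_map_cong[OF smooth_map_slice[OF A A H UNIV_I[of t]] _ A]) (simp add: h_def)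
    then show ?thesis by (simp add: smooth_maps_def h_def)
  qed
  have cH: "continuous_on (V \<times> UNIV) H" using H by (simp add: smooth_map_def)
  \<comment> \<open>The condition of \<open>whitney_nbhd\<close> at a single point; its centre
    \<open>f\<close> may lie off the path.\<close>
  define close where "close f c d L \<epsilon> t x \<longleftrightarrow> h t x \<in> fst d \<and>
      (\<forall>vs\<in>L. norm (partials (snd c ` (fst c \<inter> V)) vs (local_rep c d f) (snd c x)
        - partials (snd c ` (fst c \<inter> V)) vs (local_rep c d (h t)) (snd c x)) < \<epsilon>)"
    for f :: "'m \<Rightarrow> 'm" and c d :: "('m, 'e) chart" and L \<epsilon> t x
  have local: "\<exists>N \<delta>. open N \<and> x0 \<in> N \<and> \<delta> > 0 \<and>
      (\<forall>x\<in>N \<inter> fst c \<inter> V. \<forall>t. \<bar>t - t0\<bar> < \<delta> \<longrightarrow> close f c d L \<epsilon> t x)"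
    if f: "f \<in> smooth_maps A A V" and c: "c \<in> A" and d: "d \<in> A" and x0: "x0 \<in> fst c" "x0 \<in> V"
      and fx0: "f x0 \<in> fst d" and L: "finite L" and P: "close f c d L \<epsilon> t0 x0"
    for f c d x0 t0 L \<epsilon>
  proof -
    have hx0: "h t0 x0 \<in> fst d" using P by (simp add: close_def)
    define S where "S = snd c ` (fst c \<inter> V)"
    obtain N0 where N0: "open N0" "S = snd c ` fst c \<inter> N0"
      using chart_image_open[OF A c V] unfolding S_def by blast
    have S: "openin (top_of_set (half_space b)) S"
      unfolding N0(2) using chart_image_half_space(1)[OF M c] N0(1) openin_Int_open by blast
    have x0S: "snd c x0 \<in> S" using x0 by (auto simp: S_def)
    let ?Tf = "snd c ` {x \<in> fst c \<inter> V. f x \<in> fst d}"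
    have sf: "smooth_on ?Tf (local_rep c d f)" and cf: "continuous_on V f"
      using f c d unfolding smooth_maps_def smooth_map_def by blast+
    have "open (V \<inter> f -` fst d)" using cf V chart_open[OF A d] by (intro continuous_open_preimage)
    then obtain N1 where N1: "open N1" "snd c ` (fst c \<inter> (V \<inter> f -` fst d)) = snd c ` fst c \<inter> N1"
      using chart_image_open[OF A c] by blast
    have Tf: "?Tf = snd c ` fst c \<inter> N1" unfolding N1(2)[symmetric] by (rule arg_cong[of _ _ "image (snd c)"]) auto
    have "snd c x0 \<in> ?Tf" using x0 fx0 by auto
    from smooth_on_openD[OF sf this Tf N1(1)] obtain Uf gf where Uf: "open Uf" "snd c x0 \<in> Uf"
      and gf: "\<forall>k. Ck_on k Uf gf" "\<forall>q\<in>snd c ` fst c \<inter> Uf. q \<in> ?Tf \<and> gf q = local_rep c d f q" by blast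
    let ?TH = "snd (cyl c) ` {p \<in> fst (cyl c) \<inter> V \<times> UNIV. H p \<in> fst d}"
    have sH: "smooth_on ?TH (local_rep (cyl c) d H)"
      by (rule smooth_mapD[OF H cylinder_atlas_mem[OF c] d])
    have "open (V \<times> UNIV \<inter> H -` fst d)"
      using cH V chart_open[OF A d] by (intro continuous_open_preimage open_Times) auto
    then obtain N2 where N2: "open N2"
      "snd (cyl c) ` (fst (cyl c) \<inter> (V \<times> UNIV \<inter> H -` fst d)) = snd (cyl c) ` fst (cyl c) \<inter> N2"
      using chart_image_open[OF chart_system_cylinder[OF A] cylinder_atlas_mem[OF c]] by blast
    have TH: "?TH = snd (cyl c) ` fst (cyl c) \<inter> N2"
      unfolding N2(2)[symmetric] by (rule arg_cong[of _ _ "image (snd (cyl c))"]) auto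
    have "(snd c x0, t0) \<in> ?TH"
      by (rule image_eqI[of _ _ "(x0, t0)"]) (use x0 hx0 in \<open>auto simp: h_def\<close>)
    from smooth_on_openD[OF sH this TH N2(1)] obtain U g where U: "open U" "(snd c x0, t0) \<in> U"
      and g: "\<forall>k. Ck_on k U g"
        "\<forall>q\<in>snd (cyl c) ` fst (cyl c) \<inter> U. q \<in> ?TH \<and> g q = local_rep (cyl c) d H q" by blast
    have inTH: "H (x, t) \<in> fst d" if "(snd c x, t) \<in> ?TH" "x \<in> fst c" for x t
    proof -
      obtain x' where x': "snd c x = snd c x'" "x' \<in> fst c" "H (x', t) \<in> fst d" using \<open>(snd c x, t) \<in> ?TH\<close> by auto
      then have "x = x'" using chart_inj[OF A c \<open>x \<in> fst c\<close>] by blast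
      then show ?thesis using x' by simp
    qed
    have cylmem: "(y, t) \<in> snd (cyl c) ` fst (cyl c)" if "y \<in> S" for y t
      using that by (auto simp: S_def intro!: image_eqI[of _ _ "(_, t)"])
    define U' where "U' = U \<inter> Uf \<times> UNIV"
    have U': "open U'" "(snd c x0, t0) \<in> U'" using U Uf by (auto simp: U'_def open_Times)
    have pf: "partials S vs (local_rep c d f) y = partials UNIV (map (\<lambda>v. (v, 0)) vs) (\<lambda>z. gf (fst z)) (y, t)"
      if "y \<in> S" "(y, t) \<in> U'" for vs y t
    proof (rule partials_slice[OF b S, of "Uf \<times> UNIV"])
      show "open (Uf \<times> (UNIV :: real set))" using Uf by (intro open_Times) auto
      then show "Ck_on k (Uf \<times> UNIV) (\<lambda>z :: 'e \<times> real. gf (fst z))" for k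
        using gf(1) by (intro Ck_on_compose[OF _ Ck_on_fst]) auto
      show "local_rep c d f y = gf (fst (y, t))" if "y \<in> S" "(y, t) \<in> Uf \<times> UNIV" for y
        using that gf(2) N0(2) by auto
    qed (use that in \<open>auto simp: U'_def\<close>)
    have ph: "partials S vs (local_rep c d (h t)) y = partials UNIV (map (\<lambda>v. (v, 0)) vs) g (y, t)"
      if "y \<in> S" "(y, t) \<in> U'" for vs y t
    proof (rule partials_slice[OF b S U(1)])
      show "local_rep c d (h t) y = g (y, t)" if y: "y \<in> S" "(y, t) \<in> U" for y
      proof -
        have "y \<in> snd c ` fst c" using y N0 by auto
        moreover have "g (y, t) = local_rep (cyl c) d H (y, t)"
          using g(2) y(2) cylmem[OF y(1)] by blast
        ultimately have "g (y, t) = snd d (H (chart_inv c y, t))"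
          using cyl_local_rep[OF A c] by simp
        moreover have "chart_inv c y \<in> V" using y(1) chart_inv_chart[OF A c] by (auto simp: S_def)
        ultimately show ?thesis by (simp add: local_rep_def h_def)
      qed
    qed (use that g in \<open>auto simp: U'_def\<close>)
    \<comment> \<open>The discrepancy of the partial derivatives, written with the extensions
      \<open>gf\<close> and \<open>g\<close> so that it is continuous on the open set
      \<open>U'\<close>.\<close>
    define Q where "Q vs z = norm (partials UNIV (map (\<lambda>v. (v, 0)) vs) (\<lambda>z. gf (fst z)) z
        - partials UNIV (map (\<lambda>v. (v, 0)) vs) g z)" for vs z
    have "continuous_on U' (Q vs)" for vs
    proof -
      have "Ck_on k (Uf \<times> UNIV) (\<lambda>z::'e \<times> real. gf (fst z))" for k
        using gf(1) Uf by (intro Ck_on_compose[OF _ Ck_on_fst] open_Times) auto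
      from Ck_on_partials[OF this] have "continuous_on U' (partials UNIV (map (\<lambda>v. (v, 0)) vs) (\<lambda>z. gf (fst z)))"
        using Ck_on_imp_continuous_on continuous_on_subset by (metis U'_def inf_le2)
      moreover have "continuous_on U' (partials UNIV (map (\<lambda>v. (v, 0)) vs) g)"
        using Ck_on_partials[of U g 0] g(1) continuous_on_subset[of U _ U'] by (auto simp: U'_def)
      ultimately show ?thesis unfolding Q_def[abs_def] by (intro continuous_intros)
    qed
    then have "open (U' \<inter> Q vs -` {..<\<epsilon>})" for vs
      using U'(1) by (intro continuous_open_preimage) auto
    then have "open (U' \<inter> (\<Inter>vs\<in>L. U' \<inter> Q vs -` {..<\<epsilon>}))"
      using L U'(1) by (intro open_Int open_INT) auto
    moreover have "(snd c x0, t0) \<in> U' \<inter> (\<Inter>vs\<in>L. U' \<inter> Q vs -` {..<\<epsilon>})"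
      using P U'(2) pf[OF x0S U'(2)] ph[OF x0S U'(2)] by (simp add: Q_def S_def close_def)
    ultimately obtain A1 B1 where AB: "open A1" "open B1" "(snd c x0, t0) \<in> A1 \<times> B1"
      "A1 \<times> B1 \<subseteq> U' \<inter> (\<Inter>vs\<in>L. U' \<inter> Q vs -` {..<\<epsilon>})"
      by (rule open_prod_elim)
    obtain N where N: "open N" "fst c \<inter> snd c -` A1 = fst c \<inter> N"
      using continuous_openin_preimage_gen[OF chart_continuous[OF A c] AB(1)] unfolding openin_open by auto
    have "t0 \<in> B1" using AB(3) by simp
    then obtain \<delta> where \<delta>: "\<delta> > 0" "ball t0 \<delta> \<subseteq> B1" using AB(2) openE by blast
    have "close f c d L \<epsilon> t x"
      if x: "x \<in> N \<inter> fst c \<inter> V" and t: "\<bar>t - t0\<bar> < \<delta>" for x t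
    proof -
      have xS: "snd c x \<in> S" using x by (auto simp: S_def)
      have "x \<in> fst c \<inter> snd c -` A1" using x N(2) by blast
      moreover have "t \<in> B1" using t \<delta>(2) by (auto simp: dist_real_def)
      ultimately have "(snd c x, t) \<in> A1 \<times> B1" by simp
      then have "(snd c x, t) \<in> U' \<inter> (\<Inter>vs\<in>L. U' \<inter> Q vs -` {..<\<epsilon>})" using AB(4) by blast
      then have z: "(snd c x, t) \<in> U'" and "\<forall>vs\<in>L. (snd c x, t) \<in> Q vs -` {..<\<epsilon>}" by blast+
      then have zQ: "\<forall>vs\<in>L. Q vs (snd c x, t) < \<epsilon>" by simp
      have "(snd c x, t) \<in> ?TH" using g(2) z cylmem[OF xS] unfolding U'_def by blast
      then have "h t x \<in> fst d" using inTH x by (simp add: h_def)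
      then show ?thesis using zQ pf[OF xS z] ph[OF xS z] by (simp add: Q_def S_def close_def)
    qed
    moreover have "x0 \<in> N" using N(2) AB(3) x0(1) by auto
    ultimately show ?thesis using N(1) \<delta>(1) by blast
  qed
  have opn: "open {t. h t \<in> whitney_nbhd A V f c d K m \<epsilon>}"
    if f: "f \<in> smooth_maps A A V" and c: "c \<in> A" and d: "d \<in> A" and K: "compact K" "K \<subseteq> fst c \<inter> V" "f ` K \<subseteq> fst d"
    for f c d K m \<epsilon>
    unfolding open_dist
  proof
    fix t0 assume t0: "t0 \<in> {t. h t \<in> whitney_nbhd A V f c d K m \<epsilon>}"
    define L :: "'e list set" where "L = {vs. set vs \<subseteq> Basis \<and> length vs \<le> m}"
    have L: "finite L" unfolding L_def by (intro finite_lists_length_le) simp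
    let ?P = "close f c d L \<epsilon>"
    have nb: "h t \<in> whitney_nbhd A V f c d K m \<epsilon> \<longleftrightarrow> (\<forall>x\<in>K. ?P t x)" for t
      using h unfolding whitney_nbhd_def close_def L_def by blast
    have "\<exists>N \<delta>. open N \<and> x \<in> N \<and> \<delta> > 0 \<and> (\<forall>x\<in>N \<inter> K. \<forall>t. \<bar>t - t0\<bar> < \<delta> \<longrightarrow> ?P t x)" if x: "x \<in> K" for x
    proof -
      have P: "?P t0 x" using t0 nb x by blast
      have x': "x \<in> fst c" "x \<in> V" "f x \<in> fst d" using x K by auto
      from local[OF f c d x' L P] obtain N \<delta> where "open N \<and> x \<in> N \<and> \<delta> > 0 \<and>
        (\<forall>x\<in>N \<inter> fst c \<inter> V. \<forall>t. \<bar>t - t0\<bar> < \<delta> \<longrightarrow> ?P t x)" by (elim exE)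
      moreover have "N \<inter> K \<subseteq> N \<inter> fst c \<inter> V" using K(2) by blast
      ultimately show ?thesis by (intro exI[of _ N] exI[of _ \<delta>]) (simp add: subset_iff)
    qed
    then obtain N \<delta> where N: "\<And>x. x \<in> K \<Longrightarrow> open (N x) \<and> x \<in> N x \<and> \<delta> x > (0::real) \<and>
        (\<forall>y\<in>N x \<inter> K. \<forall>t. \<bar>t - t0\<bar> < \<delta> x \<longrightarrow> ?P t y)" by metis
    obtain C where C: "C \<subseteq> K" "finite C" "K \<subseteq> (\<Union>x\<in>C. N x)"
      by (rule compactE_image[OF K(1), of K N]) (use N in blast)+
    define e where "e = Min (insert 1 (\<delta> ` C))"
    have e: "e > 0" "\<And>x. x \<in> C \<Longrightarrow> e \<le> \<delta> x"
      using C N unfolding e_def by (auto simp: subset_iff)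
    have "?P t x" if x: "x \<in> K" and t: "\<bar>t - t0\<bar> < e" for x t
    proof -
      obtain y where y: "y \<in> C" "x \<in> N y" using C(3) x by blast
      then have "\<bar>t - t0\<bar> < \<delta> y" using e(2)[OF y(1)] t by linarith
      then show ?thesis using N[of y] y C(1) x by blast
    qed
    then show "\<exists>e>0. \<forall>t. dist t t0 < e \<longrightarrow> t \<in> {t. h t \<in> whitney_nbhd A V f c d K m \<epsilon>}"
      using e(1) nb by (auto simp: dist_real_def)
  qed
  have "continuous_map euclideanreal (whitney_topology A r V) h"
    unfolding whitney_topology_def continuous_on_generated_topo_iff
  proof (intro conjI allI impI)
    fix W assume "W \<in> {whitney_nbhd A V f c d K m \<epsilon> | f c d K m \<epsilon>.
        f \<in> smooth_maps A A V \<and> c \<in> A \<and> d \<in> A \<and> compact K \<and> K \<subseteq> fst c \<inter> V \<and>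
        f ` K \<subseteq> fst d \<and> enat m \<le> r \<and> 0 < \<epsilon>}"
    then obtain f c d K m \<epsilon> where "W = whitney_nbhd A V f c d K m \<epsilon>" "f \<in> smooth_maps A A V" "c \<in> A" "d \<in> A"
      "compact K" "K \<subseteq> fst c \<inter> V" "f ` K \<subseteq> fst d" by blast
    with opn[of f c d K m \<epsilon>] show "openin euclideanreal (h -` W \<inter> topspace euclideanreal)"
      by (simp add: vimage_def)
  next
    obtain c where c: "c \<in> A" using chart_cover[OF A] by blast
    \<comment> \<open>With \<open>K\<close> empty the neighbourhood is the whole function space;
      this shows that the path stays in the underlying set of the topology.\<close>
    have "h t \<in> whitney_nbhd A V (h 0) c c {} 0 1" for t using h by (simp add: whitney_nbhd_def)
    moreover have "enat 0 \<le> r" by (simp add: zero_enat_def[symmetric])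
    ultimately show "h ` topspace euclideanreal \<subseteq> \<Union> {whitney_nbhd A V f c d K m \<epsilon> | f c d K m \<epsilon>.
        f \<in> smooth_maps A A V \<and> c \<in> A \<and> d \<in> A \<and> compact K \<and> K \<subseteq> fst c \<inter> V \<and>
        f ` K \<subseteq> fst d \<and> enat m \<le> r \<and> 0 < \<epsilon>}"
      using h[of 0] c by (intro image_subsetI UnionI[of "whitney_nbhd A V (h 0) c c {} 0 1"])
        (blast intro: compact_empty zero_less_one)+
  qed
  then show ?thesis by (simp add: h_def[abs_def])
qed

section \<open>The homotopy along a subordinate field\<close>

lemma smooth_mapI_local:
  fixes A :: "('m::topological_space, 'e::euclidean_space) chart set"
    and B :: "('n::topological_space, 'f::euclidean_space) chart set"
  assumes A: "chart_system A" and B: "chart_system B"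
    and loc: "\<And>x. x \<in> W \<Longrightarrow> \<exists>V. open V \<and> x \<in> V \<and> continuous_on (W \<inter> V) h \<and> (\<exists>c0\<in>A. \<exists>d0\<in>B. x \<in> fst c0 \<and> h x \<in> fst d0 \<and>
      smooth_on (snd c0 ` {y \<in> fst c0 \<inter> W \<inter> V. h y \<in> fst d0}) (local_rep c0 d0 h))"
  shows "smooth_map A B W h"
proof (rule smooth_mapI[OF A B])
  show "continuous_on W h"
    unfolding continuous_on_def
  proof
    fix x assume x: "x \<in> W"
    then obtain V where V: "open V" "x \<in> V" "continuous_on (W \<inter> V) h" using loc by blast
    have "at x within W = at x within W \<inter> V" by (rule at_within_nhd[OF V(2,1)]) auto
    then show "(h \<longlongrightarrow> h x) (at x within W)"
      using V x unfolding continuous_on_def by simp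
  qed
  fix x assume "x \<in> W"
  from loc[OF this] show "\<exists>V c0 d0. open V \<and> x \<in> V \<and> c0 \<in> A \<and> d0 \<in> B \<and> x \<in> fst c0 \<and> h x \<in> fst d0 \<and>
      smooth_on (snd c0 ` {y \<in> fst c0 \<inter> W \<inter> V. h y \<in> fst d0}) (local_rep c0 d0 h)"
    by blast
qed

text \<open>\<open>XF\<close> extends \<open>F\<close> near \<open>p\<close> in the chart \<open>c\<close>, and \<open>Y\<close> is the cut-off of \<open>G\<close>, with flow \<open>\<Phi>\<close>.\<close>

locale subordinate_flow =
  fixes b :: "'e::euclidean_space"
    and A :: "('m::{t2_space,second_countable_topology}, 'e) chart set"
    and F G :: "('m, 'e) vector_field" and V :: "'m set" and c :: "('m, 'e) chart" and p :: 'e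
    and rF r :: real and XF Y :: "'e \<Rightarrow> 'e" and hF h :: "'e \<Rightarrow> real" and \<Phi> :: "real \<times> 'e \<Rightarrow> 'e"
  assumes M: "smooth_manifold b A" and F: "smooth_vector_field A F" and G: "smooth_vector_field A G"
    and tanF: "chart_tangent b A F" and tanG: "chart_tangent b A G"
    and sing: "\<And>x. F x = (\<lambda>c. 0) \<Longrightarrow> G x = (\<lambda>c. 0)"
    and par: "\<And>c x. c \<in> A \<Longrightarrow> x \<in> fst c \<Longrightarrow> F x c \<noteq> 0 \<Longrightarrow>
      G x c = ((G x c \<bullet> F x c) / (F x c \<bullet> F x c)) *\<^sub>R F x c"
    and V: "open V" and c: "c \<in> A"
    and coF: "cutoff (snd c ` fst c) (\<lambda>y. F (chart_inv c y) c) p rF XF hF"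
    and co: "cutoff (snd c ` fst c) (\<lambda>y. G (chart_inv c y) c) p r Y h"
    and r: "r \<le> rF / 2" and sub: "cball p r \<inter> half_space b \<subseteq> snd c ` (fst c \<inter> V)"
    and \<Phi>: "is_flow Y \<Phi>"
begin

lemmas A = smooth_manifold_chart_system[OF M]

abbreviation S :: "'e set" where "S \<equiv> snd c ` fst c"

lemma in_half_space: "y \<in> S \<Longrightarrow> y \<in> half_space b"
  using chart_image_half_space(2)[OF M c] by blast

section \<open>The cut-off flow in the chart\<close>

lemma flow_add: "\<Phi> (s, \<Phi> (t, q)) = \<Phi> (s + t, q)"
  and flow_fixed: "Y q = 0 \<Longrightarrow> \<Phi> (t, q) = q"
proof -
  obtain L where L: "L \<ge> 0" "\<And>x y. norm (Y x - Y y) \<le> L * norm (x - y)"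
    using cutoff_lipschitz[OF co] by blast
  show "\<Phi> (s, \<Phi> (t, q)) = \<Phi> (s + t, q)" by (rule is_flow_add[OF L \<Phi>])
  show "Y q = 0 \<Longrightarrow> \<Phi> (t, q) = q" by (rule is_flow_fixed[OF L \<Phi>])
qed

lemma flow_fixed_back:
  assumes "Y (\<Phi> (t, q)) = 0"
  shows "\<Phi> (t, q) = q"
  using flow_fixed[OF assms, of "- t"] flow_add[of "- t" t q] is_flow_zero[OF \<Phi>] by simp

lemma flow_outside: "q \<notin> ball p r \<Longrightarrow> \<Phi> (t, q) = q"
  using flow_fixed cutoff_outside(1)[OF co] by blast

text \<open>\<open>Y\<close> vanishes outside the ball, and a trajectory that reaches a zero of
  \<open>Y\<close> has been there all the time; so a point of the ball cannot leave it. Tangency of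
  \<open>G\<close> keeps it in the half-space.\<close>

lemma flow_inside:
  assumes "q \<in> ball p r" "q \<in> S"
  shows "\<Phi> (t, q) \<in> ball p r \<inter> half_space b"
proof
  show "\<Phi> (t, q) \<in> ball p r"
    using flow_fixed_back[of t q] cutoff_outside(1)[OF co] assms(1) by metis
  show "\<Phi> (t, q) \<in> half_space b"
  proof (rule cutoff_flow_half_space[OF co _ _ \<Phi> _ in_half_space[OF assms(2)]])
    show "ball p r \<inter> half_space b \<subseteq> S" using sub ball_subset_cball by blast
    show "b \<in> Basis" using M by (simp add: smooth_manifold_def)
    fix y assume "y \<in> S" "y \<bullet> b = 0"
    then show "G (chart_inv c y) c \<bullet> b = 0"
      using tanG c chart_inv_mem[of y c] chart_chart_inv[of y c] unfolding chart_tangent_def by metis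
  qed
qed

lemma flow_S: "q \<in> S \<Longrightarrow> \<Phi> (t, q) \<in> S"
  using flow_inside[of q t] flow_outside[of q t] sub ball_subset_cball by (cases "q \<in> ball p r") blast+

section \<open>Transport of the cut-off flow to the manifold\<close>

definition H :: "'m \<times> real \<Rightarrow> 'm" where
  "H z = (if fst z \<in> fst c then chart_inv c (\<Phi> (snd z, snd c (fst z))) else fst z)"

lemma H_chart: "x \<in> fst c \<Longrightarrow> H (x, t) \<in> fst c" "x \<in> fst c \<Longrightarrow> snd c (H (x, t)) = \<Phi> (t, snd c x)"
  using flow_S[of "snd c x" t] by (auto simp: H_def chart_inv_mem chart_chart_inv simp del: image_iff)

lemma H_zero: "H (x, 0) = x"
  using is_flow_zero[OF \<Phi>] chart_inv_chart[OF A c] by (simp add: H_def)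

lemma H_add: "H (H (x, t), s) = H (x, s + t)"
proof (cases "x \<in> fst c")
  case True
  then show ?thesis
    using H_chart[OF True, of t] flow_add[of s t "snd c x"] by (simp add: H_def)
qed (simp add: H_def)

lemma H_fixed: "x \<in> fst c \<Longrightarrow> snd c x \<notin> ball p r \<Longrightarrow> H (x, t) = x"
  using flow_outside chart_inv_chart[OF A c] by (simp add: H_def)

lemma H_V:
  assumes "x \<in> V"
  shows "H (x, t) \<in> V"
proof (cases "x \<in> fst c \<and> snd c x \<in> ball p r")
  case True
  then have "\<Phi> (t, snd c x) \<in> snd c ` (fst c \<inter> V)"
    using flow_inside[of "snd c x" t] sub ball_subset_cball by blast
  then obtain y where "y \<in> fst c" "y \<in> V" "snd c y = snd c (H (x, t))"
    using H_chart(2) True by auto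
  then show ?thesis using chart_inj[OF A c] H_chart(1) True by metis
next
  case False
  then show ?thesis using H_fixed assms by (cases "x \<in> fst c") (auto simp: H_def)
qed

lemma H_singular: "F x = (\<lambda>c. 0) \<Longrightarrow> H (x, t) = x"
proof (cases "x \<in> fst c")
  case True
  assume "F x = (\<lambda>c. 0)"
  then have "Y (snd c x) = 0"
    using sing cutoff_eq[OF co, of "snd c x"] chart_inv_chart[OF A c True] True by simp
  then show ?thesis using flow_fixed chart_inv_chart[OF A c True] True by (simp add: H_def)
qed (simp add: H_def)

lemma H_nonsingular:
  assumes "F x \<noteq> (\<lambda>c. 0)"
  shows "F (H (x, t)) \<noteq> (\<lambda>c. 0)"
proof
  assume "F (H (x, t)) = (\<lambda>c. 0)"
  then have "H (H (x, t), - t) = H (x, t)" by (rule H_singular)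
  then have "x = H (x, t)" using H_add[of x t "- t"] H_zero by simp
  then show False using \<open>F (H (x, t)) = _\<close> assms by simp
qed

text \<open>A compact set outside which \<open>H\<close> is the identity. It is closed since the
  space is Hausdorff, so the chart domain and the complement of \<open>K\<close> form an open cover
  on which smoothness can be checked.\<close>

definition K :: "'m set" where "K = chart_inv c ` (cball p r \<inter> half_space b)"

lemma open_K: "open (- K)"
proof -
  have "closed (half_space b)"
    unfolding half_space_def by (rule closed_Collect_le) (auto intro!: continuous_intros)
  then have "compact (cball p r \<inter> half_space b)" by (intro compact_Int_closed) auto
  moreover have "continuous_on (cball p r \<inter> half_space b) (chart_inv c)"
    by (rule continuous_on_subset[OF chart_inv_continuous[OF A c]]) (use sub in blast)
  ultimately show ?thesis
    unfolding K_def by (intro open_Compl compact_imp_closed compact_continuous_image)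
qed

lemma not_K: "x \<notin> K \<Longrightarrow> x \<in> fst c \<Longrightarrow> snd c x \<notin> cball p r"
  using in_half_space[of "snd c x"] chart_inv_chart[OF A c] unfolding K_def by (metis IntI imageI)

lemma K_subset: "K \<subseteq> fst c"
  using sub chart_inv_mem[of _ c] unfolding K_def by blast

lemma H_not_K: "x \<notin> K \<Longrightarrow> H (x, t) = x"
  using not_K[of x] H_fixed[of x t] by (cases "x \<in> fst c") (simp, simp add: H_def)

lemma smooth_map_H: "smooth_map (cylinder_atlas A) A UNIV H"
proof (rule smooth_mapI_local[OF chart_system_cylinder[OF A] A])
  fix z :: "'m \<times> real"
  obtain x t where z: "z = (x, t)" by (cases z)
  have c\<Phi>: "continuous_on UNIV \<Phi>" by (rule is_flow_continuous[OF \<Phi>])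
  show "\<exists>W. open W \<and> z \<in> W \<and> continuous_on (UNIV \<inter> W) H \<and> (\<exists>c0\<in>cylinder_atlas A. \<exists>d0\<in>A. z \<in> fst c0 \<and> H z \<in> fst d0 \<and>
      smooth_on (snd c0 ` {y \<in> fst c0 \<inter> UNIV \<inter> W. H y \<in> fst d0}) (local_rep c0 d0 H))"
  proof (cases "x \<in> fst c")
    case True
    have "continuous_on (fst c \<times> UNIV) (\<lambda>z. chart_inv c (\<Phi> (snd z, snd c (fst z))))"
      by (intro continuous_on_compose2[OF chart_inv_continuous[OF A c]] continuous_on_compose2[OF c\<Phi>]
          continuous_intros continuous_on_compose2[OF chart_continuous[OF A c]])
        (auto simp: flow_S)
    then have "continuous_on (fst c \<times> UNIV) H"
      by (rule continuous_on_eq) (auto simp: H_def)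
    moreover have "smooth_on (snd (cyl c) ` {y \<in> fst (cyl c) \<inter> UNIV \<inter> fst c \<times> UNIV. H y \<in> fst c}) (local_rep (cyl c) c H)"
    proof (rule smooth_on_cong)
      show "smooth_on (snd (cyl c) ` {y \<in> fst (cyl c) \<inter> UNIV \<inter> fst c \<times> UNIV. H y \<in> fst c}) (\<lambda>z. \<Phi> (snd z, fst z))"
        by (intro smooth_onI_Ck[OF open_UNIV subset_UNIV] Ck_on_compose[OF _ _ is_flow_Ck[OF \<Phi>]])
          (auto intro!: Ck_on_intros)
      fix q assume "q \<in> snd (cyl c) ` {y \<in> fst (cyl c) \<inter> UNIV \<inter> fst c \<times> UNIV. H y \<in> fst c}"
      then obtain x' t' where q: "q = (snd c x', t')" "x' \<in> fst c" by auto
      then have "local_rep (cyl c) c H q = snd c (H (chart_inv c (snd c x'), t'))"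
        using cyl_local_rep[OF A c, of "snd c x'" c H t'] by simp
      then show "\<Phi> (snd q, fst q) = local_rep (cyl c) c H q"
        using q H_chart(2) chart_inv_chart[OF A c] by simp
    qed
    ultimately show ?thesis
      using True H_chart(1) c cylinder_atlas_mem[OF c] chart_open[OF A c]
      by (intro exI[of _ "fst c \<times> UNIV"] conjI bexI[of _ "cyl c"] bexI[of _ c]) (auto simp: z open_Times)
  next
    case False
    then have xK: "x \<notin> K" using K_subset by blast
    obtain d where d: "d \<in> A" "x \<in> fst d" using chart_cover[OF A] by blast
    have "continuous_on ((- K) \<times> UNIV) (fst :: 'm \<times> real \<Rightarrow> 'm)" by (intro continuous_intros)
    then have "continuous_on ((- K) \<times> UNIV) H"
      by (rule continuous_on_eq) (auto simp: H_not_K)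
    moreover have "smooth_on (snd (cyl d) ` {y \<in> fst (cyl d) \<inter> UNIV \<inter> (- K) \<times> UNIV. H y \<in> fst d}) (local_rep (cyl d) d H)"
    proof (rule smooth_on_cong[OF smooth_on_fst])
      fix q assume "q \<in> snd (cyl d) ` {y \<in> fst (cyl d) \<inter> UNIV \<inter> (- K) \<times> UNIV. H y \<in> fst d}"
      then obtain x' t' where q: "q = (snd d x', t')" "x' \<in> fst d" "x' \<notin> K" by auto
      then have "local_rep (cyl d) d H q = snd d (H (chart_inv d (snd d x'), t'))"
        using cyl_local_rep[OF A d(1), of "snd d x'" d H t'] by simp
      then show "fst q = local_rep (cyl d) d H q"
        using q H_not_K chart_inv_chart[OF A d(1)] by simp
    qed
    ultimately show ?thesis
      using False xK d cylinder_atlas_mem[OF d(1)] open_K H_not_K[OF xK]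
      by (intro exI[of _ "(- K) \<times> UNIV"] conjI bexI[of _ "cyl d"] bexI[of _ d]) (auto simp: z open_Times)
  qed
qed

text \<open>The quotient of \<open>Y\<close> by \<open>F\<close>.  Division by zero makes it 0 where \<open>XF\<close> vanishes; it is smooth only
  on \<open>N\<close>, since there \<open>XF \<noteq> 0\<close> or \<open>Y = 0\<close> locally.\<close>

definition factor :: "'e \<Rightarrow> real" where "factor y = (Y y \<bullet> XF y) / (XF y \<bullet> XF y)"

definition N :: "'e set" where "N = {y. XF y \<noteq> 0} \<union> - cball p r"

lemma open_N: "open N"
proof -
  have "open {y. XF y \<noteq> 0}"
    using Ck_on_imp_continuous_on[OF cutoff_Ck[OF coF]] by (intro open_Collect_neq continuous_intros)
  then show ?thesis unfolding N_def by (intro open_Un) auto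
qed

lemma Ck_on_factor: "Ck_on k N factor"
proof (rule Ck_on_local)
  fix y assume "y \<in> N"
  then consider "XF y \<noteq> 0" | "y \<notin> cball p r" by (auto simp: N_def)
  then show "\<exists>U. open U \<and> y \<in> U \<and> Ck_on k U factor"
  proof cases
    case 1
    have o: "open {y. XF y \<noteq> 0}"
      using Ck_on_imp_continuous_on[OF cutoff_Ck[OF coF]] by (intro open_Collect_neq continuous_intros)
    have "Ck_on k {y. XF y \<noteq> 0} (\<lambda>y. (Y y \<bullet> XF y) / (XF y \<bullet> XF y))"
      by (intro Ck_on_divide Ck_on_inner o Ck_on_subset[OF cutoff_Ck[OF co]] Ck_on_subset[OF cutoff_Ck[OF coF]]) auto
    then show ?thesis using 1 o unfolding factor_def[abs_def] by blast
  next
    case 2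
    have "Ck_on k (- cball p r) factor"
    proof (rule Ck_on_cong[OF _ _ Ck_on_const[of _ _ 0]])
      show "0 = factor y" if "y \<in> - cball p r" for y
        using cutoff_outside(1)[OF co, of y] that by (auto simp: factor_def)
    qed auto
    then show ?thesis using 2 by (intro exI[of _ "- cball p r"]) auto
  qed
qed

lemma XF_eq: "y \<in> S \<Longrightarrow> y \<in> cball p r \<Longrightarrow> XF y = F (chart_inv c y) c"
  using cutoff_inner[OF coF, of y] r by auto

lemma F_chart_nonzero: "x \<in> fst c \<Longrightarrow> F x \<noteq> (\<lambda>c. 0) \<Longrightarrow> F x c \<noteq> 0"
  using tangent_space_chart_zero[OF smooth_vector_field_tangent[OF F] c _ _ A] by blast

text \<open>A nonsingular trajectory never meets a zero of \<open>F\<close>, and inside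
  \<open>cball p r\<close> the extension \<open>XF\<close> coincides with \<open>F\<close>;
  everything outside that ball belongs to \<open>N\<close>.\<close>

lemma flow_N:
  assumes "x \<in> fst c" "F x \<noteq> (\<lambda>c. 0)"
  shows "\<Phi> (t, snd c x) \<in> N"
proof (cases "\<Phi> (t, snd c x) \<in> cball p r")
  case True
  have "\<Phi> (t, snd c x) \<in> S" using flow_S assms(1) by blast
  then have "XF (\<Phi> (t, snd c x)) = F (H (x, t)) c"
    using XF_eq[OF _ True] assms(1) by (simp add: H_def)
  then show ?thesis
    using F_chart_nonzero[OF H_chart(1)[OF assms(1)] H_nonsingular[OF assms(2)]] by (simp add: N_def)
qed (simp add: N_def)

lemma factor_eq:
  assumes "y \<in> S" "F (chart_inv c y) \<noteq> (\<lambda>c. 0)"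
  shows "factor y = h y * ((G (chart_inv c y) c \<bullet> F (chart_inv c y) c) / (F (chart_inv c y) c \<bullet> F (chart_inv c y) c))"
    and "Y y = factor y *\<^sub>R F (chart_inv c y) c"
proof -
  let ?x = "chart_inv c y"
  show *: "factor y = h y * ((G ?x c \<bullet> F ?x c) / (F ?x c \<bullet> F ?x c))"
  proof (cases "y \<in> cball p r")
    case True
    then show ?thesis using XF_eq[OF assms(1)] cutoff_eq[OF co assms(1)] by (simp add: factor_def)
  next
    case False
    then have "Y y = 0" "h y = 0" using cutoff_outside[OF co, of y] by auto
    then show ?thesis by (simp add: factor_def)
  qed
  define q where "q = (G ?x c \<bullet> F ?x c) / (F ?x c \<bullet> F ?x c)"
  have "F ?x c \<noteq> 0" using F_chart_nonzero[OF chart_inv_mem[OF assms(1)] assms(2)] .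
  then have "G ?x c = q *\<^sub>R F ?x c"
    unfolding q_def by (rule par[OF c chart_inv_mem[OF assms(1)]])
  then show "Y y = factor y *\<^sub>R F ?x c"
    using cutoff_eq[OF co assms(1)] unfolding * q_def[symmetric] by simp
qed

text \<open>The integral of the weight \<open>factor\<close> along the trajectory from time 0 to
  \<open>snd z\<close>, rescaled to \<open>{0..1}\<close>. Outside the chart the homotopy is
  stationary, whence the value 0.\<close>

definition \<Lambda> :: "'m \<times> real \<Rightarrow> real" where
  "\<Lambda> z = (if fst z \<in> fst c then snd z * integral {0..1} (\<lambda>s. factor (\<Phi> (snd z * s, snd c (fst z)))) else 0)"

lemma continuous_factor_flow:
  assumes "x \<in> fst c" "F x \<noteq> (\<lambda>c. 0)"
  shows "continuous_on UNIV (\<lambda>s. factor (\<Phi> (s, snd c x)))"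
  by (intro continuous_on_compose2[OF Ck_on_imp_continuous_on[OF Ck_on_factor]]
      continuous_on_compose2[OF is_flow_continuous[OF \<Phi>]] continuous_intros) (auto simp: flow_N[OF assms])

lemma \<Lambda>_derivative:
  assumes "x \<in> fst c" "F x \<noteq> (\<lambda>c. 0)"
  shows "((\<lambda>t. \<Lambda> (x, t)) has_real_derivative factor (\<Phi> (t, snd c x))) (at t)"
  using scaled_integral_has_vector_derivative[OF continuous_factor_flow[OF assms], of t] assms(1)
  by (simp add: \<Lambda>_def has_real_derivative_iff_has_vector_derivative)

text \<open>In the chart the trajectory is a weighted \<open>F\<close>-curve with weight
  \<open>factor\<close>, and \<open>\<Lambda>\<close> is the primitive of this weight along
  it.\<close>

lemma H_reach:
  assumes "F x \<noteq> (\<lambda>c. 0)"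
  shows "reach A F x (H (x, t)) (\<Lambda> (x, t))"
proof (cases "x \<in> fst c")
  case True
  have "weighted_curve A F (\<lambda>s. factor (\<Phi> (s, snd c x))) UNIV (chart_inv c \<circ> (\<lambda>s. \<Phi> (s, snd c x)))"
  proof (rule weighted_curve_of_chart[OF A smooth_vector_field_tangent[OF F] c is_interval_univ])
    fix s
    show S: "\<Phi> (s, snd c x) \<in> S" using flow_S True by blast
    have "F (chart_inv c (\<Phi> (s, snd c x))) \<noteq> (\<lambda>c. 0)"
      using H_nonsingular[OF assms, of s] True by (simp add: H_def)
    from factor_eq(2)[OF S this] is_flow_derivative[OF \<Phi>, of "snd c x" s]
    show "((\<lambda>s. \<Phi> (s, snd c x)) has_vector_derivative
        factor (\<Phi> (s, snd c x)) *\<^sub>R F (chart_inv c (\<Phi> (s, snd c x))) c) (at s)"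
      by simp
  qed
  moreover have "chart_inv c \<circ> (\<lambda>s. \<Phi> (s, snd c x)) = (\<lambda>s. H (x, s))" using True by (simp add: H_def fun_eq_iff)
  ultimately have "weighted_curve A F (\<lambda>s. factor (\<Phi> (s, snd c x))) UNIV (\<lambda>s. H (x, s))" by simp
  from weighted_curve_reach[OF M F tanF this continuous_factor_flow[OF True assms] \<Lambda>_derivative[OF True assms], of 0 t]
  moreover have "\<Lambda> (x, 0) = 0" by (simp add: \<Lambda>_def)
  ultimately show ?thesis by (simp add: H_zero)
next
  case False
  then show ?thesis using reach_refl[OF A F] by (simp add: H_def \<Lambda>_def)
qed

lemma smooth_map_\<Lambda>: "smooth_map (cylinder_atlas A) euclidean_atlas ((V - singular_set F) \<times> {0..1}) \<Lambda>"
proof (rule smooth_mapI_local[OF chart_system_cylinder[OF A] chart_system_euclidean])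
  fix z assume z': "z \<in> (V - singular_set F) \<times> {0..1::real}"
  let ?W = "(V - singular_set F) \<times> {0..1::real}"
  obtain x t where z: "z = (x, t)" by (cases z)
  have e: "(UNIV, id) \<in> (euclidean_atlas :: (real, real) chart set)" by (simp add: euclidean_atlas_def)
  show "\<exists>W. open W \<and> z \<in> W \<and> continuous_on (?W \<inter> W) \<Lambda> \<and>
      (\<exists>c0\<in>cylinder_atlas A. \<exists>d0\<in>euclidean_atlas. z \<in> fst c0 \<and> \<Lambda> z \<in> fst d0 \<and>
      smooth_on (snd c0 ` {y \<in> fst c0 \<inter> ?W \<inter> W. \<Lambda> y \<in> fst d0}) (local_rep c0 d0 \<Lambda>))"
  proof (cases "x \<in> fst c")
    case True
    define l' where "l' w = snd w * integral {0..1} (\<lambda>s. factor (\<Phi> (snd w * s, fst w)))" for w :: "'e \<times> real"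
    define T where "T = snd c ` (fst c - singular_set F) \<times> (UNIV :: real set)"
    have sm: "smooth_on T l'"
      unfolding smooth_on_def
    proof
      fix w assume "w \<in> T"
      then obtain x' t' where w: "w = (snd c x', t')" "x' \<in> fst c" "F x' \<noteq> (\<lambda>c. 0)"
        by (auto simp: T_def singular_set_def)
      let ?q = "\<lambda>z :: real \<times> 'e \<times> real. \<Phi> (snd (snd z) * fst z, fst (snd z))"
      have q: "Ck_on k UNIV ?q" for k
        by (rule Ck_on_compose[OF _ _ is_flow_Ck[OF \<Phi>]])
          (auto intro!: Ck_on_Pair Ck_on_mult Ck_on_fst Ck_on_snd Ck_on_compose[OF _ Ck_on_snd Ck_on_snd]
            Ck_on_compose[OF _ Ck_on_snd Ck_on_fst])
      define N' where "N' = ?q -` N"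
      have "open N'"
        unfolding N'_def using continuous_open_preimage[OF Ck_on_imp_continuous_on[OF q] open_UNIV open_N] by simp
      then have o: "open ((\<lambda>z. (snd z, fst z)) -` N')"
        by (intro open_vimage continuous_intros)
      \<comment> \<open>The whole piece of trajectory belonging to \<open>w\<close> lies in
        \<open>N\<close>, where \<open>factor\<close> is smooth. The tube lemma makes this uniform
        near \<open>w\<close>, so that one can differentiate under the integral.\<close>
      have "{w} \<times> {0..1} \<subseteq> (\<lambda>z. (snd z, fst z)) -` N'"
        using flow_N[OF w(2,3)] by (auto simp: N'_def w)
      from Elementary_Topology.tube_lemma[OF compact_Icc o this]
      obtain Z where Z: "w \<in> Z" "open Z" "Z \<times> {0..1} \<subseteq> (\<lambda>z. (snd z, fst z)) -` N'" by blast
      have "Ck_on k N' (\<lambda>z. factor (?q z))" for k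
        by (rule Ck_on_compose[OF \<open>open N'\<close> Ck_on_subset[OF q subset_UNIV] Ck_on_factor]) (auto simp: N'_def)
      moreover have "{0..1} \<times> Z \<subseteq> N'" using Z(3) by auto
      ultimately have "Ck_on k Z (\<lambda>w. integral {0..1} (\<lambda>s. factor (?q (s, w))))" for k
        using Z(2) by (intro Ck_on_integral)
      then have "Ck_on k Z l'" for k
        unfolding l'_def[abs_def] using Z(2) by (intro Ck_on_mult Ck_on_snd) auto
      then show "\<exists>U g. open U \<and> w \<in> U \<and> (\<forall>k. Ck_on k U g) \<and> (\<forall>q\<in>T \<inter> U. g q = l' q)" using Z by blast
    qed
    have "continuous_on (?W \<inter> fst c \<times> UNIV) (\<lambda>z. l' (snd c (fst z), snd z))"
      by (intro continuous_on_compose2[OF smooth_on_imp_continuous_on[OF sm]] continuous_intros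
          continuous_on_compose2[OF chart_continuous[OF A c]]) (auto simp: T_def)
    then have "continuous_on (?W \<inter> fst c \<times> UNIV) \<Lambda>"
      by (rule continuous_on_eq) (auto simp: \<Lambda>_def l'_def)
    moreover have "smooth_on (snd (cyl c) ` {y \<in> fst (cyl c) \<inter> ?W \<inter> fst c \<times> UNIV. \<Lambda> y \<in> fst (UNIV, id :: real \<Rightarrow> real)})
        (local_rep (cyl c) (UNIV, id) \<Lambda>)" (is "smooth_on ?T _")
    proof (rule smooth_on_cong[OF smooth_on_subset[OF sm]])
      show "?T \<subseteq> T" by (auto simp: T_def)
      fix q assume "q \<in> ?T"
      then obtain x' t' where q: "q = (snd c x', t')" "x' \<in> fst c" by auto
      then have "local_rep (cyl c) (UNIV, id) \<Lambda> q = \<Lambda> (x', t')"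
        using cyl_local_rep[OF A c, of "snd c x'" "(UNIV, id)" \<Lambda> t'] chart_inv_chart[OF A c] by simp
      then show "l' q = local_rep (cyl c) (UNIV, id) \<Lambda> q" using q by (simp add: \<Lambda>_def l'_def)
    qed
    ultimately show ?thesis
      using True cylinder_atlas_mem[OF c] chart_open[OF A c] e
      by (intro exI[of _ "fst c \<times> UNIV"] conjI bexI[of _ "cyl c"] bexI[of _ "(UNIV, id)"]) (auto simp: z open_Times)
  next
    case False
    then have xK: "x \<notin> K" using K_subset by blast
    have \<Lambda>0: "\<Lambda> (x', t') = 0" if "x' \<notin> K" for x' t'
    proof (cases "x' \<in> fst c")
      case True
      then have n: "snd c x' \<notin> ball p r" using not_K[OF that] by auto
      then have "Y (snd c x') = 0" by (rule cutoff_outside(1)[OF co])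
      then show ?thesis using flow_outside[OF n] by (simp add: \<Lambda>_def factor_def)
    qed (simp add: \<Lambda>_def)
    obtain d where d: "d \<in> A" "x \<in> fst d" using chart_cover[OF A] by blast
    have "continuous_on (?W \<inter> (- K) \<times> UNIV) \<Lambda>"
      by (rule continuous_on_eq[OF continuous_on_const[of _ 0]]) (auto simp: \<Lambda>0)
    moreover have "smooth_on (snd (cyl d) ` {y \<in> fst (cyl d) \<inter> ?W \<inter> (- K) \<times> UNIV. \<Lambda> y \<in> fst (UNIV, id :: real \<Rightarrow> real)})
        (local_rep (cyl d) (UNIV, id) \<Lambda>)" (is "smooth_on ?T _")
    proof (rule smooth_on_cong[OF smooth_on_const[of _ 0]])
      fix q assume "q \<in> ?T"
      then obtain x' t' where q: "q = (snd d x', t')" "x' \<in> fst d" "x' \<notin> K" by auto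
      then show "0 = local_rep (cyl d) (UNIV, id) \<Lambda> q"
        using cyl_local_rep[OF A d(1), of "snd d x'" "(UNIV, id)" \<Lambda> t'] chart_inv_chart[OF A d(1)] \<Lambda>0 by simp
    qed
    ultimately show ?thesis
      using xK d cylinder_atlas_mem[OF d(1)] open_K e
      by (intro exI[of _ "(- K) \<times> UNIV"] conjI bexI[of _ "cyl d"] bexI[of _ "(UNIV, id)"]) (auto simp: z open_Times)
  qed
qed

text \<open>Time \<open>- t\<close> gives a smooth inverse and \<open>H\<close> maps
  \<open>V\<close> onto itself, so \<open>V\<close> serves as the neighbourhood for the local
  diffeomorphism at every point. Orbits are preserved because \<open>H\<close> fixes the zeros of
  \<open>F\<close> and moves every other point along its \<open>F\<close>-curve.\<close>

lemma H_mem_\<E>: "(\<lambda>x\<in>V. H (x, t)) \<in> \<E> A F V"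
proof -
  have sm: "smooth_map A A V (\<lambda>x\<in>V. H (x, t))" for t
  proof (rule smooth_map_cong[OF smooth_map_slice[OF A A _ UNIV_I[of t]] _ A])
    show "smooth_map (cylinder_atlas A) A (V \<times> UNIV) H"
      by (rule smooth_map_subset[OF smooth_map_H]) simp
  qed simp
  have orb: "H (y, t) \<in> orbit A F x" if y: "y \<in> orbit A F x" for x y
  proof (cases "F y = (\<lambda>c. 0)")
    case True
    then show ?thesis using H_singular y by simp
  next
    case False
    obtain d where "reach A F x y d" using y orbit_iff[OF A F] by blast
    from reach_trans[OF A F this H_reach[OF False, of t]] show ?thesis using orbit_iff[OF A F] by blast
  qed
  let ?h = "\<lambda>x\<in>V. H (x, t)"
  have inv: "H (H (x, t), - t) = x" "H (H (x, - t), t) = x" for x using H_add[of x] H_zero by auto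
  have inj: "inj_on ?h V"
    by (rule inj_onI) (metis inv(1) restrict_apply')
  have im: "?h ` V = V"
  proof
    show "?h ` V \<subseteq> V" using H_V by auto
    show "V \<subseteq> ?h ` V"
    proof
      fix x assume x: "x \<in> V"
      then show "x \<in> ?h ` V" using H_V[OF x, of "- t"] inv(2)[of x] by (intro image_eqI[of _ _ "H (x, - t)"]) auto
    qed
  qed
  have "smooth_map A A V (inv_into V ?h)"
  proof (rule smooth_map_cong[OF sm[of "- t"] _ A])
    fix x assume x: "x \<in> V"
    have "inv_into V ?h x = H (x, - t)"
      by (rule inv_into_f_eq[OF inj H_V[OF x]]) (use H_V[OF x, of "- t"] inv(2)[of x] in simp)
    then show "(\<lambda>x\<in>V. H (x, - t)) x = inv_into V ?h x" using x by simp
  qed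
  then have "local_diffeo_at A V ?h z" if "z \<in> V" for z
    unfolding local_diffeo_at_def using V that inj im sm[of t] by (intro exI[of _ V]) (simp add: im)
  moreover have "?h \<in> smooth_maps A A V" using sm[of t] by (simp add: smooth_maps_def)
  ultimately show ?thesis using orb unfolding \<E>_def by auto
qed

lemma H_mem_\<E>_id: "(\<lambda>x\<in>V. H (x, t)) \<in> \<E>_id A F V \<infinity>"
proof -
  have "smooth_map (cylinder_atlas A) A (V \<times> UNIV) H"
    by (rule smooth_map_subset[OF smooth_map_H]) simp
  note cm = continuous_map_whitney_topology[OF M V this, of \<infinity>]
  have "continuous_map (top_of_set {0..1}) euclideanreal (\<lambda>s. t * s)"
    by (auto intro!: continuous_intros)
  from continuous_map_compose[OF this cm]
  have "continuous_map (top_of_set {0..1}) (whitney_topology A \<infinity> V) (\<lambda>s. \<lambda>x\<in>V. H (x, t * s))"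
    by (simp add: o_def)
  then have "pathin (subtopology (whitney_topology A \<infinity> V) (\<E> A F V)) (\<lambda>s. \<lambda>x\<in>V. H (x, t * s))"
    unfolding pathin_def continuous_map_in_subtopology using H_mem_\<E> by blast
  moreover have "(\<lambda>x\<in>V. H (x, t * 0)) = restrict id V" by (simp add: H_zero restrict_def fun_eq_iff)
  ultimately show ?thesis
    unfolding \<E>_id_def path_component_of_def by (auto intro!: exI[of _ "\<lambda>s. \<lambda>x\<in>V. H (x, t * s)"])
qed

lemma zero_shift: "(\<lambda>x\<in>V. 0) \<in> shift_functions A F V" "shift_map A F V (\<lambda>x\<in>V. 0) = restrict id V"
proof -
  have "smooth_map A euclidean_atlas V (\<lambda>x\<in>V. 0 :: real)"
  proof (rule smooth_map_cong[OF _ _ A])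
    show "smooth_map A euclidean_atlas V (\<lambda>x. 0 :: real)"
      unfolding smooth_map_def
    proof (intro conjI ballI continuous_on_const)
      fix c :: "('m, 'e) chart" and d assume "d \<in> (euclidean_atlas :: (real, real) chart set)"
      then have "local_rep c d (\<lambda>x :: 'm. 0) = (\<lambda>y. 0)" by (simp add: euclidean_atlas_def local_rep_def fun_eq_iff)
      then show "smooth_on (snd c ` {x \<in> fst c \<inter> V. (0::real) \<in> fst d}) (local_rep c d (\<lambda>x. 0))"
        by (simp add: smooth_on_const)
    qed
  qed simp
  then have "(\<lambda>x\<in>V. 0 :: real) \<in> smooth_maps A euclidean_atlas V" by (simp add: smooth_maps_def)
  moreover have "0 \<in> max_interval A F x" for x using max_interval_iff[OF A F] reach_refl[OF A F] by blast
  ultimately show "(\<lambda>x\<in>V. 0) \<in> shift_functions A F V" by (simp add: shift_functions_def flow_domain_def)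
  show "shift_map A F V (\<lambda>x\<in>V. 0) = restrict id V"
    using flow_eqI[OF A F reach_refl[OF A F]] by (simp add: shift_map_def restrict_def fun_eq_iff)
qed

section \<open>Application of the path-lifting condition\<close>

lemma shift_lift_\<Lambda>: "shift_lift A F V (\<lambda>x\<in>V. 0) H \<Lambda>"
  unfolding shift_lift_def
proof (intro conjI ballI smooth_map_\<Lambda>)
  show "\<Lambda> (x, 0) = (\<lambda>x\<in>V. 0) x" if "x \<in> V - singular_set F" for x using that by (simp add: \<Lambda>_def)
  fix x t assume "x \<in> V - singular_set F"
  then have "F x \<noteq> (\<lambda>c. 0)" by (simp add: singular_set_def)
  note reach = H_reach[OF this, of t]
  show "(x, \<Lambda> (x, t)) \<in> flow_domain A F"
    using reach max_interval_iff[OF A F] unfolding flow_domain_def by blast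
  show "H (x, t) = flow A F x (\<Lambda> (x, t))" using flow_eqI[OF A F reach] by simp
qed

theorem smooth_quotient:
  assumes Sh: "Sh A F V = \<E>_id A F V \<infinity>" and lift: "smooth_path_lifting A F V"
  shows "\<exists>\<Lambda>'. smooth_map (cylinder_atlas A) euclidean_atlas (V \<times> {0..1}) \<Lambda>' \<and>
    (\<forall>q\<in>(V - singular_set F) \<times> {0..1}. \<Lambda>' q = \<Lambda> q)"
proof -
  have "smooth_map (cylinder_atlas A) A (V \<times> {0..1}) H"
    by (rule smooth_map_subset[OF smooth_map_H]) simp
  moreover have "(\<lambda>x\<in>V. H (x, 0)) = shift_map A F V (\<lambda>x\<in>V. 0)"
    unfolding zero_shift(2) by (simp add: H_zero restrict_def fun_eq_iff)
  moreover have "\<forall>t\<in>{0..1}. (\<lambda>x\<in>V. H (x, t)) \<in> Sh A F V" using H_mem_\<E>_id Sh by simp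
  ultimately show ?thesis
    using lift zero_shift(1) shift_lift_\<Lambda> unfolding smooth_path_lifting_def by blast
qed

end

context subordinate_flow
begin

text \<open>The quotient is the time derivative at 0 of a smooth extension \<open>g\<close> of the
  lift; the path-lifting condition provides \<open>g\<close> also across zeros of \<open>F\<close>.
  At a nonsingular point this derivative is \<open>factor\<close>, which near \<open>p\<close> is
  the quotient of \<open>G\<close> by \<open>F\<close>, as the bump function is 1 there.\<close>

lemma quotient_extension:
  assumes Sh: "Sh A F V = \<E>_id A F V \<infinity>" and lift: "smooth_path_lifting A F V" and p: "p \<in> S"
  shows "\<exists>U a. open U \<and> p \<in> U \<and> (\<forall>k. Ck_on k U a) \<and>
    (\<forall>x\<in>fst c. snd c x \<in> U \<longrightarrow> F x \<noteq> (\<lambda>c. 0) \<longrightarrow> G x = (\<lambda>d. a (snd c x) *\<^sub>R F x d))"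
proof -
  obtain \<Lambda>' where sm: "smooth_map (cylinder_atlas A) euclidean_atlas (V \<times> {0..1}) \<Lambda>'"
    and eq: "\<And>x t. x \<in> V \<Longrightarrow> F x \<noteq> (\<lambda>c. 0) \<Longrightarrow> t \<in> {0..1} \<Longrightarrow> \<Lambda>' (x, t) = \<Lambda> (x, t)"
    using smooth_quotient[OF Sh lift] unfolding singular_set_def by auto
  let ?T = "snd (cyl c) ` {q \<in> fst (cyl c) \<inter> V \<times> {0..1}. \<Lambda>' q \<in> fst (UNIV, id :: real \<Rightarrow> real)}"
  have s: "smooth_on ?T (local_rep (cyl c) (UNIV, id) \<Lambda>')"
    by (rule smooth_mapD[OF sm cylinder_atlas_mem[OF c]]) (simp add: euclidean_atlas_def)
  have r0: "r > 0" by (rule cutoff_pos[OF co])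
  have T: "(y, t) \<in> ?T" if "y \<in> S" "y \<in> cball p r" "t \<in> {0..1}" for y t
  proof -
    have "y \<in> snd c ` (fst c \<inter> V)" using that sub in_half_space by blast
    then obtain x where "y = snd c x" "x \<in> fst c" "x \<in> V" by auto
    then show ?thesis using that(3) by (intro image_eqI[of _ _ "(x, t)"]) auto
  qed
  have "(p, 0) \<in> ?T" using T[OF p] r0 by simp
  then obtain U0 g where U0: "open U0" "(p, 0) \<in> U0" and g: "\<And>k. Ck_on k U0 g"
    and geq: "\<And>q. q \<in> ?T \<inter> U0 \<Longrightarrow> g q = local_rep (cyl c) (UNIV, id) \<Lambda>' q"
    using s unfolding smooth_on_def by meson
  \<comment> \<open>Within radius \<open>r / 2\<close> the cut-off field \<open>Y\<close> still
    coincides with \<open>G\<close>.\<close>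
  define U where "U = (\<lambda>y. (y, 0)) -` U0 \<inter> ball p (r / 2)"
  define a where "a y = frechet_derivative g (at (y, 0)) (0, 1)" for y
  have "open ((\<lambda>y. (y, 0 :: real)) -` U0)" using U0(1) by (intro open_vimage continuous_intros)
  then have "open U" unfolding U_def by auto
  moreover have "p \<in> U" using U0(2) r0 by (simp add: U_def)
  moreover have "Ck_on k U a" for k
    unfolding a_def[abs_def]
    by (rule Ck_on_compose[OF \<open>open U\<close> _ Ck_on_SucD2[OF g]])
      (auto simp: U_def intro!: Ck_on_linear bounded_linear_intros)
  moreover have "G x = (\<lambda>d. a (snd c x) *\<^sub>R F x d)"
    if x: "x \<in> fst c" "snd c x \<in> U" "F x \<noteq> (\<lambda>c. 0)" for x
  proof -
    define y where "y = snd c x"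
    have y: "y \<in> S" "(y, 0) \<in> U0" "y \<in> cball p (r / 2)" "chart_inv c y = x"
      using x chart_inv_chart[OF A c] by (auto simp: y_def U_def)
    then have yr: "y \<in> cball p r" using r0 by auto
    have xV: "x \<in> V"
    proof -
      have "y \<in> snd c ` (fst c \<inter> V)" using y(1) yr sub in_half_space by blast
      then obtain x' where "snd c x = snd c x'" "x' \<in> fst c" "x' \<in> V" by (auto simp: y_def)
      then show ?thesis using chart_inj[OF A c x(1)] by metis
    qed
    have "open ((\<lambda>t. (y, t)) -` U0)" using U0(1) by (intro open_vimage continuous_intros)
    then obtain \<epsilon> where \<epsilon>: "\<epsilon> > 0" "ball 0 \<epsilon> \<subseteq> (\<lambda>t. (y, t)) -` U0"
      using y(2) openE[of "(\<lambda>t. (y, t)) -` U0" 0] by auto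
    define \<tau> where "\<tau> = min 1 (\<epsilon> / 2)"
    have \<tau>: "\<tau> > 0" "\<tau> \<le> 1" "\<tau> < \<epsilon>" using \<epsilon>(1) by (auto simp: \<tau>_def)
    \<comment> \<open>\<open>\<Lambda>'\<close> is known for times in \<open>{0..1}\<close>, so
      \<open>g\<close> agrees with \<open>\<Lambda>\<close> on the right of 0, and one-sided
      derivatives are compared.\<close>
    have g\<Lambda>: "g (y, t) = \<Lambda> (x, t)" if t: "t \<in> {0..\<tau>}" for t
    proof -
      have t1: "t \<in> {0..1}" using t \<tau> by auto
      have "t \<in> ball 0 \<epsilon>" using t \<tau> by (simp add: dist_real_def)
      then have "(y, t) \<in> U0" using \<epsilon>(2) by blast
      then have "g (y, t) = local_rep (cyl c) (UNIV, id) \<Lambda>' (y, t)"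
        using geq T[OF y(1) yr t1] by blast
      then show ?thesis using cyl_local_rep[OF A c y(1), of "(UNIV, id)" \<Lambda>' t] y(4) eq[OF xV x(3) t1] by simp
    qed
    have dg: "((\<lambda>t. g (y, t)) has_vector_derivative a y) (at 0 within {0..\<tau>})"
    proof -
      let ?D = "frechet_derivative g (at (y, 0))"
      have D: "(g has_derivative ?D) (at (y, 0))" using Ck_on_has_derivative[OF g y(2)] .
      have "?D (0, s) = s *\<^sub>R a y" for s
        using linear_scale[OF has_derivative_linear[OF D], of s "(0, 1)"] by (simp add: a_def)
      then show ?thesis
        using has_derivative_Pair_right[OF D, of "{0..\<tau>}"] by (simp add: has_vector_derivative_def)
    qed
    have "((\<lambda>t. \<Lambda> (x, t)) has_vector_derivative a y) (at 0 within {0..\<tau>})"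
      by (rule has_vector_derivative_transform[OF _ _ dg]) (use \<tau> g\<Lambda> in auto)
    moreover have "((\<lambda>t. \<Lambda> (x, t)) has_vector_derivative factor y) (at 0 within {0..\<tau>})"
      using \<Lambda>_derivative[OF x(1,3), of 0] is_flow_zero[OF \<Phi>]
      unfolding has_real_derivative_iff_has_vector_derivative
      by (simp add: y_def has_vector_derivative_at_within)
    moreover have "at 0 within {0..\<tau>} \<noteq> bot" using \<tau>(1) by (simp add: at_within_Icc_at_right)
    ultimately have "a y = factor y" by (intro vector_derivative_unique_within)
    moreover have "Y y = G x c" using cutoff_inner[OF co y(1,3)] y(4) by simp
    moreover have "Y y = factor y *\<^sub>R F x c" using factor_eq(2)[OF y(1)] x(3) y(4) by simp
    ultimately have "G x c = a (snd c x) *\<^sub>R F x c" by (simp add: y_def)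
    then show ?thesis
      by (rule tangent_space_chart_scale[OF smooth_vector_field_tangent[OF G] smooth_vector_field_tangent[OF F] c x(1) _ A])
  qed
  ultimately show ?thesis by blast
qed

end

section \<open>Local quotients of \<open>G\<close> by \<open>F\<close>\<close>

lemma local_quotient_nonsingular:
  fixes A :: "('m::{t2_space,second_countable_topology}, 'e::euclidean_space) chart set"
  assumes A: "chart_system A" and F: "smooth_vector_field A F" and G: "smooth_vector_field A G"
    and par: "\<And>c x. c \<in> A \<Longrightarrow> x \<in> fst c \<Longrightarrow> F x c \<noteq> 0 \<Longrightarrow>
      G x c = ((G x c \<bullet> F x c) / (F x c \<bullet> F x c)) *\<^sub>R F x c"
    and c: "c \<in> A" "x \<in> fst c" and Fx: "F x c \<noteq> 0"
  shows "\<exists>U a. open U \<and> snd c x \<in> U \<and> (\<forall>k. Ck_on k U a) \<and>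
    (\<forall>y\<in>fst c. snd c y \<in> U \<longrightarrow> F y c \<noteq> 0 \<and> G y = (\<lambda>d. a (snd c y) *\<^sub>R F y d))"
proof -
  let ?S = "snd c ` fst c"
  have p: "snd c x \<in> ?S" using c by blast
  obtain U1 f where U1: "open U1" "snd c x \<in> U1" and f: "\<And>k. Ck_on k U1 f"
    and feq: "\<And>q. q \<in> ?S \<inter> U1 \<Longrightarrow> f q = F (chart_inv c q) c"
    using smooth_vector_field_chart[OF F c(1)] p unfolding smooth_on_def by meson
  obtain U2 g where U2: "open U2" "snd c x \<in> U2" and g: "\<And>k. Ck_on k U2 g"
    and geq: "\<And>q. q \<in> ?S \<inter> U2 \<Longrightarrow> g q = G (chart_inv c q) c"
    using smooth_vector_field_chart[OF G c(1)] p unfolding smooth_on_def by meson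
  define U where "U = (U1 \<inter> U2) \<inter> f -` (- {0})"
  have "continuous_on (U1 \<inter> U2) f"
    using Ck_on_imp_continuous_on[OF f] by (rule continuous_on_subset) auto
  then have "open U"
    unfolding U_def by (rule continuous_open_preimage) (use U1 U2 in auto)
  moreover have "snd c x \<in> U"
    using U1 U2 feq[of "snd c x"] p Fx chart_inv_chart[OF A c] by (simp add: U_def)
  moreover have "Ck_on k U (\<lambda>y. (g y \<bullet> f y) / (f y \<bullet> f y))" for k
    by (intro Ck_on_divide Ck_on_inner \<open>open U\<close> Ck_on_subset[OF f] Ck_on_subset[OF g]) (auto simp: U_def)
  moreover have "F y c \<noteq> 0 \<and> G y = (\<lambda>d. ((g (snd c y) \<bullet> f (snd c y)) / (f (snd c y) \<bullet> f (snd c y))) *\<^sub>R F y d)"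
    if y: "y \<in> fst c" "snd c y \<in> U" for y
  proof -
    have e: "f (snd c y) = F y c" "g (snd c y) = G y c"
      using feq[of "snd c y"] geq[of "snd c y"] y chart_inv_chart[OF A c(1)] by (auto simp: U_def)
    then have F0: "F y c \<noteq> 0" using y(2) by (auto simp: U_def)
    show ?thesis
      unfolding e using F0 tangent_space_chart_scale[OF smooth_vector_field_tangent[OF G]
        smooth_vector_field_tangent[OF F] c(1) y(1) par[OF c(1) y(1) F0] A] by blast
  qed
  ultimately show ?thesis by (intro exI[of _ U] exI[of _ "\<lambda>y. (g y \<bullet> f y) / (f y \<bullet> f y)"]) blast
qed

theorem local_quotient:
  fixes A :: "('m::{t2_space,second_countable_topology}, 'e::euclidean_space) chart set"
  assumes M: "smooth_manifold b A" and F: "smooth_vector_field A F" and G: "smooth_vector_field A G"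
    and tan: "chart_tangent b A F" and orb: "\<And>x. \<exists>y. orbit A G x \<subseteq> orbit A F y"
    and V: "open V" "z \<in> V" and Sh: "Sh A F V = \<E>_id A F V \<infinity>" and lift: "smooth_path_lifting A F V"
    and c: "c \<in> A" "z \<in> fst c"
  shows "\<exists>U a. open U \<and> snd c z \<in> U \<and> (\<forall>k. Ck_on k U a) \<and>
    (\<forall>x\<in>fst c. snd c x \<in> U \<longrightarrow> F x \<noteq> (\<lambda>c. 0) \<longrightarrow> G x = (\<lambda>d. a (snd c x) *\<^sub>R F x d))"
proof -
  note A = smooth_manifold_chart_system[OF M]
  let ?S = "snd c ` fst c" and ?p = "snd c z"
  have p: "?p \<in> ?S" using c by blast
  obtain N where N: "open N" "snd c ` (fst c \<inter> V) = ?S \<inter> N"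
    using chart_image_open[OF A c(1) V(1)] by blast
  have "openin (top_of_set (half_space b)) (snd c ` (fst c \<inter> V))"
    unfolding N(2) using chart_image_half_space(1)[OF M c(1)] N(1) openin_Int_open by blast
  moreover have "?p \<in> snd c ` (fst c \<inter> V)" using c V by blast
  ultimately obtain \<epsilon>0 where \<epsilon>0: "\<epsilon>0 > 0" "ball ?p \<epsilon>0 \<inter> half_space b \<subseteq> snd c ` (fst c \<inter> V)"
    using openin_half_space_ball by blast
  obtain rF XF hF where coF: "cutoff ?S (\<lambda>y. F (chart_inv c y) c) ?p rF XF hF"
    using smooth_on_cutoff[OF smooth_vector_field_chart[OF F c(1)] p zero_less_one] by blast
  \<comment> \<open>The support of \<open>Y\<close> must lie where \<open>XF\<close> still coincides
    with \<open>F\<close>, and the closed ball of radius \<open>r\<close> must fit into the ball of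
    radius \<open>\<epsilon>0\<close>, whose part in the half-space lies in the image of
    \<open>V\<close>.\<close>
  have "min (rF / 2) (\<epsilon>0 / 2) > 0" using cutoff_pos[OF coF] \<epsilon>0(1) by simp
  then obtain r Y h where r: "r \<le> min (rF / 2) (\<epsilon>0 / 2)"
    and co: "cutoff ?S (\<lambda>y. G (chart_inv c y) c) ?p r Y h"
    using smooth_on_cutoff[OF smooth_vector_field_chart[OF G c(1)] p] by blast
  obtain \<Phi> where \<Phi>: "is_flow Y \<Phi>" using is_flow_exists[OF co] by blast
  interpret subordinate_flow b A F G V c ?p rF r XF Y hF h \<Phi>
  proof
    show "chart_tangent b A G" by (rule subordinate_field_singular(1)[OF M F G tan orb])
    show "G x = (\<lambda>c. 0)" if "F x = (\<lambda>c. 0)" for x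
      by (rule subordinate_field_singular(2)[OF M F G tan orb that])
    show "G x c = ((G x c \<bullet> F x c) / (F x c \<bullet> F x c)) *\<^sub>R F x c" if "c \<in> A" "x \<in> fst c" "F x c \<noteq> 0" for c x
      by (rule parallel_chart[OF M F G orb that])
    show "r \<le> rF / 2" using r by simp
    have "cball ?p r \<subseteq> ball ?p \<epsilon>0" using r \<epsilon>0(1) by auto
    then show "cball ?p r \<inter> half_space b \<subseteq> snd c ` (fst c \<inter> V)" using \<epsilon>0(2) by blast
  qed (fact M F G tan V(1) c(1) coF co \<Phi>)+
  show ?thesis by (rule quotient_extension[OF Sh lift p])
qed

section \<open>Parameter rigidity\<close>

theorem theorem4p4:
  fixes A :: "('m::{t2_space,second_countable_topology}, 'e::euclidean_space) chart set"
    and b :: 'e and F :: "('m, 'e) vector_field"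
  assumes "smooth_manifold b A"
    and "smooth_vector_field A F"
    and "tangent_to_boundary b A F"
    and "\<And>z. z \<in> singular_set F \<Longrightarrow>
           \<exists>V. open V \<and> z \<in> V \<and> Sh A F V = \<E>_id A F V \<infinity> \<and> smooth_path_lifting A F V"
  shows "parameter_rigid A F"
  unfolding parameter_rigid_def
proof (intro allI impI, elim conjE)
  fix G assume G: "smooth_vector_field A G" and "\<forall>x. \<exists>y. orbit A G x \<subseteq> orbit A F y"
  then have orb: "\<And>x. \<exists>y. orbit A G x \<subseteq> orbit A F y" by blast
  note M = assms(1) and F = assms(2)
  note A = smooth_manifold_chart_system[OF M]
  note tan = tangent_to_boundary_chart[OF assms(3)]
  have sing: "G x = (\<lambda>c. 0)" if "F x = (\<lambda>c. 0)" for x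
    by (rule subordinate_field_singular(2)[OF M F G tan orb that])
  \<comment> \<open>Off the zeros of \<open>F\<close> the factor is unique, so the chosen one agrees
    with every local quotient.\<close>
  define \<alpha>1 :: "'m \<Rightarrow> real" where "\<alpha>1 x = (SOME a. G x = (\<lambda>c. a *\<^sub>R F x c))" for x
  have \<alpha>1_eq: "\<alpha>1 x = a" if "F x \<noteq> (\<lambda>c. 0)" "G x = (\<lambda>c. a *\<^sub>R F x c)" for x a
  proof -
    have "G x = (\<lambda>c. \<alpha>1 x *\<^sub>R F x c)" unfolding \<alpha>1_def by (rule someI[of _ a]) (rule that(2))
    then have "\<alpha>1 x *\<^sub>R F x c = a *\<^sub>R F x c" for c using that(2) by metis
    moreover have "\<exists>c. F x c \<noteq> 0" using that(1) by auto
    ultimately show ?thesis by (metis scaleR_right_imp_eq)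
  qed
  define \<Sigma> where "\<Sigma> = singular_set F"
  \<comment> \<open>On \<Sigma> both fields vanish and any value satisfies the equation; smoothness
    singles out the limit from outside \<Sigma>, which exists because it is the value of a local
    quotient.\<close>
  define \<alpha> where "\<alpha> x = (if x \<in> \<Sigma> then Lim (at x within - \<Sigma>) \<alpha>1 else \<alpha>1 x)" for x
  have loc: "\<exists>W c a U. open W \<and> x \<in> W \<and> c \<in> A \<and> W \<subseteq> fst c \<and> open U \<and> snd c ` W \<subseteq> U \<and> (\<forall>k. Ck_on k U a) \<and>
      (\<forall>y\<in>W. \<alpha> y = a (snd c y)) \<and> (\<forall>y\<in>W. y \<notin> \<Sigma> \<longrightarrow> G y = (\<lambda>d. a (snd c y) *\<^sub>R F y d))" for x
  proof -
    obtain c where c: "c \<in> A" "x \<in> fst c" using chart_cover[OF A] by blast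
    have preim: "\<exists>W. open W \<and> fst c \<inter> snd c -` U = W" if "open U" for U
      using continuous_open_preimage[OF chart_continuous[OF A c(1)] chart_open[OF A c(1)] that] by blast
    show ?thesis
    proof (cases "x \<in> \<Sigma>")
      case False
      then have "F x c \<noteq> 0"
        using tangent_space_chart_zero[OF smooth_vector_field_tangent[OF F] c _ A] by (auto simp: \<Sigma>_def singular_set_def)
      from local_quotient_nonsingular[OF A F G parallel_chart[OF M F G orb] c this]
      obtain U a where U: "open U" "snd c x \<in> U" "\<forall>k. Ck_on k U a"
        and a: "\<forall>y\<in>fst c. snd c y \<in> U \<longrightarrow> F y c \<noteq> 0 \<and> G y = (\<lambda>d. a (snd c y) *\<^sub>R F y d)" by blast
      obtain W where W: "open W" "fst c \<inter> snd c -` U = W" using preim[OF U(1)] by blast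
      have "\<alpha> y = a (snd c y)" if "y \<in> W" for y
      proof -
        have y: "F y c \<noteq> 0" "G y = (\<lambda>d. a (snd c y) *\<^sub>R F y d)" using a that W(2) by auto
        then have "F y \<noteq> (\<lambda>c. 0)" by auto
        then show ?thesis using \<alpha>1_eq[OF _ y(2)] by (simp add: \<alpha>_def \<Sigma>_def singular_set_def)
      qed
      then show ?thesis
        using U W c a by (intro exI[of _ W] exI[of _ c] exI[of _ a] exI[of _ U]) auto
    next
      case True
      then obtain V where V: "open V" "x \<in> V" "Sh A F V = \<E>_id A F V \<infinity>" "smooth_path_lifting A F V"
        using assms(4) unfolding \<Sigma>_def by blast
      obtain U a where U: "open U" "snd c x \<in> U" "\<forall>k. Ck_on k U a"
        and a: "\<forall>y\<in>fst c. snd c y \<in> U \<longrightarrow> F y \<noteq> (\<lambda>c. 0) \<longrightarrow> G y = (\<lambda>d. a (snd c y) *\<^sub>R F y d)"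
        using local_quotient[OF M F G tan orb V c] by blast
      obtain W0 where W0: "open W0" "fst c \<inter> snd c -` U = W0" using preim[OF U(1)] by blast
      define W where "W = W0 \<inter> V"
      have W: "open W" "x \<in> W" "W \<subseteq> fst c" "snd c ` W \<subseteq> U"
        using W0 V c U by (auto simp: W_def)
      have aW: "G y = (\<lambda>d. a (snd c y) *\<^sub>R F y d)" if "y \<in> W" "y \<notin> \<Sigma>" for y
        using a that W0 by (auto simp: W_def \<Sigma>_def singular_set_def)
      have \<alpha>1W: "\<alpha>1 y = a (snd c y)" if "y \<in> W" "y \<notin> \<Sigma>" for y
        using \<alpha>1_eq[OF _ aW[OF that]] that(2) by (simp add: \<Sigma>_def singular_set_def)
      have "\<alpha> y = a (snd c y)" if y: "y \<in> W" for y
      proof (cases "y \<in> \<Sigma>")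
        case y\<Sigma>: True
        have "continuous_on W (\<lambda>y. a (snd c y))"
          using W U(3) by (intro continuous_on_compose2[OF Ck_on_imp_continuous_on[of 0 U a]]
              continuous_on_subset[OF chart_continuous[OF A c(1)]]) auto
        then have "((\<lambda>y. a (snd c y)) \<longlongrightarrow> a (snd c y)) (at y)"
          using W(1) y unfolding continuous_on_def by (metis at_within_open)
        then have "((\<lambda>y. a (snd c y)) \<longlongrightarrow> a (snd c y)) (at y within - \<Sigma>)"
          by (rule tendsto_within_subset) simp
        moreover have "\<forall>\<^sub>F w in at y within - \<Sigma>. a (snd c w) = \<alpha>1 w"
          unfolding eventually_at_topological using W(1) y \<alpha>1W by (intro exI[of _ W]) auto
        ultimately have "(\<alpha>1 \<longlongrightarrow> a (snd c y)) (at y within - \<Sigma>)"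
          by (rule Lim_transform_eventually)
        \<comment> \<open>Otherwise an open set around \<open>y\<close> inside \<open>V\<close>
          would consist of zeros of \<open>F\<close>, contrary to the nowhere density built into
          \<open>smooth_path_lifting\<close>.\<close>
        moreover have "at y within - \<Sigma> \<noteq> bot"
        proof
          assume "at y within - \<Sigma> = bot"
          then have "y \<notin> closure (- \<Sigma> - {y})" by (simp add: at_within_eq_bot_iff)
          then have "y \<in> - closure (- \<Sigma>)" using y\<Sigma> by (simp add: Diff_insert_absorb)
          then have o: "y \<in> - closure (- \<Sigma>) \<inter> V" using y by (simp add: W_def)
          have "- closure (- \<Sigma>) \<subseteq> \<Sigma>" using closure_subset[of "- \<Sigma>"] by blast
          then have "- closure (- \<Sigma>) \<inter> V \<subseteq> closure (\<Sigma> \<inter> V)" using closure_subset[of "\<Sigma> \<inter> V"] by blast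
          moreover have "open (- closure (- \<Sigma>) \<inter> V)" using V(1) by (intro open_Int) auto
          ultimately have "y \<in> interior (closure (\<Sigma> \<inter> V))" using o interior_maximal by blast
          then show False using V(4) o unfolding smooth_path_lifting_def \<Sigma>_def by blast
        qed
        ultimately have "Lim (at y within - \<Sigma>) \<alpha>1 = a (snd c y)" by (intro tendsto_Lim)
        then show ?thesis using y\<Sigma> by (simp add: \<alpha>_def)
      next
        case False
        then show ?thesis using \<alpha>1W[OF y] by (simp add: \<alpha>_def)
      qed
      then show ?thesis
        using W U c aW by (intro exI[of _ W] exI[of _ c] exI[of _ a] exI[of _ U]) auto
    qed
  qed
  have "smooth_map A euclidean_atlas UNIV \<alpha>"
  proof (rule smooth_mapI_local[OF A chart_system_euclidean])
    fix x
    obtain W c a U where W: "open W" "x \<in> W" "c \<in> A" "W \<subseteq> fst c" "open U" "snd c ` W \<subseteq> U" "\<forall>k. Ck_on k U a"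
      and a: "\<forall>y\<in>W. \<alpha> y = a (snd c y)"
      using loc[of x] by (elim exE conjE)
    have "continuous_on W (\<lambda>y. a (snd c y))"
      using W by (intro continuous_on_compose2[OF Ck_on_imp_continuous_on[of 0 U a]]
          continuous_on_subset[OF chart_continuous[OF A W(3)]]) auto
    then have "continuous_on W \<alpha>" by (rule continuous_on_eq) (use a in auto)
    moreover have "smooth_on (snd c ` {y \<in> fst c \<inter> UNIV \<inter> W. \<alpha> y \<in> fst (UNIV, id :: real \<Rightarrow> real)}) (local_rep c (UNIV, id) \<alpha>)"
    proof (rule smooth_on_cong[OF smooth_onI_Ck[OF W(5)]])
      show "snd c ` {y \<in> fst c \<inter> UNIV \<inter> W. \<alpha> y \<in> fst (UNIV, id :: real \<Rightarrow> real)} \<subseteq> U" using W(6) by auto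
      show "Ck_on k U a" for k using W(7) by blast
      fix q assume "q \<in> snd c ` {y \<in> fst c \<inter> UNIV \<inter> W. \<alpha> y \<in> fst (UNIV, id :: real \<Rightarrow> real)}"
      then obtain y where "q = snd c y" "y \<in> fst c" "y \<in> W" by auto
      then show "a q = local_rep c (UNIV, id) \<alpha> q"
        using a chart_inv_chart[OF A W(3)] by (simp add: local_rep_def)
    qed
    ultimately show "\<exists>V. open V \<and> x \<in> V \<and> continuous_on (UNIV \<inter> V) \<alpha> \<and> (\<exists>c0\<in>A. \<exists>d0\<in>euclidean_atlas. x \<in> fst c0 \<and> \<alpha> x \<in> fst d0 \<and>
      smooth_on (snd c0 ` {y \<in> fst c0 \<inter> UNIV \<inter> V. \<alpha> y \<in> fst d0}) (local_rep c0 d0 \<alpha>))"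
      using W by (intro exI[of _ W] conjI bexI[of _ c] bexI[of _ "(UNIV, id)"]) (auto simp: euclidean_atlas_def)
  qed
  moreover have "G x = (\<lambda>c. \<alpha> x *\<^sub>R F x c)" for x
  proof (cases "x \<in> \<Sigma>")
    case True
    then have "F x = (\<lambda>c. 0)" by (simp add: \<Sigma>_def singular_set_def)
    then show ?thesis using sing by simp
  next
    case False
    obtain W c a U where "open W" "x \<in> W" "c \<in> A" "W \<subseteq> fst c" "open U" "snd c ` W \<subseteq> U" "\<forall>k. Ck_on k U a"
      "\<forall>y\<in>W. \<alpha> y = a (snd c y)" "\<forall>y\<in>W. y \<notin> \<Sigma> \<longrightarrow> G y = (\<lambda>d. a (snd c y) *\<^sub>R F y d)"
      using loc[of x] by (elim exE conjE)
    then show ?thesis using False by simp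
  qed
  ultimately show "\<exists>\<alpha>::'m \<Rightarrow> real. smooth_map A euclidean_atlas UNIV \<alpha> \<and> (\<forall>x. G x = (\<lambda>c. \<alpha> x *\<^sub>R F x c))"
    by blast
qed

end
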